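(* Let $n \ge 1$ and let $G = \prod_{i=1}^n G_i$ be a (non-trivial) direct product of finitely many hereditarily just infinite profinite groups $G_1, \ldots, G_n$, each of finite lower rank. Set \[ d = \max\{\mathrm{lr}(G_i) \mid 1 \le i \le n\} \quad \text{and} \quad r = \max\{ r_p \mid p \text{ prime}\}, \] where, for each prime $p$, $r_p$ denotes the number of indices $i \in \{1,\ldots,n\}$ such that $G_i$ is virtually-$\mathbb{Z}_p$. Then the lower rank of $G$ is $\mathrm{lr}(G) = \max\{d, r\}$.
   Context: A profinite group $G$ is just infinite if $G$ is infinite and every non-trivial closed normal subgroup of $G$ is open in $G$. It is hereditarily just infinite if every open subgroup of $G$ is just infinite. For a profinite group $H$, $\mathrm{d}(H)$ denotes the minimal number of topological generators of $H$ (with value $\infty$ if $H$ is not topologically finitely generated). The lower rank of a profinite group $G$ is \[ \mathrm{lr}(G) = \liminf\{ \mathrm{d}(H) \mid H \text{ an open subgroup of } G\} \in \mathbb{N}_0 \cup \{\infty\}, \] the limit inferior being taken over the net of open subgroups of $G$ ordered by reverse inclusion, that is, $\mathrm{lr}(G) = \sup_{U} \inf\{\mathrm{d}(H) \mid H \le U,\ H \text{ open in } G\}$, with $U$ ranging over the open subgroups of $G$. Equivalently, for countably based $G$, $\mathrm{lr}(G) \le k$ if and only if there is a descending chain of $k$-generated open subgroups of $G$ that form a neighbourhood base for the identity. A profinite group is virtually-$\mathbb{Z}_p$ if it has an open subgroup that is an infinite procyclic pro-$p$ group, i.e. isomorphic to the additive group $\mathbb{Z}_p$ of $p$-adic integers.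 *)

theory Defs
  imports "HOL-Analysis.Analysis" "HOL-Algebra.Product_Groups" "HOL-Library.Extended_Nat"
begin

text \<open>
  A topological group is given by an algebraic group \<open>G\<close> together with an abstract topology \<open>T\<close>
  on its carrier. A closed (or open) subgroup \<open>H\<close> is regarded as a topological group in its own
  right via \<open>G\<lparr>carrier := H\<rparr>\<close> and \<open>subtopology T H\<close>.
\<close>

locale topological_group = group G for G (structure) and T :: "'a topology" +
  assumes topspace_eq: "topspace T = carrier G"
    and continuous_mult: "continuous_map (prod_topology T T) T (\<lambda>(x, y). x \<otimes> y)"
    and continuous_inv: "continuous_map T T (\<lambda>x. inv x)"

locale profinite_group = topological_group +
  assumes compact: "compact_space T"
    and Hausdorff: "Hausdorff_space T"
    and totally_disconnected: "\<And>x. x \<in> topspace T \<Longrightarrow> connected_component_of_set T x = {x}"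

definition open_subgroups :: "'a monoid \<Rightarrow> 'a topology \<Rightarrow> 'a set set"
  where "open_subgroups G T = {H. subgroup H G \<and> openin T H}"

definition just_infinite :: "'a monoid \<Rightarrow> 'a topology \<Rightarrow> bool"
  where "just_infinite G T \<longleftrightarrow> infinite (carrier G) \<and>
    (\<forall>N. N \<lhd> G \<and> closedin T N \<and> N \<noteq> {\<one>\<^bsub>G\<^esub>} \<longrightarrow> openin T N)"

definition hereditarily_just_infinite :: "'a monoid \<Rightarrow> 'a topology \<Rightarrow> bool"
  where "hereditarily_just_infinite G T \<longleftrightarrow>
    (\<forall>H \<in> open_subgroups G T. just_infinite (G\<lparr>carrier := H\<rparr>) (subtopology T H))"

definition topologically_generates :: "'a monoid \<Rightarrow> 'a topology \<Rightarrow> 'a set \<Rightarrow> bool"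
  where "topologically_generates G T S \<longleftrightarrow>
    S \<subseteq> carrier G \<and> T closure_of (generate G S) = carrier G"

text \<open>The infimum of the empty set of extended naturals is \<open>\<infinity>\<close>.\<close>

definition min_generators :: "'a monoid \<Rightarrow> 'a topology \<Rightarrow> enat"
  where "min_generators G T =
    (INF S \<in> {S. finite S \<and> topologically_generates G T S}. enat (card S))"

definition lower_rank :: "'a monoid \<Rightarrow> 'a topology \<Rightarrow> enat"
  where "lower_rank G T =
    (SUP U \<in> open_subgroups G T. INF H \<in> {H \<in> open_subgroups G T. H \<subseteq> U}.
      min_generators (G\<lparr>carrier := H\<rparr>) (subtopology T H))"

definition pro_p_group :: "nat \<Rightarrow> 'a monoid \<Rightarrow> 'a topology \<Rightarrow> bool"
  where "pro_p_group p G T \<longleftrightarrow> profinite_group G T \<and>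
    (\<forall>N. N \<lhd> G \<and> openin T N \<longrightarrow> (\<exists>k. card (rcosets\<^bsub>G\<^esub> N) = p ^ k))"

definition procyclic :: "'a monoid \<Rightarrow> 'a topology \<Rightarrow> bool"
  where "procyclic G T \<longleftrightarrow>
    profinite_group G T \<and> (\<exists>x \<in> carrier G. topologically_generates G T {x})"

definition virtually_Zp :: "nat \<Rightarrow> 'a monoid \<Rightarrow> 'a topology \<Rightarrow> bool"
  where "virtually_Zp p G T \<longleftrightarrow>
    (\<exists>H \<in> open_subgroups G T. infinite H \<and>
      procyclic (G\<lparr>carrier := H\<rparr>) (subtopology T H) \<and>
      pro_p_group p (G\<lparr>carrier := H\<rparr>) (subtopology T H))"

end

theory Submission
  imports Defs
begin

text \<open>
  The lower bound follows by projecting: onto a single factor, and onto the virtually-\<open>\<int>\<^sub>p\<close> factors,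
  where the image in \<open>(\<int>/p\<^sup>N)\<^sup>r\<close> of an open subgroup with \<open>s\<close> generators has at most \<open>(p\<^sup>N)\<^sup>s\<close> elements
  but index bounded independently of \<open>N\<close>, which forces \<open>r \<le> s\<close>.

  For the upper bound, choose small open subgroups \<open>H\<^sub>i\<close> of the factors with \<open>m = max d r\<close> generators
  and let \<open>K\<close> be generated by the \<open>m\<close> tuples of these generators. Then \<open>K\<close> projects onto every \<open>H\<^sub>i\<close>,
  so \<open>K\<close> is open as soon as it contains, for each \<open>i\<close>, a non-trivial element supported at \<open>i\<close>
  only. Virtually abelian factors have \<open>H\<^sub>i \<cong> \<int>\<^sub>p\<close>; those with the same \<open>p\<close> put their generator
  at different positions of the tuple, and different primes are separated by taking powers. If
  \<open>G\<^sub>i\<close> is not virtually abelian, a Goursat argument and commutators produce the element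
  unless \<open>H\<^sub>i\<close> is isomorphic to another \<open>H\<^sub>j\<close>. This is avoided because a finitely generated just
  infinite group \<open>H\<close> that is not virtually abelian is not isomorphic to a proper open subgroup of
  itself: given such an embedding \<open>\<phi>\<close>, there is an open \<open>N\<close> with \<open>\<phi> N \<subseteq> N\<close> and all \<open>\<phi>\<^sup>s N\<close> normal in
  \<open>H\<close>; the centralisers of the factors \<open>\<phi>\<^sup>i N / \<phi>\<^sup>i\<^sup>+\<^sup>s N\<close> have bounded index, hence open intersection, hence
  contain some \<open>\<phi>\<^sup>t N\<close>, and applying \<open>\<phi>\<^sup>-\<^sup>t\<close> to \<open>[\<phi>\<^sup>t N, \<phi>\<^sup>t N] \<subseteq> \<phi>\<^sup>t\<^sup>+\<^sup>s N\<close> for every \<open>s\<close> shows that \<open>N\<close> is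
  abelian.
\<close>

section \<open>Topological and profinite groups\<close>

text \<open>The obstacle is the diagonal: if the chosen subgroups of two factors are isomorphic,
  tuples of generators may generate only the graph of an isomorphism. For just infinite groups this
  is the only obstruction: if every element of \<open>K\<close> that is trivial at \<open>j\<close>
  is trivial at \<open>i\<close>, then \<open>H i\<close> is an infinite quotient of
  \<open>H j\<close>, hence isomorphic to it. The factors themselves may well be isomorphic, so the
  subgroups inside them must be made different, and this is what the result on self-embeddings
  provides. Finite generation, supplied by finite lower rank, enters there: an action on a fixed
  finite set is determined by the generators, so only finitely many actions occur. The subgroup
  \<open>N\<close> is non-trivial because compactness yields an element of it outside the image of
  \<phi>; being closed and normal it is then open. For virtually abelian factors commutators are
  useless and self-embeddings do exist (multiplication by \<open>p\<close>). That is why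
  \<open>r\<close> enters: \<open>m\<close> positions of a tuple keep apart at most \<open>m\<close>
  factors with the same prime.\<close>

lemma openin_forall_compactin:
  assumes f: "continuous_map (prod_topology X Y) Z f" and C: "compactin Y C" and V: "openin Z V"
  shows "openin X {x \<in> topspace X. \<forall>y\<in>C. f (x, y) \<in> V}"
proof -
  define Y' where "Y' = subtopology Y C"
  have Y': "compact_space Y'" "topspace Y' = C"
    using C by (auto simp: Y'_def compactin_subspace)
  have "continuous_map (prod_topology X Y') (prod_topology X Y) id"
    unfolding Y'_def prod_topology_subtopology
    by (simp add: prod_topology_subtopology(2) continuous_map_from_subtopology)
  then have f': "continuous_map (prod_topology X Y') Z f"
    using f by (metis continuous_map_compose comp_id)
  \<comment> \<open>This is the tube lemma: the complement of the set in question is the projection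
    of the closed set on which \<open>f\<close> leaves \<open>V\<close>, and projection along a
    compact space is a closed map.\<close>
  let ?W = "{z \<in> topspace (prod_topology X Y'). f z \<in> V}"
  have "openin (prod_topology X Y') ?W"
    using f' V openin_continuous_map_preimage by blast
  then have "closedin (prod_topology X Y') (topspace (prod_topology X Y') - ?W)"
    by blast
  then have "closedin X (fst ` (topspace (prod_topology X Y') - ?W))"
    using closed_map_fst[OF Y'(1), of X] unfolding closed_map_def by blast
  moreover have "topspace X - fst ` (topspace (prod_topology X Y') - ?W)
      = {x \<in> topspace X. \<forall>y\<in>C. f (x, y) \<in> V}"
    using Y'(2) by (force simp: image_iff)
  ultimately show ?thesis
    by (metis openin_diff openin_topspace)
qed

section \<open>Continuity of group operations, cosets and open subgroups\<close>

context topological_group begin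

lemma continuous_map_mult:
  assumes "continuous_map X T f" "continuous_map X T g"
  shows "continuous_map X T (\<lambda>x. f x \<otimes> g x)"
proof -
  have "continuous_map X (prod_topology T T) (\<lambda>x. (f x, g x))"
    by (simp add: assms continuous_map_pairedI)
  from continuous_map_compose[OF this continuous_mult] show ?thesis by (simp add: o_def)
qed

lemma continuous_map_minv:
  assumes "continuous_map X T f"
  shows "continuous_map X T (\<lambda>x. inv (f x))"
  using continuous_map_compose[OF assms continuous_inv] by (simp add: o_def)

lemma continuous_map_const_carrier:
  assumes "a \<in> carrier G"
  shows "continuous_map X T (\<lambda>x. a)"
  using assms by (simp add: topspace_eq)

lemma continuous_map_ident: "continuous_map T T (\<lambda>x. x)"
  by simp

lemmas continuous_group_intros =
  continuous_map_mult continuous_map_minv continuous_map_const_carrier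
  continuous_map_ident continuous_map_fst continuous_map_snd

lemma continuous_map_npow:
  assumes "continuous_map X T f"
  shows "continuous_map X T (\<lambda>x. f x [^] (n::nat))"
proof (induction n)
  case 0
  then show ?case by (simp add: topspace_eq)
next
  case (Suc n)
  then show ?case
    using assms by (simp add: continuous_map_mult)
qed

text \<open>Right translation by \<open>inv h \<otimes> v\<close> moves \<open>h\<close> to
  \<open>v\<close>; the preimage of \<open>V\<close> under it is a neighbourhood of \<open>h\<close>
  inside \<open>H\<close>.\<close>

lemma subgroup_openinI:
  assumes H: "subgroup H G" and V: "openin T V" "V \<subseteq> H" "V \<noteq> {}"
  shows "openin T H"
proof (subst openin_subopen, safe)
  fix h assume h: "h \<in> H"
  obtain v where v: "v \<in> V" using V(3) by blast
  have c: "h \<in> carrier G" "v \<in> carrier G"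
    using h v V(2) subgroup.subset[OF H] by auto
  let ?W = "{y \<in> topspace T. y \<otimes> (inv h \<otimes> v) \<in> V}"
  have "openin T ?W"
    by (rule openin_continuous_map_preimage[OF _ V(1)])
      (intro continuous_group_intros; use c in simp)
  moreover have "h \<in> ?W"
    using c v by (simp add: topspace_eq m_assoc[symmetric])
  moreover have "?W \<subseteq> H"
  proof
    fix y assume y: "y \<in> ?W"
    then have yc: "y \<in> carrier G" and "y \<otimes> (inv h \<otimes> v) \<in> H"
      using V(2) by (auto simp: topspace_eq)
    then have "(y \<otimes> (inv h \<otimes> v)) \<otimes> inv (inv h \<otimes> v) \<in> H"
      using H h v V(2) by (meson subgroup.m_closed subgroup.m_inv_closed subsetD)
    then show "y \<in> H"
      using yc c by (simp add: m_assoc)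
  qed
  ultimately show "\<exists>T'. openin T T' \<and> h \<in> T' \<and> T' \<subseteq> H" by blast
qed

lemma openin_coset:
  assumes H: "openin T H" and x: "x \<in> carrier G"
  shows "openin T (H #> x)"
proof -
  have "H #> x = {y \<in> topspace T. y \<otimes> inv x \<in> H}"
  proof (intro Set.set_eqI iffI)
    fix y assume "y \<in> H #> x"
    then obtain h where "h \<in> H" "y = h \<otimes> x" by (auto simp: r_coset_def)
    moreover have "h \<in> carrier G" using \<open>h \<in> H\<close> H openin_subset topspace_eq by blast
    ultimately show "y \<in> {y \<in> topspace T. y \<otimes> inv x \<in> H}"
      using x by (simp add: topspace_eq m_assoc)
  next
    fix y assume "y \<in> {y \<in> topspace T. y \<otimes> inv x \<in> H}"
    then have "y \<otimes> inv x \<in> H" "y = (y \<otimes> inv x) \<otimes> x"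
      using x by (auto simp: topspace_eq m_assoc)
    then show "y \<in> H #> x" unfolding r_coset_def by blast
  qed
  moreover have "openin T {y \<in> topspace T. y \<otimes> inv x \<in> H}"
    by (rule openin_continuous_map_preimage[OF _ H])
      (intro continuous_group_intros; use x in simp)
  ultimately show ?thesis by simp
qed

lemma open_subgroup_closedin:
  assumes H: "subgroup H G" and o: "openin T H"
  shows "closedin T H"
proof -
  have "topspace T - H = (\<Union>x \<in> carrier G - H. H #> x)"
  proof (intro Set.set_eqI iffI)
    fix y assume "y \<in> topspace T - H"
    then show "y \<in> (\<Union>x \<in> carrier G - H. H #> x)"
      using rcos_self[OF _ H] topspace_eq by blast
  next
    fix y assume "y \<in> (\<Union>x \<in> carrier G - H. H #> x)"
    then obtain x where x: "x \<in> carrier G" "x \<notin> H" "y \<in> H #> x" by blast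
    then obtain h where h: "h \<in> H" "y = h \<otimes> x" by (auto simp: r_coset_def)
    have hc: "h \<in> carrier G" using h H subgroup.mem_carrier by metis
    have "y \<notin> H"
    proof
      assume "y \<in> H"
      then have "inv h \<otimes> y \<in> H" using H h by (simp add: subgroup_def)
      then show False using x h hc by (simp add: m_assoc[symmetric])
    qed
    then show "y \<in> topspace T - H" using x h hc topspace_eq by simp
  qed
  moreover have "openin T (\<Union>x \<in> carrier G - H. H #> x)"
    by (rule openin_Union) (auto intro: openin_coset[OF o])
  ultimately show ?thesis
    using closedin_def o openin_subset by metis
qed

lemma closure_subgroup:
  assumes H: "subgroup H G"
  shows "subgroup (T closure_of H) G"
proof (rule subgroupI)
  show "T closure_of H \<subseteq> carrier G"
    using closure_of_subset_topspace topspace_eq by metis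
  have sub: "H \<subseteq> T closure_of H"
    by (simp add: H closure_of_subset subgroup.subset topspace_eq)
  then show "T closure_of H \<noteq> {}"
    using H subgroup.one_closed by blast
  fix a assume a: "a \<in> T closure_of H"
  have "(\<lambda>x. inv x) ` (T closure_of H) \<subseteq> T closure_of ((\<lambda>x. inv x) ` H)"
    using continuous_inv by (rule continuous_map_image_closure_subset)
  also have "\<dots> \<subseteq> T closure_of H"
    by (rule closure_of_mono) (use H subgroup.m_inv_closed in auto)
  finally show "inv a \<in> T closure_of H" using a by blast
  fix b assume b: "b \<in> T closure_of H"
  have "(\<lambda>(x,y). x \<otimes> y) ` (prod_topology T T closure_of (H \<times> H)) \<subseteq> T closure_of ((\<lambda>(x,y). x \<otimes> y) ` (H \<times> H))"
    using continuous_mult by (rule continuous_map_image_closure_subset)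
  also have "\<dots> \<subseteq> T closure_of H"
    by (rule closure_of_mono) (use H subgroup.m_closed in auto)
  finally show "a \<otimes> b \<in> T closure_of H" using a b by (force simp: closure_of_Times)
qed

lemma finite_rcosets_open:
  assumes C: "compact_space T" and H: "subgroup H G" and o: "openin T H"
  shows "finite (rcosets H)"
proof -
  have "\<And>U. U \<in> rcosets H \<Longrightarrow> openin T U"
    using openin_coset[OF o] by (auto simp: RCOSETS_def)
  moreover have "topspace T \<subseteq> \<Union> (rcosets H)"
    using rcosets_part_G[OF H] topspace_eq by simp
  ultimately obtain F where F: "finite F" "F \<subseteq> rcosets H" "topspace T \<subseteq> \<Union> F"
    using C unfolding compact_space_def compactin_def by (metis (no_types, lifting))
  have "rcosets H \<subseteq> F"
  proof
    fix A assume A: "A \<in> rcosets H"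
    then obtain x where "x \<in> A" "x \<in> carrier G"
      using rcos_self[OF _ H] by (auto simp: RCOSETS_def)
    then obtain B where "B \<in> F" "x \<in> B" using F topspace_eq by blast
    then show "A \<in> F"
      using rcos_disjoint[OF H] A F(2) \<open>x \<in> A\<close> by (metis disjnt_iff pairwiseD subsetD)
  qed
  then show ?thesis using F finite_subset by blast
qed

lemma topological_group_subgroup:
  assumes H: "subgroup H G"
  shows "topological_group (G\<lparr>carrier := H\<rparr>) (subtopology T H)"
proof -
  interpret H: group "G\<lparr>carrier := H\<rparr>" using H subgroup_imp_group by blast
  have sub: "H \<subseteq> carrier G" using H by (rule subgroup.subset)
  show ?thesis
  proof
    show 1: "topspace (subtopology T H) = carrier (G\<lparr>carrier := H\<rparr>)"
      using sub topspace_eq by auto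
    have "continuous_map (subtopology (prod_topology T T) (H \<times> H)) T (\<lambda>(x, y). x \<otimes> y)"
      using continuous_mult continuous_map_from_subtopology by blast
    then have "continuous_map (subtopology (prod_topology T T) (H \<times> H)) (subtopology T H) (\<lambda>(x, y). x \<otimes> y)"
      by (auto simp: continuous_map_in_subtopology subgroup.m_closed[OF H])
    then show "continuous_map (prod_topology (subtopology T H) (subtopology T H)) (subtopology T H)
     (\<lambda>(x, y). x \<otimes>\<^bsub>G\<lparr>carrier := H\<rparr>\<^esub> y)"
      by (simp add: subtopology_Times)
    have "continuous_map (subtopology T H) (subtopology T H) (\<lambda>x. inv x)"
      using continuous_map_from_subtopology[OF continuous_inv, of H]
      by (auto simp: continuous_map_in_subtopology subgroup.m_inv_closed[OF H])
    then show "continuous_map (subtopology T H) (subtopology T H) (\<lambda>x. inv\<^bsub>G\<lparr>carrier := H\<rparr>\<^esub> x)"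
      by (rule continuous_map_eq) (use 1 H in auto)
  qed
qed

text \<open>Multiplying a coset of \<open>A\<close> by \<open>B\<close> from the left gives the
  coset of \<open>B\<close> that contains it, and this map is onto the cosets of
  \<open>B\<close>.\<close>

lemma card_rcosets_mono:
  assumes A: "subgroup A G" and B: "subgroup B G" and AB: "A \<subseteq> B" and fin: "finite (rcosets A)"
  shows "finite (rcosets B)" "card (rcosets B) \<le> card (rcosets A)"
proof -
  have "rcosets B \<subseteq> (\<lambda>C. B <#> C) ` (rcosets A)"
  proof
    fix D assume "D \<in> rcosets B"
    then obtain x where x: "x \<in> carrier G" "D = B #> x" by (auto simp: RCOSETS_def)
    have "B <#> (A #> x) = B #> x"
    proof (intro Set.set_eqI iffI)
      fix y assume "y \<in> B <#> (A #> x)"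
      then obtain b a where ba: "b \<in> B" "a \<in> A" "y = b \<otimes> (a \<otimes> x)"
        by (auto simp: set_mult_def r_coset_def)
      then have "y = (b \<otimes> a) \<otimes> x"
        using x A B by (simp add: m_assoc subgroup.mem_carrier)
      moreover have "b \<otimes> a \<in> B" using ba AB subgroup.m_closed[OF B] by (simp add: subsetD)
      ultimately show "y \<in> B #> x" by (auto simp: r_coset_def)
    next
      fix y assume "y \<in> B #> x"
      then obtain b where b: "b \<in> B" "y = b \<otimes> (\<one> \<otimes> x)"
        using x by (auto simp: r_coset_def)
      moreover have "\<one> \<otimes> x \<in> A #> x"
        using subgroup.one_closed[OF A] by (auto simp: r_coset_def)
      ultimately show "y \<in> B <#> (A #> x)"
        by (auto simp: set_mult_def)
    qed
    then show "D \<in> (\<lambda>C. B <#> C) ` (rcosets A)"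
      using x by (auto simp: RCOSETS_def)
  qed
  then show "finite (rcosets B)" "card (rcosets B) \<le> card (rcosets A)"
    using finite_surj[OF fin] surj_card_le[OF fin] by simp_all
qed

end

section \<open>Open subgroups near the identity and compactness arguments\<close>

context profinite_group begin

text \<open>In a compact Hausdorff space components are quasi-components, so finitely many clopen
  sets separate the identity from the complement of \<open>U\<close>; this yields a clopen
  \<open>V\<close>. The elements that multiply \<open>V\<close> into itself from the right, together
  with their inverses, form a subgroup, which is open because \<open>V\<close> is compact.\<close>

lemma open_subgroup_in_nhd:
  assumes U: "openin T U" and one: "\<one> \<in> U"
  obtains W where "subgroup W G" "openin T W" "W \<subseteq> U"
proof -
  have q: "quasi_component_of_set T \<one> = {\<one>}"
  proof -
    have "quasi_component_of T \<one> = connected_component_of T \<one>"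
      by (rule quasi_eq_connected_component_of) (use compact Hausdorff in auto)
    then show ?thesis using totally_disconnected[of \<one>] topspace_eq by simp
  qed
  have C: "compactin T (topspace T - U)"
    using U by (simp add: closedin_compact_space compact closedin_diff)
  let ?\<F> = "{V. closedin T V \<and> openin T V \<and> \<one> \<in> V}"
  have "(topspace T - U) \<inter> \<Inter>?\<F> = {}"
  proof -
    have "y = \<one>" if "y \<in> topspace T" "\<forall>V\<in>?\<F>. y \<in> V" for y
    proof -
      have "quasi_component_of T \<one> y"
        unfolding quasi_component_of using that topspace_eq by auto
      then show ?thesis using q by auto
    qed
    then show ?thesis using one by blast
  qed
  then obtain F where F: "finite F" "F \<subseteq> ?\<F>" "(topspace T - U) \<inter> \<Inter>F = {}"
    using C unfolding compactin_fip by (metis (no_types, lifting) mem_Collect_eq)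
  \<comment> \<open>Intersecting with \<open>topspace T\<close> gives the right set when the finite
    family \<open>F\<close> is empty.\<close>
  define V where "V = topspace T \<inter> \<Inter>F"
  have V: "openin T V" "closedin T V" "\<one> \<in> V" "V \<subseteq> U"
  proof -
    have "openin T V" "closedin T V" if "F \<noteq> {}"
    proof -
      have "V = \<Inter>F" using that F(2) openin_subset unfolding V_def by blast
      then show "openin T V" "closedin T V"
        using F that by auto
    qed
    then show "openin T V" "closedin T V"
      unfolding V_def by (cases "F = {}"; simp)+
    show "\<one> \<in> V" using F(2) topspace_eq by (auto simp: V_def)
    show "V \<subseteq> U" using F(3) V_def by blast
  qed
  have Vc: "V \<subseteq> carrier G" using V(1) openin_subset topspace_eq by metis
  have cV: "compactin T V" using V(2) compact closedin_compact_space by blast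
  let ?A = "{x \<in> topspace T. \<forall>y\<in>V. (case (x,y) of (x,y) \<Rightarrow> y \<otimes> x) \<in> V}"
  have A: "openin T ?A"
    by (rule openin_forall_compactin[OF _ cV V(1)])
      (simp add: case_prod_beta continuous_group_intros)
  let ?B = "{x \<in> topspace T. inv x \<in> ?A}"
  have B: "openin T ?B"
    using openin_continuous_map_preimage[OF continuous_inv A] .
  have AV: "?A \<subseteq> V"
    using V(3) topspace_eq by auto
  have "subgroup (?A \<inter> ?B) G"
  proof (rule subgroupI)
    have "\<one> \<in> ?A \<inter> ?B"
      using Vc V(3) topspace_eq by (auto simp: subset_iff)
    then show "?A \<inter> ?B \<noteq> {}" by blast
    fix a b assume a: "a \<in> ?A \<inter> ?B"
    show "inv a \<in> ?A \<inter> ?B"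
      using a topspace_eq by auto
    assume b: "b \<in> ?A \<inter> ?B"
    have cc: "a \<in> carrier G" "b \<in> carrier G" using a b topspace_eq by auto
    have 1: "y \<otimes> (a \<otimes> b) \<in> V" "y \<otimes> inv (a \<otimes> b) \<in> V" if "y \<in> V" for y
    proof -
      have "y \<in> carrier G" using that Vc by auto
      then have "y \<otimes> (a \<otimes> b) = (y \<otimes> a) \<otimes> b" "y \<otimes> inv (a \<otimes> b) = (y \<otimes> inv b) \<otimes> inv a"
        using cc by (auto simp: m_assoc inv_mult_group)
      then show "y \<otimes> (a \<otimes> b) \<in> V" "y \<otimes> inv (a \<otimes> b) \<in> V"
        using a b that by auto
    qed
    then show "a \<otimes> b \<in> ?A \<inter> ?B" using cc topspace_eq by auto
  qed (use topspace_eq in auto)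
  moreover have "openin T (?A \<inter> ?B)" using A B by blast
  ultimately show ?thesis using AV V(4) that by blast
qed

lemma trivial_if_in_all_open_subgroups:
  assumes x: "x \<in> carrier G" and W: "\<And>W. subgroup W G \<Longrightarrow> openin T W \<Longrightarrow> x \<in> W"
  shows "x = \<one>"
proof (rule ccontr)
  assume "x \<noteq> \<one>"
  have "closedin T {x}"
    using x topspace_eq Hausdorff by (simp add: closedin_Hausdorff_singleton)
  then have "openin T (topspace T - {x})" by blast
  then obtain W where "subgroup W G" "openin T W" "W \<subseteq> topspace T - {x}"
    using open_subgroup_in_nhd[of "topspace T - {x}"] \<open>x \<noteq> \<one>\<close> topspace_eq by auto
  then show False using W by blast
qed

text \<open>Passes from approximate to exact solutions: the image of \<open>D\<close> is closed, so
  if it meets every neighbourhood of the identity it contains the identity. It later turns powers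
  that come close to the identity in one coordinate into an element that is trivial there.\<close>

lemma compact_image_hits_one:
  assumes D: "compactin X D" and f: "continuous_map X T f"
    and W: "\<And>W. subgroup W G \<Longrightarrow> openin T W \<Longrightarrow> \<exists>d\<in>D. f d \<in> W"
  shows "\<exists>d\<in>D. f d = \<one>"
proof (rule ccontr)
  assume n: "\<not> ?thesis"
  have "compactin T (f ` D)" using D f image_compactin by blast
  then have "closedin T (f ` D)" using Hausdorff compactin_imp_closedin by blast
  then have "openin T (topspace T - f ` D)" by blast
  moreover have "\<one> \<in> topspace T - f ` D" using n topspace_eq by force
  ultimately obtain V where "subgroup V G" "openin T V" "V \<subseteq> topspace T - f ` D"
    using open_subgroup_in_nhd by metis
  then show False using W[of V] by blast
qed

lemma profinite_group_closed_subgroup: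
  assumes H: "subgroup H G" and c: "closedin T H"
  shows "profinite_group (G\<lparr>carrier := H\<rparr>) (subtopology T H)"
proof -
  interpret H: topological_group "G\<lparr>carrier := H\<rparr>" "subtopology T H"
    using H by (rule topological_group_subgroup)
  show ?thesis
  proof
    show "compact_space (subtopology T H)"
      using c compact closedin_compact_space compact_space_subtopology by blast
    show "Hausdorff_space (subtopology T H)"
      using Hausdorff Hausdorff_space_subtopology by blast
    fix x assume x: "x \<in> topspace (subtopology T H)"
    then have "connected_component_of_set T x = {x}" using totally_disconnected by auto
    moreover have "connected_component_of_set (subtopology T H) x \<subseteq> connected_component_of_set T x"
      by (auto simp: connected_component_of_def connectedin_subtopology)
    moreover have "x \<in> connected_component_of_set (subtopology T H) x"
      using x connected_component_of_refl by fast
    ultimately show "connected_component_of_set (subtopology T H) x = {x}" by blast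
  qed
qed

end

section \<open>Open self-embeddings of just infinite groups\<close>

locale open_self_embedding = profinite_group G T for G :: "'a monoid" (structure) and T +
  fixes \<phi> :: "'a \<Rightarrow> 'a"
  assumes ji: "just_infinite G T"
    and \<phi>_hom: "\<phi> \<in> hom G G"
    and \<phi>_inj: "inj_on \<phi> (carrier G)"
    and \<phi>_cont: "continuous_map T T \<phi>"
    and \<phi>_open: "openin T (\<phi> ` carrier G)"
    and \<phi>_proper: "\<phi> ` carrier G \<noteq> carrier G"
begin

section \<open>Iterates of the embedding and indices of images\<close>

abbreviation e :: "nat \<Rightarrow> 'a \<Rightarrow> 'a" where "e t \<equiv> \<phi> ^^ t"

lemma e_closed [simp, intro]: "x \<in> carrier G \<Longrightarrow> e t x \<in> carrier G"
  by (induction t) (use \<phi>_hom in \<open>auto simp: hom_def Pi_iff\<close>)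

lemma e_hom: "e t \<in> hom G G"
proof (induction t)
  case (Suc t)
  then show ?case using \<phi>_hom by (auto simp: hom_def Pi_iff)
qed (auto simp: hom_def)

lemma e_group_hom: "group_hom G G (e t)"
  by (rule group_hom.intro) (auto simp: group_hom_axioms_def e_hom)

lemma e_mult: "x \<in> carrier G \<Longrightarrow> y \<in> carrier G \<Longrightarrow> e t (x \<otimes> y) = e t x \<otimes> e t y"
  using e_hom by (auto simp: hom_def)

lemma e_minv: "x \<in> carrier G \<Longrightarrow> e t (inv x) = inv (e t x)"
  using group_hom.hom_inv[OF e_group_hom] by blast

lemma e_one: "e t \<one> = \<one>"
  using group_hom.hom_one[OF e_group_hom] by blast

lemma e_eqD: "e t x = e t y \<Longrightarrow> x \<in> carrier G \<Longrightarrow> y \<in> carrier G \<Longrightarrow> x = y"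
proof (induction t)
  case (Suc t)
  then show ?case using \<phi>_inj by (auto simp: inj_on_def)
qed auto

lemma e_add: "e (s + t) x = e s (e t x)"
  by (simp add: funpow_add)

lemma e_cont: "continuous_map T T (e t)"
proof (induction t)
  case (Suc t)
  then show ?case using continuous_map_compose[OF Suc \<phi>_cont] by (simp add: o_def)
qed (simp add: id_def)

lemma e_openin: "openin T U \<Longrightarrow> openin T (e t ` U)"
proof (induction t)
  case (Suc t)
  have "embedding_map T T \<phi>"
    using \<phi>_cont compact Hausdorff \<phi>_inj topspace_eq by (simp add: continuous_imp_embedding_map)
  then have "open_map T (subtopology T (\<phi> ` carrier G)) \<phi>"
    unfolding embedding_map_def topspace_eq by (rule homeomorphic_imp_open_map)
  then have "openin (subtopology T (\<phi> ` carrier G)) (\<phi> ` (e t ` U))"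
    using Suc unfolding open_map_def by blast
  then show ?case using \<phi>_open openin_trans_full by (metis funpow.simps(2) image_comp)
qed auto

lemma e_closedin: "closedin T U \<Longrightarrow> closedin T (e t ` U)"
  using continuous_imp_closed_map[OF e_cont compact Hausdorff] by (auto simp: closed_map_def)

lemma e_subgroup: "subgroup N G \<Longrightarrow> subgroup (e t ` N) G"
  using group_hom.subgroup_img_is_subgroup[OF e_group_hom] .

text \<open>The images of the cosets of \<open>N\<close> are distinct cosets of the image of
  \<open>N\<close>, all inside the image of \<phi>. The coset of a \<open>y\<close> outside that
  image is not among them.\<close>

lemma card_rcosets_image_less:
  assumes N: "subgroup N G" and o: "openin T N"
  shows "card (rcosets N) < card (rcosets (\<phi> ` N))"
proof -
  have e1: "e 1 = \<phi>" by simp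
  have fin: "finite (rcosets (\<phi> ` N))"
    by (rule finite_rcosets_open[OF compact]) (use e_subgroup[OF N, of 1] e_openin[OF o, of 1] in auto)
  have Nc: "N \<subseteq> carrier G" using N by (rule subgroup.subset)
  have im: "\<phi> ` (N #> x) = \<phi> ` N #> \<phi> x" if "x \<in> carrier G" for x
  proof -
    have "\<phi> (n \<otimes> x) = \<phi> n \<otimes> \<phi> x" if "n \<in> N" for n
      using that \<open>x \<in> carrier G\<close> Nc \<phi>_hom by (auto simp: hom_def)
    then show ?thesis by (simp add: r_coset_def image_UN cong: SUP_cong_simp)
  qed
  have inj: "inj_on (\<lambda>C. \<phi> ` C) (rcosets N)"
    by (rule inj_on_subset[OF inj_on_image_Pow[OF \<phi>_inj]])
      (use rcosets_subset_PowG[OF N] in auto)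
  obtain y where y: "y \<in> carrier G" "y \<notin> \<phi> ` carrier G"
    using \<phi>_proper e_closed[of _ 1] by fastforce
  have y1: "y \<in> \<phi> ` N #> y" "\<phi> ` N #> y \<in> rcosets (\<phi> ` N)"
    using y e_subgroup[OF N, of 1] rcos_self by (auto simp: RCOSETS_def)
  have "(\<lambda>C. \<phi> ` C) ` (rcosets N) \<subseteq> rcosets (\<phi> ` N)"
  proof clarify
    fix C assume "C \<in> rcosets N"
    then obtain x where x: "x \<in> carrier G" "C = N #> x" by (auto simp: RCOSETS_def)
    then have "\<phi> x \<in> carrier G" "\<phi> ` N \<subseteq> carrier G"
      using e_closed[of _ 1] Nc by auto
    then show "\<phi> ` C \<in> rcosets (\<phi> ` N)"
      using x im rcosetsI by simp
  qed
  moreover have "\<phi> ` N #> y \<notin> (\<lambda>C. \<phi> ` C) ` (rcosets N)"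
    using y y1(1) rcosets_subset_PowG[OF N] by blast
  ultimately have "(\<lambda>C. \<phi> ` C) ` (rcosets N) \<subset> rcosets (\<phi> ` N)"
    using y1(2) by blast
  then have "card ((\<lambda>C. \<phi> ` C) ` (rcosets N)) < card (rcosets (\<phi> ` N))"
    using fin psubset_card_mono by blast
  then show ?thesis using inj by (simp add: card_image)
qed

text \<open>\<open>co t\<close> is the preimage under \<open>\<phi>\<^sup>t\<close> of the normal core of the image of \<open>\<phi>\<^sup>t\<close>.\<close>

definition co :: "nat \<Rightarrow> 'a set" where
  "co t = {x \<in> carrier G. \<forall>h\<in>carrier G. h \<otimes> e t x \<otimes> inv h \<in> e t ` carrier G}"

lemma coD: "x \<in> co t \<Longrightarrow> x \<in> carrier G"
  by (simp add: co_def)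

lemma co_subset: "co t \<subseteq> carrier G"
  by (auto simp: co_def)

lemma conj_mult: "\<lbrakk>h \<in> carrier G; x \<in> carrier G; y \<in> carrier G\<rbrakk> \<Longrightarrow>
   h \<otimes> (x \<otimes> y) \<otimes> inv h = (h \<otimes> x \<otimes> inv h) \<otimes> (h \<otimes> y \<otimes> inv h)"
  by (simp add: m_assoc inv_solve_left)

lemma conj_conj: "\<lbrakk>h \<in> carrier G; g \<in> carrier G; y \<in> carrier G\<rbrakk> \<Longrightarrow>
   h \<otimes> (g \<otimes> y \<otimes> inv g) \<otimes> inv h = (h \<otimes> g) \<otimes> y \<otimes> inv (h \<otimes> g)"
  by (simp add: m_assoc inv_mult_group)

lemma conj_inv: "\<lbrakk>h \<in> carrier G; y \<in> carrier G\<rbrakk> \<Longrightarrow>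
   h \<otimes> inv y \<otimes> inv h = inv (h \<otimes> y \<otimes> inv h)"
  by (simp add: m_assoc inv_mult_group)

lemma e_conj: "\<lbrakk>h \<in> carrier G; y \<in> carrier G\<rbrakk> \<Longrightarrow>
   e t (h \<otimes> y \<otimes> inv h) = e t h \<otimes> e t y \<otimes> inv (e t h)"
  by (simp add: e_mult e_minv)

lemma co_subgroup: "subgroup (co t) G"
proof (rule subgroupI[OF co_subset])
  have r: "subgroup (e t ` carrier G) G" by (simp add: e_subgroup subgroup_self)
  have "\<one> \<in> co t" using subgroup.one_closed[OF r] by (auto simp: co_def e_one)
  then show "co t \<noteq> {}" by blast
  fix a assume a: "a \<in> co t"
  show "inv a \<in> co t"
    using a subgroup.m_inv_closed[OF r] by (auto simp: co_def e_minv conj_inv)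
  fix b assume b: "b \<in> co t"
  show "a \<otimes> b \<in> co t"
    using a b subgroup.m_closed[OF r] by (auto simp: co_def e_mult conj_mult)
qed

lemma co_open: "openin T (co t)"
proof -
  have "openin T {x \<in> topspace T. \<forall>h\<in>carrier G. (case (x, h) of (x,h) \<Rightarrow> h \<otimes> e t x \<otimes> inv h) \<in> e t ` carrier G}"
  proof (rule openin_forall_compactin)
    show "compactin T (carrier G)" using compact topspace_eq compact_space_def by metis
    show "openin T (e t ` carrier G)" using e_openin topspace_eq openin_topspace by metis
    have "continuous_map (prod_topology T T) T (\<lambda>z. snd z \<otimes> e t (fst z) \<otimes> inv (snd z))"
      using continuous_map_compose[OF continuous_map_fst e_cont]
      by (intro continuous_group_intros) (simp add: o_def)
    moreover have "(\<lambda>(x, h). h \<otimes> e t x \<otimes> inv h) = (\<lambda>z. snd z \<otimes> e t (fst z) \<otimes> inv (snd z))"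
      by auto
    ultimately show "continuous_map (prod_topology T T) T (\<lambda>(x, h). h \<otimes> e t x \<otimes> inv h)"
      by metis
  qed
  then show ?thesis by (simp add: co_def topspace_eq)
qed

lemma co_conj:
  assumes x: "x \<in> co t" and h: "h \<in> carrier G"
  obtains x' where "x' \<in> co t" "e t x' = h \<otimes> e t x \<otimes> inv h"
proof -
  have xc: "x \<in> carrier G" using x by (rule coD)
  obtain x' where x': "x' \<in> carrier G" "e t x' = h \<otimes> e t x \<otimes> inv h"
    using x h by (force simp: co_def)
  have "g \<otimes> e t x' \<otimes> inv g \<in> e t ` carrier G" if g: "g \<in> carrier G" for g
    using x' x h g xc by (simp add: conj_conj) (simp add: co_def)
  then show ?thesis using x' that by (auto simp: co_def)
qed

text \<open>Only conjugators of the form \<open>\<phi> h\<close> are used: conjugating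
  \<open>e (Suc t) x\<close> by \<open>\<phi> h\<close> is \<phi> applied to the conjugate of
  \<open>e t x\<close> by \<open>h\<close>, and injectivity cancels one application of
  \<phi>.\<close>

lemma co_Suc: "co (Suc t) \<subseteq> co t"
proof
  fix x assume x: "x \<in> co (Suc t)"
  then have xc: "x \<in> carrier G" by (rule coD)
  have "h \<otimes> e t x \<otimes> inv h \<in> e t ` carrier G" if h: "h \<in> carrier G" for h
  proof -
    have "e 1 h \<otimes> e (Suc t) x \<otimes> inv (e 1 h) \<in> e (Suc t) ` carrier G"
      using x h by (auto simp: co_def simp del: funpow.simps)
    then obtain y where y: "y \<in> carrier G" "e 1 h \<otimes> e (Suc t) x \<otimes> inv (e 1 h) = e (Suc t) y"
      by (auto simp del: funpow.simps)
    then have "e 1 (h \<otimes> e t x \<otimes> inv h) = e 1 (e t y)"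
      using h xc e_add[of 1 t] by (simp add: e_conj del: funpow.simps)
    then have "h \<otimes> e t x \<otimes> inv h = e t y"
      by (rule e_eqD) (use h xc y in auto)
    then show ?thesis using y by blast
  qed
  then show "x \<in> co t" using xc by (auto simp: co_def)
qed

lemma co_decseq: "decseq co"
  using co_Suc by (simp add: decseq_Suc_iff)

text \<open>Otherwise \<open>co t \<subseteq> \<phi> (co t)\<close>, although \<open>\<phi>\<close> strictly increases the index of open subgroups.\<close>

lemma co_not_in_image: "\<not> co t \<subseteq> \<phi> ` carrier G"
proof
  assume a: "co t \<subseteq> \<phi> ` carrier G"
  have "co t \<subseteq> \<phi> ` co t"
  proof
    fix x assume x: "x \<in> co t"
    then obtain x1 where x1: "x1 \<in> carrier G" "x = \<phi> x1" using a by blast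
    have ex: "e t x = e (Suc t) x1" using x1 by (simp add: funpow_swap1)
    have "h \<otimes> e (Suc t) x1 \<otimes> inv h \<in> e (Suc t) ` carrier G" if h: "h \<in> carrier G" for h
    proof -
      obtain x' where x': "x' \<in> co t" "e t x' = h \<otimes> e t x \<otimes> inv h"
        using co_conj[OF x h] .
      obtain y where "y \<in> carrier G" "x' = \<phi> y" using a x' by blast
      then have "e t x' = e (Suc t) y" by (simp add: funpow_swap1)
      then show ?thesis using x' ex \<open>y \<in> carrier G\<close> by (metis imageI)
    qed
    then have "x1 \<in> co (Suc t)" using x1 by (auto simp: co_def simp del: funpow.simps)
    then show "x \<in> \<phi> ` co t" using co_Suc x1 by blast
  qed
  moreover have "subgroup (\<phi> ` co t) G" using e_subgroup[OF co_subgroup, of 1] by simp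
  ultimately have "card (rcosets (\<phi> ` co t)) \<le> card (rcosets (co t))"
    using card_rcosets_mono(2)[OF co_subgroup] finite_rcosets_open[OF compact co_subgroup co_open] by blast
  then show False using card_rcosets_image_less[OF co_subgroup co_open] by (simp add: not_le[symmetric])
qed

section \<open>The open subgroup \<open>N\<close> and the descending chain of its images\<close>

definition N :: "'a set" where "N = (\<Inter>t. co t)"

lemma N_co: "x \<in> N \<Longrightarrow> x \<in> co t" by (auto simp: N_def)

lemma N_carrier [simp]: "x \<in> N \<Longrightarrow> x \<in> carrier G"
  using N_co coD by blast

lemma N_subset: "N \<subseteq> carrier G" by auto

lemma N_subgroup: "subgroup N G"
  unfolding N_def by (rule subgroups_Inter) (use co_subgroup in auto)

lemma N_closed: "closedin T N"
  unfolding N_def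
  by (rule closedin_Inter) (use open_subgroup_closedin[OF co_subgroup co_open] in auto)

text \<open>The preimage \<open>x'\<close> found at level \<open>s\<close> does not depend on the
  level: applying \<open>e u\<close> turns its equation into the one at level \<open>s + u\<close>
  with conjugator \<open>e u h\<close>, whose solution lies in \<open>co (s + u)\<close> and is
  unique by injectivity. So \<open>x'\<close> lies in every \<open>co u\<close>. In effect every
  image of \<open>N\<close> is normal in the whole group.\<close>

lemma N_conj:
  assumes x: "x \<in> N" and h: "h \<in> carrier G"
  shows "\<exists>x'\<in>N. e s x' = h \<otimes> e s x \<otimes> inv h"
proof -
  have xc: "x \<in> carrier G" using x by simp
  obtain x' where x': "x' \<in> co s" "e s x' = h \<otimes> e s x \<otimes> inv h"
    using co_conj[OF N_co[OF x] h] .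
  have xc': "x' \<in> carrier G" using x' coD by blast
  have "x' \<in> co (s + u)" for u
  proof -
    have "e (s+u) x' = e u h \<otimes> e (s+u) x \<otimes> inv (e u h)"
      using x' h xc by (simp add: e_conj e_add[of u s, unfolded add.commute[of u]])
    moreover obtain x'' where "x'' \<in> co (s+u)" "e (s+u) x'' = e u h \<otimes> e (s+u) x \<otimes> inv (e u h)"
      using co_conj[OF N_co[OF x], of "e u h"] h by blast
    ultimately have "x' = x''"
      using e_eqD[of "s+u" x' x''] xc' coD by auto
    then show ?thesis using \<open>x'' \<in> co (s+u)\<close> by simp
  qed
  moreover have "co (s+t) \<subseteq> co t" for t using co_decseq by (simp add: decseq_def)
  ultimately have "x' \<in> N" unfolding N_def by blast
  then show ?thesis using x' by blast
qed

lemma normalI_conj: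
  assumes "subgroup H G" "\<And>x h. x \<in> H \<Longrightarrow> h \<in> carrier G \<Longrightarrow> h \<otimes> x \<otimes> inv h \<in> H"
  shows "H \<lhd> G"
  using assms normal_inv_iff by blast

lemma just_infinite_open: "\<lbrakk>H \<lhd> G; closedin T H; x \<in> H; x \<noteq> \<one>\<rbrakk> \<Longrightarrow> openin T H"
  using ji unfolding just_infinite_def by blast

lemma N_open: "openin T N"
proof -
  define C where "C t = co t - \<phi> ` carrier G" for t
  have "(\<Inter>t. C t) \<noteq> {}"
  proof (rule compact_space_imp_nest[OF compact])
    show "closedin T (C n)" for n
      using open_subgroup_closedin[OF co_subgroup co_open] \<phi>_open by (auto simp: C_def)
    show "C n \<noteq> {}" for n using co_not_in_image by (auto simp: C_def)
    show "decseq C" using co_decseq by (auto simp: C_def decseq_def)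
  qed
  then obtain x where "x \<in> N" "x \<notin> \<phi> ` carrier G" by (auto simp: C_def N_def)
  moreover have "\<one> \<in> \<phi> ` carrier G" using e_one[of 1] by force
  ultimately show ?thesis
    using just_infinite_open[OF normalI_conj[OF N_subgroup] N_closed] N_conj[where s=0] by auto
qed

lemma \<phi>_N: "x \<in> N \<Longrightarrow> \<phi> x \<in> N"
proof -
  assume x: "x \<in> N"
  have "\<phi> x \<in> co t" for t
  proof -
    have "h \<otimes> e t (\<phi> x) \<otimes> inv h \<in> e t ` carrier G" if h: "h \<in> carrier G" for h
    proof -
      obtain x' where "x' \<in> N" "e (Suc t) x' = h \<otimes> e (Suc t) x \<otimes> inv h"
        using N_conj[OF x h] by blast
      then have "h \<otimes> e t (\<phi> x) \<otimes> inv h = e t (\<phi> x')" "\<phi> x' \<in> carrier G"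
        using e_closed[of x' 1] by (simp_all add: funpow_swap1)
      then show ?thesis by blast
    qed
    then show ?thesis using x e_closed[of x 1] by (auto simp: co_def)
  qed
  then show ?thesis by (simp add: N_def)
qed

lemma e_N: "x \<in> N \<Longrightarrow> e t x \<in> N"
  by (induction t) (auto simp: \<phi>_N)

definition M :: "nat \<Rightarrow> 'a set" where "M s = e s ` N"

lemma M_subgroup: "subgroup (M s) G" unfolding M_def by (rule e_subgroup[OF N_subgroup])
lemma M_open: "openin T (M s)" unfolding M_def by (rule e_openin[OF N_open])
lemma M_closed: "closedin T (M s)" unfolding M_def by (rule e_closedin[OF N_closed])

lemma M_conj: "x \<in> M s \<Longrightarrow> h \<in> carrier G \<Longrightarrow> h \<otimes> x \<otimes> inv h \<in> M s"
  unfolding M_def using N_conj[of _ h s] by force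

lemma M_decseq: "decseq M"
proof -
  have "M (Suc s) \<subseteq> M s" for s
    unfolding M_def using \<phi>_N by (auto simp: funpow_swap1)
  then show ?thesis by (simp add: decseq_Suc_iff)
qed

text \<open>If this closed normal intersection were non-trivial it would be open, and its finite
  index would bound the indices of all \<open>M s\<close>; but these grow strictly with
  \<open>s\<close>.\<close>

lemma M_Inter: "(\<Inter>s. M s) = {\<one>}"
proof (rule ccontr)
  assume n: "\<not> ?thesis"
  let ?D = "\<Inter>s. M s"
  have D: "subgroup ?D G" by (rule subgroups_Inter) (use M_subgroup in auto)
  then have "\<one> \<in> ?D" by (rule subgroup.one_closed)
  then obtain x where "x \<in> ?D" "x \<noteq> \<one>" using n by blast
  moreover have "?D \<lhd> G" by (rule normalI_conj[OF D]) (use M_conj in blast)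
  moreover have "closedin T ?D" by (rule closedin_Inter) (use M_closed in auto)
  ultimately have o: "openin T ?D" using just_infinite_open by blast
  have fin: "finite (rcosets ?D)" by (rule finite_rcosets_open[OF compact D o])
  have "card (rcosets (M s)) \<le> card (rcosets ?D)" for s
    by (rule card_rcosets_mono(2)[OF D M_subgroup _ fin]) auto
  moreover have "s \<le> card (rcosets (M s))" for s
  proof (induction s)
    case (Suc s)
    have "M (Suc s) = \<phi> ` M s" by (auto simp: M_def)
    then show ?case
      using card_rcosets_image_less[OF M_subgroup[of s] M_open[of s]] Suc by simp
  qed simp
  ultimately show False
    by (meson Suc_n_not_le_n le_trans)
qed

lemma M_in_open:
  assumes "openin T Z" "\<one> \<in> Z"
  shows "\<exists>t. M t \<subseteq> Z"
proof (rule ccontr)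
  assume n: "\<not> ?thesis"
  have "(\<Inter>t. M t - Z) \<noteq> {}"
  proof (rule compact_space_imp_nest[OF compact])
    show "decseq (\<lambda>t. M t - Z)" using M_decseq unfolding decseq_def by blast
  qed (use n closedin_diff[OF M_closed assms(1)] in blast)+
  then show False using M_Inter assms by blast
qed

text \<open>\<open>u i h\<close> is conjugation by \<open>h\<close> on \<open>\<phi>\<^sup>i N\<close>, transported to \<open>N\<close>. Modulo \<open>M s\<close> it describes
  the action of \<open>h\<close> on the factor \<open>\<phi>\<^sup>i N / \<phi>\<^sup>i\<^sup>+\<^sup>s N\<close>, with kernel \<open>Ker s i\<close>.\<close>

definition u :: "nat \<Rightarrow> 'a \<Rightarrow> 'a \<Rightarrow> 'a" where
  "u i h x = (THE x'. x' \<in> N \<and> e i x' = h \<otimes> e i x \<otimes> inv h)"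

lemma u_props:
  assumes "x \<in> N" "h \<in> carrier G"
  shows "u i h x \<in> N" "e i (u i h x) = h \<otimes> e i x \<otimes> inv h"
proof -
  have "\<exists>!x'. x' \<in> N \<and> e i x' = h \<otimes> e i x \<otimes> inv h"
    using N_conj[OF assms] e_eqD[of i] by (metis N_carrier)
  from theI'[OF this] show "u i h x \<in> N" "e i (u i h x) = h \<otimes> e i x \<otimes> inv h"
    unfolding u_def by auto
qed

lemma u_eqI:
  assumes "x \<in> N" "h \<in> carrier G" "y \<in> N" "e i y = h \<otimes> e i x \<otimes> inv h"
  shows "u i h x = y"
  using u_props[OF assms(1,2)] assms e_eqD[of i] by (metis N_carrier)

lemma u_carrier [simp]: "x \<in> N \<Longrightarrow> h \<in> carrier G \<Longrightarrow> u i h x \<in> carrier G"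
  using u_props by simp

lemma u_mult:
  assumes "x \<in> N" "y \<in> N" "h \<in> carrier G"
  shows "u i h (x \<otimes> y) = u i h x \<otimes> u i h y"
  by (rule u_eqI) (use assms u_props subgroup.m_closed[OF N_subgroup] in \<open>auto simp: e_mult conj_mult\<close>)

lemma u_minv:
  assumes "x \<in> N" "h \<in> carrier G"
  shows "u i h (inv x) = inv (u i h x)"
  by (rule u_eqI) (use assms u_props subgroup.m_inv_closed[OF N_subgroup] in \<open>auto simp: e_minv conj_inv\<close>)

lemma u_comp:
  assumes "x \<in> N" "h \<in> carrier G" "g \<in> carrier G"
  shows "u i (h \<otimes> g) x = u i h (u i g x)"
  by (rule u_eqI) (use assms u_props in \<open>auto simp: conj_conj\<close>)

lemma u_one: "x \<in> N \<Longrightarrow> u i \<one> x = x"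
  by (rule u_eqI) auto

lemma M_N: "x \<in> M s \<Longrightarrow> x \<in> N"
  by (auto simp: M_def e_N)

text \<open>Under \<open>e i\<close> the subgroup \<open>M s\<close> becomes
  \<open>M (i + s)\<close>, which is normal as well. Hence the transported action descends to the
  cosets of \<open>M s\<close> in \<open>N\<close>.\<close>

lemma u_M:
  assumes "x \<in> M s" "h \<in> carrier G"
  shows "u i h x \<in> M s"
proof -
  obtain y where y: "y \<in> N" "x = e s y" using assms by (auto simp: M_def)
  obtain y' where y': "y' \<in> N" "e (i+s) y' = h \<otimes> e (i+s) y \<otimes> inv h"
    using N_conj[OF y(1) assms(2)] by blast
  then have "u i h x = e s y'"
    by (intro u_eqI) (use assms M_N y e_N in \<open>auto simp: e_add\<close>)
  then show ?thesis using y' by (auto simp: M_def)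
qed

section \<open>Congruence modulo \<open>M s\<close> and comparison of the actions\<close>

definition cong where "cong s x y \<longleftrightarrow> x \<otimes> inv y \<in> M s"

lemma cong_refl: "x \<in> carrier G \<Longrightarrow> cong s x x"
  using subgroup.one_closed[OF M_subgroup] by (simp add: cong_def)

lemma cong_sym:
  assumes "x \<in> carrier G" "y \<in> carrier G" "cong s x y"
  shows "cong s y x"
proof -
  have "inv (x \<otimes> inv y) \<in> M s"
    using assms subgroup.m_inv_closed[OF M_subgroup] by (auto simp: cong_def)
  then show ?thesis using assms by (simp add: cong_def inv_mult_group)
qed

lemma cong_trans:
  assumes "x \<in> carrier G" "y \<in> carrier G" "z \<in> carrier G" "cong s x y" "cong s y z"
  shows "cong s x z"
proof -
  have "(x \<otimes> inv y) \<otimes> (y \<otimes> inv z) \<in> M s"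
    using assms subgroup.m_closed[OF M_subgroup] by (auto simp: cong_def)
  moreover have "inv y \<otimes> (y \<otimes> inv z) = inv z" using assms by (simp add: m_assoc[symmetric])
  ultimately show ?thesis using assms by (simp add: cong_def m_assoc)
qed

lemma u_cong:
  assumes "x \<in> N" "y \<in> N" "h \<in> carrier G" "cong s x y"
  shows "cong s (u i h x) (u i h y)"
proof -
  have "u i h (x \<otimes> inv y) \<in> M s" using u_M assms by (auto simp: cong_def)
  then show ?thesis
    using assms subgroup.m_inv_closed[OF N_subgroup] by (simp add: cong_def u_mult u_minv)
qed

text \<open>The equaliser of two actions on the same finite set, the cosets of \<open>M s\<close> in
  \<open>N\<close>.\<close>

definition agree where
  "agree s i j = {h \<in> carrier G. \<forall>x\<in>N. cong s (u i h x) (u j h x)}"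

lemma agree_subgroup: "subgroup (agree s i j) G"
proof (rule subgroupI)
  have "\<one> \<in> agree s i j" by (simp add: agree_def u_one cong_refl)
  then show "agree s i j \<noteq> {}" by blast
  fix a assume a: "a \<in> agree s i j"
  then have ac: "a \<in> carrier G" by (simp add: agree_def)
  have "cong s (u i (inv a) x) (u j (inv a) x)" if x: "x \<in> N" for x
  proof -
    let ?w = "u j (inv a) x"
    have w: "?w \<in> N" using x ac u_props by simp
    have "cong s (u i a ?w) (u j a ?w)" using a w by (simp add: agree_def)
    moreover have "u j a ?w = x" using ac x by (simp add: u_comp[symmetric] u_one)
    ultimately have "cong s (u i (inv a) (u i a ?w)) (u i (inv a) x)"
      using w ac x u_props by (intro u_cong) auto
    moreover have "u i (inv a) (u i a ?w) = ?w" using ac w by (simp add: u_comp[symmetric] u_one)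
    ultimately have "cong s (u j (inv a) x) (u i (inv a) x)" by simp
    then show ?thesis by (rule cong_sym[rotated 2]) (use x ac in auto)
  qed
  then show "inv a \<in> agree s i j" using ac by (simp add: agree_def)
  fix b assume b: "b \<in> agree s i j"
  then have bc: "b \<in> carrier G" by (simp add: agree_def)
  have "cong s (u i (a \<otimes> b) x) (u j (a \<otimes> b) x)" if x: "x \<in> N" for x
  proof -
    have w: "u i b x \<in> N" "u j b x \<in> N" using x bc u_props by auto
    have "cong s (u i b x) (u j b x)" using b x by (simp add: agree_def)
    then have 1: "cong s (u i a (u i b x)) (u i a (u j b x))"
      using w ac by (intro u_cong) auto
    have "cong s (u i a (u j b x)) (u j a (u j b x))" using a w by (simp add: agree_def)
    with 1 have "cong s (u i a (u i b x)) (u j a (u j b x))"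
      by (rule cong_trans[rotated 3]) (use w ac u_props in auto)
    then show ?thesis using x ac bc by (simp add: u_comp)
  qed
  then show "a \<otimes> b \<in> agree s i j" using ac bc by (simp add: agree_def)
qed (auto simp: agree_def)

definition Ker where "Ker s i = {h \<in> carrier G. \<forall>x\<in>N. cong s (u i h x) x}"

lemma Ker_one: "\<one> \<in> Ker s i"
  by (simp add: Ker_def u_one cong_refl)

text \<open>Applying \<open>e i\<close> turns the congruences into the condition that the
  commutators of \<open>h\<close> with the compact image of \<open>N\<close> under
  \<open>e i\<close> lie in the open subgroup \<open>M (i + s)\<close>.\<close>

lemma Ker_open: "openin T (Ker s i)"
proof -
  have "openin T {h \<in> topspace T. \<forall>x\<in>e i ` N. (case (h, x) of (h, x) \<Rightarrow> h \<otimes> x \<otimes> inv h \<otimes> inv x) \<in> M (i + s)}"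
  proof (rule openin_forall_compactin)
    show "compactin T (e i ` N)"
      using N_closed e_closedin compact closedin_compact_space by blast
    have "continuous_map (prod_topology T T) T (\<lambda>z. fst z \<otimes> snd z \<otimes> inv (fst z) \<otimes> inv (snd z))"
      by (intro continuous_group_intros)
    moreover have "(\<lambda>(h, x). h \<otimes> x \<otimes> inv h \<otimes> inv x)
        = (\<lambda>z. fst z \<otimes> snd z \<otimes> inv (fst z) \<otimes> inv (snd z))"
      by auto
    ultimately show "continuous_map (prod_topology T T) T (\<lambda>(h, x). h \<otimes> x \<otimes> inv h \<otimes> inv x)"
      by metis
  qed (rule M_open)
  moreover have "cong s (u i h x) x \<longleftrightarrow> h \<otimes> e i x \<otimes> inv h \<otimes> inv (e i x) \<in> M (i + s)"
    if h: "h \<in> carrier G" and x: "x \<in> N" for h x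
  proof -
    have "e i (u i h x \<otimes> inv x) = h \<otimes> e i x \<otimes> inv h \<otimes> inv (e i x)"
      using h x u_props by (simp add: e_mult e_minv)
    moreover have iff: "e i y \<in> M (i + s) \<longleftrightarrow> y \<in> M s" if "y \<in> carrier G" for y
    proof
      assume "e i y \<in> M (i + s)"
      then obtain z where z: "z \<in> N" "e i y = e i (e s z)" by (auto simp: M_def e_add)
      have "y = e s z" by (rule e_eqD[OF z(2) that]) (use z in auto)
      then show "y \<in> M s" using z by (simp add: M_def)
    qed (auto simp: M_def e_add)
    ultimately show ?thesis using iff[of "u i h x \<otimes> inv x"] h x by (simp add: cong_def)
  qed
  ultimately show ?thesis by (simp add: Ker_def topspace_eq cong: conj_cong)
qed

text \<open>The equaliser contains the open set on which both actions are trivial, so it is open and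
  therefore closed. Containing \<open>S\<close>, it contains the closure of the subgroup generated
  by \<open>S\<close>.\<close>

lemma agree_all:
  assumes S: "T closure_of (generate G S) = carrier G" and agr: "S \<subseteq> agree s i j"
  shows "agree s i j = carrier G"
proof -
  have "Ker s i \<inter> Ker s j \<subseteq> agree s i j"
  proof
    fix h assume h: "h \<in> Ker s i \<inter> Ker s j"
    have "cong s (u i h x) (u j h x)" if "x \<in> N" for x
    proof -
      have hc: "h \<in> carrier G" and c: "cong s (u i h x) x" "cong s (u j h x) x"
        using h that by (auto simp: Ker_def)
      have "cong s x (u j h x)" using cong_sym[OF _ _ c(2)] that hc by simp
      then show ?thesis using cong_trans[OF _ _ _ c(1)] that hc by simp
    qed
    then show "h \<in> agree s i j" using h by (auto simp: Ker_def agree_def)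
  qed
  then have "openin T (agree s i j)"
    by (intro subgroup_openinI[OF agree_subgroup, of "Ker s i \<inter> Ker s j"])
      (use Ker_open Ker_one in blast)+
  then have "closedin T (agree s i j)" by (rule open_subgroup_closedin[OF agree_subgroup])
  moreover have "generate G S \<subseteq> agree s i j" using generate_subgroup_incl[OF agr agree_subgroup] .
  ultimately have "T closure_of (generate G S) \<subseteq> agree s i j" by (simp add: closure_of_minimal)
  then show ?thesis using S subgroup.subset[OF agree_subgroup] by blast
qed

text \<open>All these actions take place on the same finite set of cosets of \<open>M s\<close> in \<open>N\<close>, and an action
  is determined by the generators.\<close>

lemma finite_Ker:
  assumes fin: "finite S" and Sc: "S \<subseteq> carrier G" and S: "T closure_of (generate G S) = carrier G"
  shows "finite (range (Ker s))"
proof -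
  have fM: "finite (rcosets (M s))" by (rule finite_rcosets_open[OF compact M_subgroup M_open])
  obtain X where X: "finite X" "X \<subseteq> N" "(\<lambda>x. M s #> x) ` N = (\<lambda>x. M s #> x) ` X"
  proof -
    have "finite ((\<lambda>x. M s #> x) ` N)"
      by (rule finite_subset[OF _ fM]) (use N_subset in \<open>auto simp: RCOSETS_def\<close>)
    then show ?thesis using finite_subset_image[of "(\<lambda>x. M s #> x) ` N" "\<lambda>x. M s #> x" N] that by auto
  qed
  have cong_coset: "cong s x y \<longleftrightarrow> M s #> x = M s #> y" if "x \<in> carrier G" "y \<in> carrier G" for x y
  proof
    assume "cong s x y"
    then have "x \<in> M s #> y"
      using that subgroup.rcos_module_rev[OF M_subgroup is_group that(2,1)] by (simp add: cong_def)
    then show "M s #> x = M s #> y" using repr_independence[OF _ that(2) M_subgroup] by simp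
  next
    assume "M s #> x = M s #> y"
    then have "x \<in> M s #> y" using rcos_self[OF that(1) M_subgroup[of s]] by simp
    then show "cong s x y"
      using subgroup.rcos_module_imp[OF M_subgroup is_group that(2)] by (simp add: cong_def)
  qed
  \<comment> \<open>A table recording, for each generator and each coset representative in
    \<open>X\<close>, the coset reached by the action. Only finitely many tables exist, and equal
    tables force agreement on \<open>S\<close>, hence everywhere.\<close>
  define code where "code i = restrict (\<lambda>(h, x). M s #> u i h x) (S \<times> X)" for i
  have "code i \<in> (S \<times> X) \<rightarrow>\<^sub>E rcosets (M s)" for i
    unfolding code_def
  proof (rule restrict_PiE_iff[THEN iffD2], clarify)
    fix h x assume "h \<in> S" "x \<in> X"
    then have "u i h x \<in> carrier G" using Sc X(2) by (intro u_carrier) auto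
    then show "M s #> u i h x \<in> rcosets (M s)"
      using subgroup.subset[OF M_subgroup] rcosetsI by blast
  qed
  then have "range code \<subseteq> (S \<times> X) \<rightarrow>\<^sub>E rcosets (M s)" by blast
  then have fc: "finite (range code)"
    using finite_PiE[of "S \<times> X" "\<lambda>_. rcosets (M s)"] fin X(1) fM finite_subset by blast
  have eq: "Ker s i = Ker s j" if c: "code i = code j" for i j
  proof -
    have "S \<subseteq> agree s i j"
    proof
      fix h assume h: "h \<in> S"
      then have hc: "h \<in> carrier G" using Sc by blast
      have "cong s (u i h x) (u j h x)" if x: "x \<in> N" for x
      proof -
        obtain y where y: "y \<in> X" "M s #> x = M s #> y" using X(3) x by blast
        have yN: "y \<in> N" using y X by blast
        have xy: "cong s x y" using cong_coset y x yN by simp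
        have "code i (h, y) = code j (h, y)" using c by simp
        then have "cong s (u i h y) (u j h y)"
          using h y yN hc cong_coset by (simp add: code_def)
        moreover have "cong s (u i h x) (u i h y)" "cong s (u j h x) (u j h y)"
          using u_cong[OF x yN hc xy] by auto
        moreover have "u i h x \<in> carrier G" "u i h y \<in> carrier G" "u j h x \<in> carrier G" "u j h y \<in> carrier G"
          using x yN hc by auto
        ultimately show ?thesis by (meson cong_sym cong_trans)
      qed
      then show "h \<in> agree s i j" using hc by (simp add: agree_def)
    qed
    then have a: "agree s i j = carrier G" using agree_all[OF S] by blast
    have "cong s (u i h x) x \<longleftrightarrow> cong s (u j h x) x" if "h \<in> carrier G" "x \<in> N" for h x
    proof -
      have "cong s (u i h x) (u j h x)" using a that unfolding agree_def by blast
      moreover have "x \<in> carrier G" "u i h x \<in> carrier G" "u j h x \<in> carrier G" using that by auto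
      ultimately show ?thesis by (meson cong_sym cong_trans)
    qed
    then show ?thesis by (auto simp: Ker_def)
  qed
  have "range (Ker s) = (\<lambda>c. Ker s (SOME i. code i = c)) ` range code"
  proof -
    have "Ker s i = Ker s (SOME j. code j = code i)" for i
      by (rule eq) (metis (mono_tags, lifting) someI)
    then show ?thesis by (auto simp: image_iff)
  qed
  then show ?thesis using fc by simp
qed

theorem N_commutative:
  assumes fin: "finite S" and S: "topologically_generates G T S" and xy: "x \<in> N" "y \<in> N"
  shows "x \<otimes> y = y \<otimes> x"
proof -
  have xyc: "x \<in> carrier G" "y \<in> carrier G" using xy by auto
  have "y \<otimes> x \<otimes> inv y \<otimes> inv x \<in> M s" for s
  proof -
    \<comment> \<open>The index \<open>i\<close> runs over all naturals, but only finitely many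
      different kernels occur.\<close>
    have "openin T (\<Inter>i. Ker s i)"
      by (rule openin_Inter) (use finite_Ker[OF fin] S Ker_open in \<open>auto simp: topologically_generates_def\<close>)
    then obtain t where "M t \<subseteq> (\<Inter>i. Ker s i)"
      using M_in_open[of "\<Inter>i. Ker s i"] Ker_one by blast
    then have "M t \<subseteq> Ker s t" by blast
    then have "e t y \<in> Ker s t" using xy by (auto simp: M_def)
    then have "cong s (u t (e t y) x) x" using xy by (simp add: Ker_def)
    moreover have "y \<otimes> x \<otimes> inv y \<in> N"
      using xy N_subgroup by (simp add: subgroup.m_closed subgroup.m_inv_closed)
    \<comment> \<open>With conjugator and level both shifted by \<open>t\<close>, the transported
      action is plain conjugation by \<open>y\<close>. As \<open>s\<close> was arbitrary, the
      commutator lies in every \<open>M s\<close>.\<close>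
    then have "u t (e t y) x = y \<otimes> x \<otimes> inv y"
      using xy by (intro u_eqI) (auto simp: e_mult e_minv)
    ultimately show ?thesis by (simp add: cong_def)
  qed
  then have "y \<otimes> x \<otimes> inv y \<otimes> inv x = \<one>" using M_Inter by blast
  then have "inv (inv x) = y \<otimes> x \<otimes> inv y"
    using xyc by (intro inv_equality) auto
  then have "x \<otimes> y = y \<otimes> x \<otimes> inv y \<otimes> y" using xyc by simp
  then show ?thesis using xyc by (simp add: m_assoc)
qed

end

section \<open>Isomorphism, generation and hereditarily just infinite groups\<close>

definition top_isomorphic :: "'a monoid \<Rightarrow> 'a topology \<Rightarrow> 'b monoid \<Rightarrow> 'b topology \<Rightarrow> bool" where
  "top_isomorphic G T G' T' \<longleftrightarrow> (\<exists>f \<in> iso G G'. homeomorphic_map T T' f)"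

lemma top_isomorphic_sym:
  assumes "group G" "carrier G = topspace T" and i: "top_isomorphic G T G' T'"
  shows "top_isomorphic G' T' G T"
proof -
  obtain f where f: "f \<in> iso G G'" "homeomorphic_map T T' f"
    using i by (auto simp: top_isomorphic_def)
  have "inv_into (carrier G) f \<in> iso G' G"
    using group.iso_set_sym[OF assms(1) f(1)] .
  moreover have "homeomorphic_map T' T (inv_into (carrier G) f)"
  proof -
    obtain g where g: "homeomorphic_maps T T' f g"
      using f(2) homeomorphic_map_maps by blast
    have "inv_into (carrier G) f y = g y" if "y \<in> topspace T'" for y
    proof (rule inv_into_f_eq)
      show "inj_on f (carrier G)" using f(1) by (auto simp: iso_def bij_betw_def)
      show "g y \<in> carrier G" "f (g y) = y"
        using g that assms(2) by (auto simp: homeomorphic_maps_def continuous_map_def)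
    qed
    then show ?thesis
      using g homeomorphic_map_eq[of T' T g] by (simp add: homeomorphic_maps_map)
  qed
  ultimately show ?thesis by (auto simp: top_isomorphic_def)
qed

lemma top_isomorphic_trans:
  "top_isomorphic G T G' T' \<Longrightarrow> top_isomorphic G' T' G'' T'' \<Longrightarrow> top_isomorphic G T G'' T''"
  unfolding top_isomorphic_def by (meson homeomorphic_map_compose iso_set_trans)

text \<open>A Goursat-type lemma: two quotients \<open>A\<close>, \<open>B\<close> of a compact group agree
  as soon as the kernels are nested, because \<open>A\<close> has no proper infinite quotients.\<close>

lemma top_isomorphic_nested_kernels:
  fixes A :: "'a monoid" and B :: "'b monoid" and K :: "'c monoid"
  assumes A: "profinite_group A TA" "just_infinite A TA"
    and B: "profinite_group B TB" "infinite (carrier B)"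
    and K: "group K" "compact_space TK" "topspace TK = carrier K"
    and p: "p \<in> hom K A" "p ` carrier K = carrier A" "continuous_map TK TA p"
    and q: "q \<in> hom K B" "q ` carrier K = carrier B" "continuous_map TK TB q"
    and ker: "\<And>k. k \<in> carrier K \<Longrightarrow> p k = \<one>\<^bsub>A\<^esub> \<Longrightarrow> q k = \<one>\<^bsub>B\<^esub>"
  shows "top_isomorphic A TA B TB"
proof -
  interpret A: profinite_group A TA by fact
  interpret B: profinite_group B TB by fact
  interpret K: group K by fact
  interpret p: group_hom K A p using p by unfold_locales
  interpret q: group_hom K B q using q by unfold_locales
  define f where "f a = q (SOME k. k \<in> carrier K \<and> p k = a)" for a
  have fp: "f (p k) = q k" if k: "k \<in> carrier K" for k
  proof -
    define k' where "k' = (SOME k'. k' \<in> carrier K \<and> p k' = p k)"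
    have k': "k' \<in> carrier K" "p k' = p k"
      using someI[of "\<lambda>k'. k' \<in> carrier K \<and> p k' = p k" k] k by (auto simp: k'_def)
    have "p (k' \<otimes>\<^bsub>K\<^esub> inv\<^bsub>K\<^esub> k) = \<one>\<^bsub>A\<^esub>" using k k' by simp
    then have "q (k' \<otimes>\<^bsub>K\<^esub> inv\<^bsub>K\<^esub> k) = \<one>\<^bsub>B\<^esub>" using k k' ker by simp
    then have "q k' \<otimes>\<^bsub>B\<^esub> inv\<^bsub>B\<^esub> (q k) = \<one>\<^bsub>B\<^esub>" using k k' by simp
    then have "q k' = q k"
      using k k' by (metis B.inv_closed B.inv_equality B.inv_inv q.hom_closed)
    then show ?thesis by (simp add: f_def k'_def)
  qed
  have fhom: "f \<in> hom A B"
  proof (rule homI)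
    fix x assume "x \<in> carrier A"
    then obtain k where "k \<in> carrier K" "x = p k" using p(2) by blast
    then show "f x \<in> carrier B" using fp by simp
    fix y assume "y \<in> carrier A"
    then obtain l where l: "l \<in> carrier K" "y = p l" using p(2) by blast
    have "x \<otimes>\<^bsub>A\<^esub> y = p (k \<otimes>\<^bsub>K\<^esub> l)" using l \<open>k \<in> carrier K\<close> \<open>x = p k\<close> by simp
    then have "f (x \<otimes>\<^bsub>A\<^esub> y) = q (k \<otimes>\<^bsub>K\<^esub> l)" using fp[of "k \<otimes>\<^bsub>K\<^esub> l"] l \<open>k \<in> carrier K\<close> by (metis K.m_closed)
    then show "f (x \<otimes>\<^bsub>A\<^esub> y) = f x \<otimes>\<^bsub>B\<^esub> f y"
      using fp l \<open>k \<in> carrier K\<close> \<open>x = p k\<close> by simp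
  qed
  interpret f: group_hom A B f using fhom by unfold_locales
  have fsurj: "f ` carrier A = carrier B"
    unfolding p(2)[symmetric] q(2)[symmetric] image_image using fp by simp
  have "continuous_map TK TB (f \<circ> p)"
    by (rule continuous_map_eq[OF q(3)]) (use fp K(3) in simp)
  \<comment> \<open>A continuous surjection from a compact onto a Hausdorff space is a quotient map,
    so continuity of \<open>f\<close> can be tested after composition with \<open>p\<close>.\<close>
  moreover have "quotient_map TK TA p"
    by (rule continuous_imp_quotient_map[OF p(3) K(2) A.Hausdorff]) (use K(3) A.topspace_eq p(2) in simp)
  ultimately have fcont: "continuous_map TA TB f" using continuous_compose_quotient_map by blast
  let ?N = "kernel A B f"
  have N: "?N \<lhd> A" "subgroup ?N A" by (simp_all add: f.normal_kernel f.subgroup_kernel)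
  have "closedin TB {\<one>\<^bsub>B\<^esub>}"
    using B.Hausdorff B.topspace_eq by (simp add: closedin_Hausdorff_singleton)
  from closedin_continuous_map_preimage[OF fcont this]
  have Nc: "closedin TA ?N" by (simp add: kernel_def A.topspace_eq)
  have "?N = {\<one>\<^bsub>A\<^esub>}"
  proof (rule ccontr)
    assume "?N \<noteq> {\<one>\<^bsub>A\<^esub>}"
    then have "openin TA ?N" using A(2) N(1) Nc by (auto simp: just_infinite_def)
    then have fin: "finite (rcosets\<^bsub>A\<^esub> ?N)" using A.finite_rcosets_open[OF A.compact N(2)] by blast
    \<comment> \<open>An open kernel has finite index and \<open>f\<close> is constant on its
      cosets, so \<open>B\<close> would be finite.\<close>
    have "carrier B \<subseteq> (\<lambda>C. f (SOME x. x \<in> C)) ` (rcosets\<^bsub>A\<^esub> ?N)"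
    proof
      fix b assume "b \<in> carrier B"
      then obtain a where a: "a \<in> carrier A" "b = f a" using fsurj by blast
      let ?x = "SOME x. x \<in> ?N #>\<^bsub>A\<^esub> a"
      have "?x \<in> ?N #>\<^bsub>A\<^esub> a" using A.rcos_self[OF a(1) N(2)] by (rule someI)
      then obtain n where "n \<in> ?N" "?x = n \<otimes>\<^bsub>A\<^esub> a" by (auto simp: r_coset_def)
      then have "f ?x = b" using a by (auto simp: kernel_def)
      moreover have "?N #>\<^bsub>A\<^esub> a \<in> rcosets\<^bsub>A\<^esub> ?N"
        using a A.rcosetsI[OF subgroup.subset[OF N(2)]] by blast
      ultimately show "b \<in> (\<lambda>C. f (SOME x. x \<in> C)) ` (rcosets\<^bsub>A\<^esub> ?N)"
        by (metis image_eqI)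
    qed
    then show False using fin B(2) finite_surj by blast
  qed
  then have inj: "inj_on f (carrier A)" by (simp add: f.inj_iff_trivial_ker)
  then have "f \<in> iso A B" using fhom fsurj by (simp add: iso_def bij_betw_def)
  moreover have "homeomorphic_map TA TB f"
    by (rule continuous_imp_homeomorphic_map[OF fcont A.compact B.Hausdorff])
      (use A.topspace_eq B.topspace_eq fsurj inj in auto)
  ultimately show ?thesis by (auto simp: top_isomorphic_def)
qed

text \<open>Since \<open>H\<close> is closed, closures taken in the subspace and in \<open>T\<close>
  coincide; afterwards all generation statements can be made in the ambient group.\<close>

lemma topologically_generates_subgroup_iff:
  fixes G :: "'a monoid"
  assumes G: "group G" and H: "subgroup H G" and c: "closedin T H"
  shows "topologically_generates (G\<lparr>carrier := H\<rparr>) (subtopology T H) S \<longleftrightarrow>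
    S \<subseteq> H \<and> T closure_of (generate G S) = H"
proof (cases "S \<subseteq> H")
  case True
  interpret group G by fact
  have g: "generate (G\<lparr>carrier := H\<rparr>) S = generate G S" by (rule generate_consistent[OF True H])
  have gH: "generate G S \<subseteq> H" by (rule generate_subgroup_incl[OF True H])
  have "T closure_of (generate G S) \<subseteq> H" by (rule closure_of_minimal[OF gH c])
  then have "subtopology T H closure_of (generate G S) = T closure_of (generate G S)"
    using gH by (simp add: closure_of_subtopology inf.absorb2)
  then show ?thesis using True g by (simp add: topologically_generates_def)
qed (simp add: topologically_generates_def)

text \<open>Extended naturals are well-ordered, so the infimum over a non-empty set is attained;
  over the empty set it is infinite and exceeds \<open>enat m\<close>. Bounds on generator numbers
  thereby become existence statements.\<close>

lemma INF_le_enat_iff: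
  fixes f :: "'a \<Rightarrow> enat"
  shows "(INF x\<in>A. f x) \<le> enat m \<longleftrightarrow> (\<exists>x\<in>A. f x \<le> enat m)"
proof
  assume a: "(INF x\<in>A. f x) \<le> enat m"
  have "A \<noteq> {}"
  proof
    assume "A = {}"
    then show False using a by (simp add: top_enat_def)
  qed
  then have "\<exists>y. y \<in> f ` A" by blast
  then have "Inf (f ` A) \<in> f ` A"
    unfolding Inf_enat_def by (auto intro: LeastI)
  then show "\<exists>x\<in>A. f x \<le> enat m" using a by auto
qed (auto intro: INF_lower2)

lemma min_generators_le_enat_iff:
  "min_generators G T \<le> enat m \<longleftrightarrow> (\<exists>S. finite S \<and> card S \<le> m \<and> topologically_generates G T S)"
  by (auto simp: min_generators_def INF_le_enat_iff)

section \<open>Finite bounds on the lower rank and avoidance of isomorphic open subgroups\<close>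

definition virtually_abelian :: "'a monoid \<Rightarrow> 'a topology \<Rightarrow> bool" where
  "virtually_abelian G T \<longleftrightarrow>
    (\<exists>A \<in> open_subgroups G T. \<forall>x\<in>A. \<forall>y\<in>A. x \<otimes>\<^bsub>G\<^esub> y = y \<otimes>\<^bsub>G\<^esub> x)"

abbreviation subgrp :: "'a monoid \<Rightarrow> 'a set \<Rightarrow> 'a monoid" where
  "subgrp G H \<equiv> G\<lparr>carrier := H\<rparr>"

lemma min_generators_lower_rank_iff:
  "lower_rank G T \<le> enat m \<longleftrightarrow>
    (\<forall>U\<in>open_subgroups G T. \<exists>H\<in>open_subgroups G T. H \<subseteq> U \<and>
       min_generators (subgrp G H) (subtopology T H) \<le> enat m)"
  by (auto simp: lower_rank_def SUP_le_iff INF_le_enat_iff)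

locale hji_group = profinite_group G T for G :: "'a monoid" (structure) and T +
  assumes hji: "hereditarily_just_infinite G T"
begin

lemma open_subgroup_props:
  assumes H: "H \<in> open_subgroups G T"
  shows "subgroup H G" "openin T H" "closedin T H" "H \<subseteq> carrier G" "\<one> \<in> H"
    and "profinite_group (subgrp G H) (subtopology T H)"
    and "just_infinite (subgrp G H) (subtopology T H)"
    and "infinite H"
proof -
  show 1: "subgroup H G" "openin T H" using H by (auto simp: open_subgroups_def)
  show 2: "closedin T H" using 1 open_subgroup_closedin by blast
  show "H \<subseteq> carrier G" "\<one> \<in> H" using 1 by (auto simp: subgroup.one_closed subgroup.mem_carrier)
  show "profinite_group (subgrp G H) (subtopology T H)"
    using profinite_group_closed_subgroup[OF 1(1) 2] .
  show "just_infinite (subgrp G H) (subtopology T H)"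
    using H hji by (auto simp: hereditarily_just_infinite_def)
  then show "infinite H" by (simp add: just_infinite_def)
qed

lemma open_subgroupsI:
  "subgroup H G \<Longrightarrow> openin T V \<Longrightarrow> V \<subseteq> H \<Longrightarrow> V \<noteq> {} \<Longrightarrow> H \<in> open_subgroups G T"
  using subgroup_openinI by (auto simp: open_subgroups_def)

lemma inter_open_subgroups:
  "\<lbrakk>H \<in> open_subgroups G T; K \<in> open_subgroups G T\<rbrakk> \<Longrightarrow> H \<inter> K \<in> open_subgroups G T"
  by (auto simp: open_subgroups_def subgroups_Inter_pair)

lemma carrier_open_subgroup: "carrier G \<in> open_subgroups G T"
  using subgroup_self openin_topspace[of T] topspace_eq by (simp add: open_subgroups_def)

lemma open_in_open_subgroup:
  assumes H: "H \<in> open_subgroups G T" and A: "A \<in> open_subgroups (subgrp G H) (subtopology T H)"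
  shows "A \<in> open_subgroups G T"
  using incl_subgroup[of H A] openin_trans_full[of T H A] H A by (auto simp: open_subgroups_def)

lemma not_isomorphic_proper:
  assumes W: "W \<in> open_subgroups G T" and W': "W' \<in> open_subgroups G T" "W' \<subset> W"
    and S: "finite S" "topologically_generates (subgrp G W) (subtopology T W) S"
    and nva: "\<not> virtually_abelian G T"
  shows "\<not> top_isomorphic (subgrp G W) (subtopology T W) (subgrp G W') (subtopology T W')"
proof
  assume "top_isomorphic (subgrp G W) (subtopology T W) (subgrp G W') (subtopology T W')"
  then obtain f where f: "f \<in> iso (subgrp G W) (subgrp G W')"
      "homeomorphic_map (subtopology T W) (subtopology T W') f"
    by (auto simp: top_isomorphic_def)
  interpret W: profinite_group "subgrp G W" "subtopology T W"
    using open_subgroup_props[OF W] by blast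
  have fW: "f ` W = W'" using f(1) by (auto simp: iso_def bij_betw_def)
  interpret W: open_self_embedding "subgrp G W" "subtopology T W" f
  proof
    show "just_infinite (subgrp G W) (subtopology T W)" using open_subgroup_props[OF W] by blast
    show "f \<in> hom (subgrp G W) (subgrp G W)"
      using f(1) W'(2) by (auto simp: iso_def hom_def)
    show "inj_on f (carrier (subgrp G W))" using f(1) by (auto simp: iso_def bij_betw_def)
    have "continuous_map (subtopology T W) (subtopology T W') f"
      using f(2) homeomorphic_imp_continuous_map by blast
    then show "continuous_map (subtopology T W) (subtopology T W) f"
      using W'(2) fW by (auto simp: continuous_map_in_subtopology)
    show "openin (subtopology T W) (f ` carrier (subgrp G W))"
      using fW W' open_subgroup_props(2)[OF W] open_subgroup_props(2)[OF W'(1)]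
      by (simp add: openin_open_subtopology psubset_eq)
    show "f ` carrier (subgrp G W) \<noteq> carrier (subgrp G W)" using fW W'(2) by auto
  qed
  have "W.N \<in> open_subgroups G T"
    using open_in_open_subgroup[OF W] W.N_subgroup W.N_open by (simp add: open_subgroups_def)
  moreover have "x \<otimes> y = y \<otimes> x" if "x \<in> W.N" "y \<in> W.N" for x y
    using W.N_commutative[OF S that] by simp
  ultimately show False using nva unfolding virtually_abelian_def by blast
qed

text \<open>If a finitely generated open \<open>W\<close> inside \<open>U\<close> is isomorphic to
  \<open>L\<close>, pass to a proper open subgroup of \<open>W\<close>: any \<open>H\<close> below
  it isomorphic to \<open>L\<close> would be a proper open copy of \<open>W\<close>. If there is no
  such \<open>W\<close>, then \<open>U\<close> itself works. The conclusion speaks of all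
  \<open>H \<subseteq> U'\<close> so that it survives further shrinking.\<close>

lemma shrink_avoiding_iso:
  fixes L :: "'b monoid" and TL :: "'b topology"
  assumes U: "U \<in> open_subgroups G T" and nva: "\<not> virtually_abelian G T"
  obtains U' where "U' \<in> open_subgroups G T" "U' \<subseteq> U"
    "\<And>H S. \<lbrakk>H \<in> open_subgroups G T; H \<subseteq> U'; finite S;
       topologically_generates (subgrp G H) (subtopology T H) S\<rbrakk>
      \<Longrightarrow> \<not> top_isomorphic (subgrp G H) (subtopology T H) L TL"
proof (cases "\<exists>W S. W \<in> open_subgroups G T \<and> W \<subseteq> U \<and> finite S \<and>
    topologically_generates (subgrp G W) (subtopology T W) S \<and>
    top_isomorphic (subgrp G W) (subtopology T W) L TL")
  case True
  then obtain W S where W: "W \<in> open_subgroups G T" "W \<subseteq> U" "finite S"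
    "topologically_generates (subgrp G W) (subtopology T W) S"
    "top_isomorphic (subgrp G W) (subtopology T W) L TL" by blast
  obtain x where x: "x \<in> W" "x \<noteq> \<one>"
    using open_subgroup_props(8)[OF W(1)] by (metis finite.emptyI finite_insert finite_subset singletonI subsetI)
  then obtain V where V: "subgroup V G" "openin T V" "x \<notin> V"
    using trivial_if_in_all_open_subgroups[of x] open_subgroup_props(4)[OF W(1)] by blast
  have "W \<inter> V \<in> open_subgroups G T"
    using inter_open_subgroups[OF W(1)] V by (simp add: open_subgroups_def)
  moreover have "\<not> top_isomorphic (subgrp G H) (subtopology T H) L TL"
    if H: "H \<in> open_subgroups G T" "H \<subseteq> W \<inter> V" for H
  proof
    assume a: "top_isomorphic (subgrp G H) (subtopology T H) L TL"
    have "group (subgrp G H)" "carrier (subgrp G H) = topspace (subtopology T H)"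
      using open_subgroup_props[OF H(1)] subgroup_imp_group topspace_eq by auto
    then have "top_isomorphic L TL (subgrp G H) (subtopology T H)"
      using top_isomorphic_sym a by blast
    then have "top_isomorphic (subgrp G W) (subtopology T W) (subgrp G H) (subtopology T H)"
      using W(5) top_isomorphic_trans by blast
    moreover have "H \<subset> W" using H(2) x V(3) by blast
    ultimately show False using not_isomorphic_proper[OF W(1) H(1) _ W(3,4) nva] by blast
  qed
  ultimately show ?thesis using that[of "W \<inter> V"] W(2) by blast
next
  case False
  show ?thesis by (rule that[OF U]) (use False in blast)+
qed

lemma shrink_avoiding_isos:
  fixes L :: "'i \<Rightarrow> 'b monoid" and TL :: "'i \<Rightarrow> 'b topology"
  assumes J: "finite J" and U: "U \<in> open_subgroups G T" and nva: "\<not> virtually_abelian G T"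
  shows "\<exists>U'. U' \<in> open_subgroups G T \<and> U' \<subseteq> U \<and>
    (\<forall>H S j. H \<in> open_subgroups G T \<longrightarrow> H \<subseteq> U' \<longrightarrow> finite S \<longrightarrow> j \<in> J \<longrightarrow>
       topologically_generates (subgrp G H) (subtopology T H) S
      \<longrightarrow> \<not> top_isomorphic (subgrp G H) (subtopology T H) (L j) (TL j))"
  using J
proof induction
  case empty
  then show ?case using U by blast
next
  case (insert j J)
  then obtain U1 where U1: "U1 \<in> open_subgroups G T" "U1 \<subseteq> U"
    "\<forall>H S j. H \<in> open_subgroups G T \<longrightarrow> H \<subseteq> U1 \<longrightarrow> finite S \<longrightarrow> j \<in> J \<longrightarrow>
       topologically_generates (subgrp G H) (subtopology T H) S
      \<longrightarrow> \<not> top_isomorphic (subgrp G H) (subtopology T H) (L j) (TL j)" by auto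
  obtain U2 where U2: "U2 \<in> open_subgroups G T" "U2 \<subseteq> U1"
    "\<And>H S. \<lbrakk>H \<in> open_subgroups G T; H \<subseteq> U2; finite S;
       topologically_generates (subgrp G H) (subtopology T H) S\<rbrakk>
      \<Longrightarrow> \<not> top_isomorphic (subgrp G H) (subtopology T H) (L j) (TL j)"
    using shrink_avoiding_iso[OF U1(1) nva, of "L j" "TL j"] by metis
  show ?case
    by (rule exI[of _ U2]) (use U1 U2 in \<open>auto dest: subset_trans\<close>)
qed

end

section \<open>Products and isolated coordinates\<close>

locale hji_family =
  fixes I :: "'i set" and G :: "'i \<Rightarrow> 'a monoid" and T :: "'i \<Rightarrow> 'a topology"
  assumes fin_I: "finite I" and hji: "\<And>i. i \<in> I \<Longrightarrow> hji_group (G i) (T i)"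
begin

abbreviation P where "P \<equiv> product_group I G"
abbreviation TP where "TP \<equiv> product_topology T I"
abbreviation open_subs where "open_subs i \<equiv> open_subgroups (G i) (T i)"
abbreviation isomorphic_parts where
  "isomorphic_parts i A j B \<equiv>
    top_isomorphic (subgrp (G i) A) (subtopology (T i) A) (subgrp (G j) B) (subtopology (T j) B)"

lemma pg: "i \<in> I \<Longrightarrow> profinite_group (G i) (T i)"
  using hji hji_group.axioms(1) by blast

lemma tg: "i \<in> I \<Longrightarrow> topological_group (G i) (T i)"
  using pg profinite_group.axioms(1) by blast

lemma grp [simp]: "i \<in> I \<Longrightarrow> group (G i)"
  using tg topological_group.axioms(1) by blast

lemma grp_one [simp]: "i \<in> I \<Longrightarrow> \<one>\<^bsub>G i\<^esub> \<in> carrier (G i)"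
  by (rule monoid.one_closed[OF group.is_monoid[OF grp]])

lemma tsp: "i \<in> I \<Longrightarrow> topspace (T i) = carrier (G i)"
  using tg topological_group.topspace_eq by blast

lemma proj_in: "x \<in> carrier P \<Longrightarrow> i \<in> I \<Longrightarrow> x i \<in> carrier (G i)"
  by auto

lemma comp_inv: "x \<in> carrier P \<Longrightarrow> i \<in> I \<Longrightarrow> (inv\<^bsub>P\<^esub> x) i = inv\<^bsub>G i\<^esub> (x i)"
  by simp

lemma comp_mult: "i \<in> I \<Longrightarrow> (x \<otimes>\<^bsub>P\<^esub> y) i = x i \<otimes>\<^bsub>G i\<^esub> y i"
  by simp

lemma P_ext: "\<lbrakk>x \<in> carrier P; y \<in> carrier P; \<And>i. i \<in> I \<Longrightarrow> x i = y i\<rbrakk> \<Longrightarrow> x = y"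
  by (auto intro: PiE_ext)

lemma group_P: "group P"
  by simp

lemma topspace_TP: "topspace TP = carrier P"
  using tsp by (auto simp: PiE_iff)

lemma compact_TP: "compact_space TP"
  using pg profinite_group.compact compact_space_product_topology by blast

lemma continuous_map_intoP:
  assumes "\<And>x. x \<in> topspace X \<Longrightarrow> f x \<in> extensional I"
    and "\<And>i. i \<in> I \<Longrightarrow> continuous_map X (T i) (\<lambda>x. f x i)"
  shows "continuous_map X TP f"
  using assms by (auto simp: continuous_map_componentwise)

lemma continuous_proj: "i \<in> I \<Longrightarrow> continuous_map TP (T i) (\<lambda>x. x i)"
  by (rule continuous_map_product_projection)

lemma topological_group_P: "topological_group P TP"
proof (rule topological_group.intro[OF group_P], unfold_locales)
  show "topspace TP = carrier P" by (rule topspace_TP)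
  have "continuous_map (prod_topology TP TP) TP (\<lambda>z. fst z \<otimes>\<^bsub>P\<^esub> snd z)"
  proof (rule continuous_map_intoP)
    fix i assume i: "i \<in> I"
    interpret Gi: topological_group "G i" "T i" using tg i .
    have "continuous_map (prod_topology TP TP) (T i) (\<lambda>z. fst z i)"
      "continuous_map (prod_topology TP TP) (T i) (\<lambda>z. snd z i)"
      using continuous_map_compose[OF continuous_map_fst continuous_proj[OF i]]
        continuous_map_compose[OF continuous_map_snd continuous_proj[OF i]] by (auto simp: o_def)
    from Gi.continuous_map_mult[OF this]
    show "continuous_map (prod_topology TP TP) (T i) (\<lambda>z. (fst z \<otimes>\<^bsub>P\<^esub> snd z) i)"
      using i by simp
  qed simp
  moreover have "(\<lambda>z. fst z \<otimes>\<^bsub>P\<^esub> snd z) = (\<lambda>(x, y). x \<otimes>\<^bsub>P\<^esub> y)" by auto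
  ultimately show "continuous_map (prod_topology TP TP) TP (\<lambda>(x, y). x \<otimes>\<^bsub>P\<^esub> y)" by metis
  show "continuous_map TP TP (\<lambda>x. inv\<^bsub>P\<^esub> x)"
  proof (rule continuous_map_intoP)
    fix x assume "x \<in> topspace TP"
    then have "inv\<^bsub>P\<^esub> x \<in> carrier P" using group_P topspace_TP group.inv_closed by metis
    then show "inv\<^bsub>P\<^esub> x \<in> extensional I" by (metis carrier_product_group PiE_iff)
  next
    fix i assume i: "i \<in> I"
    interpret Gi: topological_group "G i" "T i" using tg i .
    show "continuous_map TP (T i) (\<lambda>x. (inv\<^bsub>P\<^esub> x) i)"
      by (rule continuous_map_eq[OF Gi.continuous_map_minv[OF continuous_proj[OF i]]])
        (use comp_inv[OF _ i] topspace_TP in metis)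
  qed
qed

sublocale P: topological_group P TP
  by (rule topological_group_P)

lemma proj_hom: "i \<in> I \<Longrightarrow> group_hom P (G i) (\<lambda>x. x i)"
  by (rule group_hom.intro) (auto simp: group_hom_axioms_def hom_def)

lemma proj_closed_subset:
  assumes "closedin TP K" "i \<in> I"
  shows "closedin (T i) ((\<lambda>x. x i) ` K)"
proof -
  have "compactin TP K" using assms compact_TP closedin_compact_space by blast
  then have "compactin (T i) ((\<lambda>x. x i) ` K)"
    using image_compactin continuous_proj[OF assms(2)] by blast
  then show ?thesis
    using compactin_imp_closedin profinite_group.Hausdorff[OF pg[OF assms(2)]] by blast
qed

definition single :: "'i \<Rightarrow> 'a \<Rightarrow> 'i \<Rightarrow> 'a" where
  "single i h = (\<lambda>j\<in>I. if j = i then h else \<one>\<^bsub>G j\<^esub>)"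

lemma single_closed: "i \<in> I \<Longrightarrow> h \<in> carrier (G i) \<Longrightarrow> single i h \<in> carrier P"
  using monoid.one_closed[OF group.is_monoid[OF grp]] by (auto simp: single_def)

text \<open>The intersection of \<open>K\<close> with the \<open>i\<close>-th factor, regarded as a
  subset of \<open>G i\<close>.\<close>

definition Ki :: "('i \<Rightarrow> 'a) set \<Rightarrow> 'i \<Rightarrow> 'a set" where
  "Ki K i = {h \<in> carrier (G i). single i h \<in> K}"

lemma partial_product_in:
  assumes K: "subgroup K P" and S: "finite S" "S \<subseteq> I" and x: "\<And>j. j \<in> S \<Longrightarrow> x j \<in> Ki K j"
  shows "(\<lambda>j\<in>I. if j \<in> S then x j else \<one>\<^bsub>G j\<^esub>) \<in> K"
  using S x
proof (induction S rule: finite_induct)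
  case empty
  then show ?case using subgroup.one_closed[OF K] by (simp add: restrict_def)
next
  case (insert s S)
  let ?y = "\<lambda>j\<in>I. if j \<in> S then x j else \<one>\<^bsub>G j\<^esub>"
  have s: "s \<in> I" "x s \<in> Ki K s" using insert by auto
  then have xs: "x s \<in> carrier (G s)" by (simp add: Ki_def)
  have "?y \<in> K" using insert.IH insert.prems by blast
  moreover have "single s (x s) \<in> K" using s by (simp add: Ki_def)
  ultimately have "?y \<otimes>\<^bsub>P\<^esub> single s (x s) \<in> K" using subgroup.m_closed[OF K] by blast
  moreover have "?y \<otimes>\<^bsub>P\<^esub> single s (x s) = (\<lambda>j\<in>I. if j \<in> insert s S then x j else \<one>\<^bsub>G j\<^esub>)"
  proof (rule ext)
    fix j show "(?y \<otimes>\<^bsub>P\<^esub> single s (x s)) j = (\<lambda>j\<in>I. if j \<in> insert s S then x j else \<one>\<^bsub>G j\<^esub>) j"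
    proof (cases "j \<in> I")
      case True
      interpret Gj: group "G j" using True by simp
      have "x j \<in> carrier (G j)" if "j \<in> insert s S" using insert.prems(2)[OF that] by (simp add: Ki_def)
      then have "\<one>\<^bsub>G j\<^esub> \<otimes>\<^bsub>G j\<^esub> x j = x j" "x j \<otimes>\<^bsub>G j\<^esub> \<one>\<^bsub>G j\<^esub> = x j" if "j \<in> insert s S"
        using that by auto
      then show ?thesis using True insert(2) by (auto simp: single_def)
    qed simp
  qed
  ultimately show ?case by metis
qed

definition off :: "('i \<Rightarrow> 'a) set \<Rightarrow> 'i set \<Rightarrow> ('i \<Rightarrow> 'a) set" where
  "off K S = {k \<in> K. \<forall>j\<in>S. k j = \<one>\<^bsub>G j\<^esub>}"

lemma off_subgroup:
  assumes K: "subgroup K P" and S: "S \<subseteq> I"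
  shows "subgroup (off K S) P"
proof (rule P.subgroupI)
  have Kc: "K \<subseteq> carrier P" using K subgroup.subset by blast
  then show "off K S \<subseteq> carrier P" unfolding off_def by blast
  have "\<one>\<^bsub>P\<^esub> \<in> K" by (rule subgroup.one_closed[OF K])
  then have "\<one>\<^bsub>P\<^esub> \<in> off K S" using S by (auto simp: off_def)
  then show "off K S \<noteq> {}" by blast
  fix a assume a: "a \<in> off K S"
  then have ac: "a \<in> carrier P" using Kc by (auto simp: off_def)
  have one: "\<one>\<^bsub>G j\<^esub> \<in> carrier (G j)" "inv\<^bsub>G j\<^esub> \<one>\<^bsub>G j\<^esub> = \<one>\<^bsub>G j\<^esub>" "\<one>\<^bsub>G j\<^esub> \<otimes>\<^bsub>G j\<^esub> \<one>\<^bsub>G j\<^esub> = \<one>\<^bsub>G j\<^esub>" if "j \<in> I" for j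
    using group.is_monoid[OF grp[OF that]] by (auto simp: monoid.inv_one)
  have "(inv\<^bsub>P\<^esub> a) j = \<one>\<^bsub>G j\<^esub>" if "j \<in> S" for j
    using comp_inv[OF ac, of j] that S one a by (auto simp: off_def)
  moreover have "inv\<^bsub>P\<^esub> a \<in> K" using a subgroup.m_inv_closed[OF K] by (auto simp: off_def)
  ultimately show "inv\<^bsub>P\<^esub> a \<in> off K S" by (simp add: off_def)
  fix b assume b: "b \<in> off K S"
  have "(a \<otimes>\<^bsub>P\<^esub> b) j = \<one>\<^bsub>G j\<^esub>" if "j \<in> S" for j
    using comp_mult[of j a b] that S one a b by (auto simp: off_def)
  moreover have "a \<otimes>\<^bsub>P\<^esub> b \<in> K" using a b subgroup.m_closed[OF K] by (auto simp: off_def)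
  ultimately show "a \<otimes>\<^bsub>P\<^esub> b \<in> off K S" by (simp add: off_def)
qed

lemma off_closed:
  assumes K: "closedin TP K" and S: "S \<subseteq> I"
  shows "closedin TP (off K S)"
proof -
  have c: "closedin TP {x \<in> topspace TP. x j \<in> {\<one>\<^bsub>G j\<^esub>}}" if "j \<in> S" for j
  proof (rule closedin_continuous_map_preimage[OF continuous_proj])
    show "j \<in> I" using that S by blast
    then show "closedin (T j) {\<one>\<^bsub>G j\<^esub>}"
      using profinite_group.Hausdorff[OF pg] tsp group.is_monoid[OF grp]
      by (simp add: closedin_Hausdorff_singleton monoid.one_closed)
  qed
  have "off K S = K \<inter> (\<Inter>j\<in>S. {x \<in> topspace TP. x j \<in> {\<one>\<^bsub>G j\<^esub>}})"
    using K closedin_subset by (fastforce simp: off_def)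
  moreover have "closedin TP (K \<inter> (\<Inter>j\<in>S. {x \<in> topspace TP. x j \<in> {\<one>\<^bsub>G j\<^esub>}}))"
  proof (cases "S = {}")
    case False
    then show ?thesis using c K by (intro closedin_Int closedin_Inter) auto
  qed (use K in simp)
  ultimately show ?thesis by simp
qed

text \<open>\<open>off K S\<close> is normal in \<open>K\<close>, so its projection is normal in
  \<open>H\<close>; the projection is closed by compactness and non-trivial because of
  \<open>k\<close>. As \<open>H\<close> is just infinite, it is open.\<close>

lemma proj_off_open:
  assumes K: "subgroup K P" "closedin TP K" and i: "i \<in> I" and S: "S \<subseteq> I"
    and H: "H \<in> open_subs i" and proj: "(\<lambda>x. x i) ` K = H"
    and k: "k \<in> off K S" "k i \<noteq> \<one>\<^bsub>G i\<^esub>"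
  shows "(\<lambda>x. x i) ` off K S \<in> open_subs i"
proof -
  interpret Gi: hji_group "G i" "T i" using hji[OF i] .
  interpret pr: group_hom P "G i" "\<lambda>x. x i" using proj_hom[OF i] .
  note Hp = Gi.open_subgroup_props[OF H]
  interpret H: profinite_group "subgrp (G i) H" "subtopology (T i) H" using Hp by blast
  have Kc: "K \<subseteq> carrier P" using K(1) subgroup.subset by blast
  let ?A = "(\<lambda>x. x i) ` off K S"
  have A: "subgroup ?A (G i)"
    using pr.subgroup_img_is_subgroup[OF off_subgroup[OF K(1) S]] .
  have sub: "?A \<subseteq> H" using proj by (auto simp: off_def)
  have sg: "subgroup ?A (subgrp (G i) H)" using Gi.subgroup_incl[OF A Hp(1) sub] .
  have "h \<otimes>\<^bsub>G i\<^esub> x \<otimes>\<^bsub>G i\<^esub> inv\<^bsub>G i\<^esub> h \<in> ?A" if h: "h \<in> H" and x: "x \<in> ?A" for h x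
  proof -
    obtain l where l: "l \<in> K" "h = l i" using h proj by blast
    obtain y where y: "y \<in> off K S" "x = y i" using x by blast
    have c: "l \<in> carrier P" "y \<in> carrier P" using l y Kc by (auto simp: off_def)
    let ?c = "l \<otimes>\<^bsub>P\<^esub> y \<otimes>\<^bsub>P\<^esub> inv\<^bsub>P\<^esub> l"
    have cK: "?c \<in> K" using K(1) l y by (auto simp: off_def subgroup.m_closed subgroup.m_inv_closed simp del: mult_product_group inv_product_group)
    have "?c j = \<one>\<^bsub>G j\<^esub>" if j: "j \<in> S" for j
    proof -
      have jI: "j \<in> I" using j S by blast
      interpret Gj: group "G j" using jI by simp
      show ?thesis unfolding comp_mult[OF jI] comp_inv[OF c(1) jI]
        using y j proj_in[OF c(1) jI] by (simp add: off_def)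
    qed
    then have "?c \<in> off K S" using cK by (simp add: off_def)
    moreover have "?c i = h \<otimes>\<^bsub>G i\<^esub> x \<otimes>\<^bsub>G i\<^esub> inv\<^bsub>G i\<^esub> h"
      unfolding comp_mult[OF i] comp_inv[OF c(1) i] using l y by simp
    ultimately show ?thesis by (metis imageI)
  qed
  then have "?A \<lhd> subgrp (G i) H" using H.normal_inv_iff sg Hp(1) sub by (simp add: subset_iff)
  moreover have "closedin (subtopology (T i) H) ?A"
    using proj_closed_subset[OF off_closed[OF K(2) S] i] sub closedin_subset_topspace by blast
  moreover have "?A \<noteq> {\<one>\<^bsub>G i\<^esub>}" using k by blast
  ultimately have "openin (subtopology (T i) H) ?A"
    using Hp(7) unfolding just_infinite_def by auto
  then show ?thesis using openin_trans_full Hp(2) A by (auto simp: open_subgroups_def)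
qed

lemma Ki_open_subgroups:
  assumes K: "subgroup K P" "closedin TP K" and i: "i \<in> I"
    and H: "H \<in> open_subs i" and proj: "(\<lambda>x. x i) ` K = H"
    and k: "k \<in> K" "k i \<noteq> \<one>\<^bsub>G i\<^esub>" "\<And>j. j \<in> I - {i} \<Longrightarrow> k j = \<one>\<^bsub>G j\<^esub>"
  shows "Ki K i \<in> open_subs i"
proof -
  have Kc: "K \<subseteq> carrier P" using K(1) subgroup.subset by blast
  have "Ki K i = (\<lambda>x. x i) ` off K (I - {i})"
  proof (intro Set.set_eqI iffI)
    fix h assume h: "h \<in> Ki K i"
    then have "single i h \<in> off K (I - {i})" by (simp add: Ki_def off_def single_def)
    moreover have "single i h i = h" using i by (simp add: single_def)
    ultimately show "h \<in> (\<lambda>x. x i) ` off K (I - {i})" by (metis image_eqI)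
  next
    fix h assume "h \<in> (\<lambda>x. x i) ` off K (I - {i})"
    then obtain x where x: "x \<in> off K (I - {i})" "h = x i" by blast
    have xc: "x \<in> carrier P" using x(1) Kc by (auto simp: off_def)
    have "single i h = x"
      by (rule P_ext[OF single_closed[OF i] xc]) (use x proj_in[OF xc i] in \<open>auto simp: off_def single_def\<close>)
    then show "h \<in> Ki K i" using x proj_in[OF xc i] by (simp add: Ki_def off_def)
  qed
  moreover have "k \<in> off K (I - {i})" using k by (simp add: off_def)
  ultimately show ?thesis
    using proj_off_open[OF K i Diff_subset H proj, of k "{i}"] k(2) by simp
qed

lemma product_open:
  assumes "\<And>i. i \<in> I \<Longrightarrow> openin (T i) (V i)"
  shows "openin TP (PiE I V)"
  using assms fin_I by (simp add: openin_PiE)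

text \<open>An isolated element makes \<open>Ki K i\<close> open, and \<open>K\<close> contains the
  product of these subgroups, an open box because \<open>I\<close> is finite.\<close>

lemma open_if_isolated:
  assumes K: "subgroup K P" "closedin TP K"
    and H: "\<And>i. i \<in> I \<Longrightarrow> H i \<in> open_subs i"
    and proj: "\<And>i. i \<in> I \<Longrightarrow> (\<lambda>x. x i) ` K = H i"
    and k: "\<And>i. i \<in> I \<Longrightarrow> \<exists>k\<in>K. k i \<noteq> \<one>\<^bsub>G i\<^esub> \<and> (\<forall>j\<in>I - {i}. k j = \<one>\<^bsub>G j\<^esub>)"
  shows "openin TP K"
proof -
  have o: "Ki K i \<in> open_subs i" if i: "i \<in> I" for i
    using k[OF i] Ki_open_subgroups[OF K i H[OF i] proj[OF i]] by blast
  have "PiE I (Ki K) \<subseteq> K"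
  proof
    fix x assume x: "x \<in> PiE I (Ki K)"
    have "(\<lambda>j\<in>I. if j \<in> I then x j else \<one>\<^bsub>G j\<^esub>) \<in> K"
      by (rule partial_product_in[OF K(1) fin_I]) (use x in auto)
    moreover have "(\<lambda>j\<in>I. if j \<in> I then x j else \<one>\<^bsub>G j\<^esub>) = x"
      using x by (auto simp: restrict_def PiE_def extensional_def fun_eq_iff)
    ultimately show "x \<in> K" by simp
  qed
  moreover have "openin TP (PiE I (Ki K))"
    by (rule product_open) (use o in \<open>auto simp: open_subgroups_def\<close>)
  moreover have "PiE I (Ki K) \<noteq> {}"
    using o by (auto simp: PiE_eq_empty_iff open_subgroups_def dest: subgroup.one_closed)
  ultimately show ?thesis using P.subgroup_openinI[OF K(1)] by blast
qed

text \<open>For a factor that is not virtually abelian, commutators combine elements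
  that vanish at different coordinates.\<close>

lemma isolate_nonabelian:
  assumes K: "subgroup K P" "closedin TP K" and i: "i \<in> I"
    and H: "H \<in> open_subs i" and proj: "(\<lambda>x. x i) ` K = H"
    and nva: "\<not> virtually_abelian (G i) (T i)"
    and S: "S \<subseteq> I" and pair: "\<And>j. j \<in> S \<Longrightarrow> \<exists>k\<in>K. k j = \<one>\<^bsub>G j\<^esub> \<and> k i \<noteq> \<one>\<^bsub>G i\<^esub>"
  shows "\<exists>k\<in>off K S. k i \<noteq> \<one>\<^bsub>G i\<^esub>"
proof -
  interpret Gi: hji_group "G i" "T i" using hji[OF i] .
  note Hp = Gi.open_subgroup_props[OF H]
  have Kc: "K \<subseteq> carrier P" using K(1) subgroup.subset by blast
  have "finite S" using S fin_I finite_subset by blast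
  then show ?thesis using S pair
  proof (induction S rule: finite_induct)
    case empty
    obtain x where "x \<in> H" "x \<noteq> \<one>\<^bsub>G i\<^esub>"
      using Hp(8) by (metis finite.emptyI finite_insert finite_subset singletonI subsetI)
    then show ?case using proj by (auto simp: off_def)
  next
    case (insert j S)
    obtain k1 where k1: "k1 \<in> off K S" "k1 i \<noteq> \<one>\<^bsub>G i\<^esub>" using insert by auto
    obtain k2 where k2: "k2 \<in> off K {j}" "k2 i \<noteq> \<one>\<^bsub>G i\<^esub>" using insert.prems by (auto simp: off_def)
    let ?A = "(\<lambda>x. x i) ` off K S" and ?B = "(\<lambda>x. x i) ` off K {j}"
    have "?A \<in> open_subs i"
      using proj_off_open[OF K i _ H proj k1] insert.prems by blast
    moreover have "?B \<in> open_subs i"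
      using proj_off_open[OF K i _ H proj k2] insert.prems by blast
    \<comment> \<open>The intersection is open, hence not commutative. Two of its elements that do
      not commute are lifted to \<open>K\<close>, one with trivial coordinates on \<open>S\<close>,
      the other with trivial coordinate \<open>j\<close>; the commutator of the lifts is trivial at
      all these coordinates.\<close>
    ultimately have "?A \<inter> ?B \<in> open_subs i" by (rule Gi.inter_open_subgroups)
    then have "\<not> (\<forall>a\<in>?A \<inter> ?B. \<forall>b\<in>?A \<inter> ?B. a \<otimes>\<^bsub>G i\<^esub> b = b \<otimes>\<^bsub>G i\<^esub> a)"
      using nva unfolding virtually_abelian_def by metis
    then obtain a b where ab: "a \<in> ?A" "b \<in> ?B" "a \<otimes>\<^bsub>G i\<^esub> b \<noteq> b \<otimes>\<^bsub>G i\<^esub> a"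
      by (meson IntD1 IntD2)
    obtain k where k: "k \<in> off K S" "k i = a" using ab by blast
    obtain l where l: "l \<in> off K {j}" "l i = b" using ab by blast
    have c: "k \<in> carrier P" "l \<in> carrier P" using k l Kc by (auto simp: off_def)
    let ?c = "k \<otimes>\<^bsub>P\<^esub> l \<otimes>\<^bsub>P\<^esub> inv\<^bsub>P\<^esub> k \<otimes>\<^bsub>P\<^esub> inv\<^bsub>P\<^esub> l"
    have cK: "?c \<in> K" using K(1) k l by (auto simp: off_def subgroup.m_closed subgroup.m_inv_closed simp del: mult_product_group inv_product_group)
    have cj: "?c s = k s \<otimes>\<^bsub>G s\<^esub> l s \<otimes>\<^bsub>G s\<^esub> inv\<^bsub>G s\<^esub> (k s) \<otimes>\<^bsub>G s\<^esub> inv\<^bsub>G s\<^esub> (l s)" if s: "s \<in> I" for s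
      unfolding comp_mult[OF s] comp_inv[OF c(1) s] comp_inv[OF c(2) s] ..
    have "?c s = \<one>\<^bsub>G s\<^esub>" if s: "s \<in> insert j S" for s
    proof -
      have sI: "s \<in> I" using s insert.prems by blast
      interpret Gs: group "G s" using sI by simp
      have "k s = \<one>\<^bsub>G s\<^esub> \<or> l s = \<one>\<^bsub>G s\<^esub>" using s k l by (auto simp: off_def)
      then show ?thesis unfolding cj[OF sI]
        using proj_in[OF c(1) sI] proj_in[OF c(2) sI] by auto
    qed
    then have "?c \<in> off K (insert j S)" using cK by (simp add: off_def)
    moreover have "?c i \<noteq> \<one>\<^bsub>G i\<^esub>"
    proof
      assume e: "?c i = \<one>\<^bsub>G i\<^esub>"
      have abc: "a \<in> carrier (G i)" "b \<in> carrier (G i)"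
        using proj_in[OF c(1) i] proj_in[OF c(2) i] k l by auto
      have "(a \<otimes>\<^bsub>G i\<^esub> b \<otimes>\<^bsub>G i\<^esub> inv\<^bsub>G i\<^esub> a) \<otimes>\<^bsub>G i\<^esub> inv\<^bsub>G i\<^esub> b = \<one>\<^bsub>G i\<^esub>"
        using e unfolding cj[OF i] using k l by simp
      then have "inv\<^bsub>G i\<^esub> (inv\<^bsub>G i\<^esub> b) = a \<otimes>\<^bsub>G i\<^esub> b \<otimes>\<^bsub>G i\<^esub> inv\<^bsub>G i\<^esub> a"
        using abc by (intro Gi.inv_equality) auto
      then have "b \<otimes>\<^bsub>G i\<^esub> a = a \<otimes>\<^bsub>G i\<^esub> b \<otimes>\<^bsub>G i\<^esub> inv\<^bsub>G i\<^esub> a \<otimes>\<^bsub>G i\<^esub> a" using abc by simp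
      then show False using ab(3) abc by (simp add: Gi.m_assoc)
    qed
    ultimately show ?case by blast
  qed
qed

end

text \<open>For a prime \<open>p\<close> in a profinite group this says that the closed subgroup
  generated by \<open>x\<close> is pro-p. Phrased with powers it can be tested on open subgroups
  that need not be normal.\<close>

definition p_element :: "nat \<Rightarrow> 'a monoid \<Rightarrow> 'a topology \<Rightarrow> 'a \<Rightarrow> bool" where
  "p_element p G T x \<longleftrightarrow> (\<forall>W\<in>open_subgroups G T. \<exists>k::nat. x [^]\<^bsub>G\<^esub> (p ^ k) \<in> W)"

lemma (in group) subgroup_npow_closed:
  "subgroup W G \<Longrightarrow> x \<in> W \<Longrightarrow> x [^] (n::nat) \<in> W"
  by (induction n) (auto simp: subgroup.one_closed subgroup.m_closed)

lemma (in group) coprime_powers_in_subgroup: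
  assumes W: "subgroup W G" and x: "x \<in> carrier G" and "x [^] (a::nat) \<in> W" "x [^] (b::nat) \<in> W" "coprime a b"
  shows "x \<in> W"
proof -
  obtain u v where "u * int a + v * int b = gcd (int a) (int b)"
    using bezout_int by blast
  then have uv: "int a * u + int b * v = 1" using assms(5) by (simp add: mult.commute)
  have "x = x [^] (int a * u + int b * v)" using uv x by (simp add: int_pow_1)
  also have "\<dots> = x [^] (int a * u) \<otimes> x [^] (int b * v)"
    using x by (rule int_pow_mult)
  also have "\<dots> = (x [^] a) [^] u \<otimes> (x [^] b) [^] v"
    using int_pow_pow[OF x] by (metis int_pow_int)
  also have "\<dots> \<in> W"
    using W assms(3,4) by (intro subgroup.m_closed[OF W] subgroup_int_pow_closed)
  finally show ?thesis .
qed

context hji_family begin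

text \<open>The coordinates in \<open>S\<close> are killed one at a time. Powers
  \<open>q ^ k\<close> of \<open>y\<close> bring coordinate \<open>j\<close> into any given open
  subgroup, while coordinate \<open>i\<close> stays outside a fixed open \<open>V\<close>: some
  \<open>p\<close>-power of \<open>y i\<close> lies in \<open>V\<close>, so by coprimality a
  \<open>q\<close>-power in \<open>V\<close> would force \<open>y i\<close> into \<open>V\<close>.
  Compactness then makes coordinate \<open>j\<close> exactly trivial.\<close>

lemma isolate_p_element:
  assumes K: "subgroup K P" "closedin TP K" and i: "i \<in> I"
    and p: "prime p" and Hi: "\<And>x. x \<in> K \<Longrightarrow> p_element p (G i) (T i) (x i)"
    and S: "finite S" "S \<subseteq> I"
    and Hj: "\<And>j. j \<in> S \<Longrightarrow> \<exists>q. prime q \<and> q \<noteq> p \<and> (\<forall>x\<in>K. p_element q (G j) (T j) (x j))"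
    and S0: "S0 \<subseteq> I" "\<exists>k\<in>off K S0. k i \<noteq> \<one>\<^bsub>G i\<^esub>"
  shows "\<exists>k\<in>off K (S \<union> S0). k i \<noteq> \<one>\<^bsub>G i\<^esub>"
  using S Hj
proof (induction S rule: finite_induct)
  case empty
  then show ?case using S0 by simp
next
  case (insert j S)
  interpret Gi: hji_group "G i" "T i" using hji[OF i] .
  have j: "j \<in> I" using insert by blast
  interpret Gj: hji_group "G j" "T j" using hji[OF j] .
  have Kc: "K \<subseteq> carrier P" using K(1) subgroup.subset by blast
  obtain y where y: "y \<in> off K (S \<union> S0)" "y i \<noteq> \<one>\<^bsub>G i\<^esub>" using insert by auto
  obtain q where q: "prime q" "q \<noteq> p" "\<forall>x\<in>K. p_element q (G j) (T j) (x j)" using insert.prems by blast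
  have yK: "y \<in> K" using y by (simp add: off_def)
  have yc: "y \<in> carrier P" using yK Kc by blast
  have SS: "S \<union> S0 \<subseteq> I" using insert S0 by blast
  note L = off_subgroup[OF K(1) SS] off_closed[OF K(2) SS]
  obtain V where V: "subgroup V (G i)" "openin (T i) V" "y i \<notin> V"
    using Gi.trivial_if_in_all_open_subgroups[OF proj_in[OF yc i]] y(2) by blast
  let ?D = "off K (S \<union> S0) \<inter> {x \<in> topspace TP. x i \<in> topspace (T i) - V}"
  have "closedin TP ?D"
    by (intro closedin_Int L closedin_continuous_map_preimage[OF continuous_proj[OF i]])
      (use V in blast)
  then have D: "compactin TP ?D" using compact_TP closedin_compact_space by blast
  have "\<exists>d\<in>?D. d j = \<one>\<^bsub>G j\<^esub>"
  proof (rule Gj.compact_image_hits_one[OF D continuous_proj[OF j]])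
    fix W assume W: "subgroup W (G j)" "openin (T j) W"
    then obtain k where k: "y j [^]\<^bsub>G j\<^esub> (q ^ k) \<in> W"
      using q(3) yK unfolding p_element_def open_subgroups_def by blast
    define d where "d = y [^]\<^bsub>P\<^esub> (q ^ k)"
    have dL: "d \<in> off K (S \<union> S0)" unfolding d_def by (rule P.subgroup_npow_closed[OF L(1) y(1)])
    have dc: "d \<in> carrier P" using dL Kc by (auto simp: off_def)
    have dcomp: "d s = y s [^]\<^bsub>G s\<^esub> (q ^ k)" if "s \<in> I" for s
      unfolding d_def using group_hom.hom_nat_pow[OF proj_hom[OF that] yc] by simp
    have "d i \<notin> V"
    proof
      assume "d i \<in> V"
      then have a: "y i [^]\<^bsub>G i\<^esub> (q ^ k) \<in> V" using dcomp i by simp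
      obtain e where e: "y i [^]\<^bsub>G i\<^esub> (p ^ e) \<in> V"
        using Hi[OF yK] V unfolding p_element_def open_subgroups_def by blast
      have "coprime (q ^ k) (p ^ e)"
        using q p by (simp add: primes_coprime)
      then show False
        using Gi.coprime_powers_in_subgroup[OF V(1) proj_in[OF yc i] a e] V(3) by blast
    qed
    then have "d \<in> ?D" using dL dc proj_in[OF dc i] tsp[OF i] topspace_TP by blast
    moreover have "d j \<in> W" using dcomp[OF j] k by simp
    ultimately show "\<exists>d\<in>?D. d j \<in> W" by blast
  qed
  then obtain d where d: "d \<in> ?D" "d j = \<one>\<^bsub>G j\<^esub>" by blast
  then have "d \<in> off K (insert j S \<union> S0)" by (auto simp: off_def)
  moreover have "d i \<noteq> \<one>\<^bsub>G i\<^esub>" using d subgroup.one_closed[OF V(1)] by auto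
  ultimately show ?case by blast
qed

end

section \<open>Virtually abelian factors\<close>

lemma (in group) pow_in_finite_index:
  assumes W: "subgroup W G" and fin: "finite (rcosets W)" and x: "x \<in> carrier G"
  shows "\<exists>n>0. x [^] (n::nat) \<in> W"
proof -
  have "\<not> inj (\<lambda>n::nat. W #> (x [^] n))"
  proof
    assume "inj (\<lambda>n::nat. W #> (x [^] n))"
    moreover have "range (\<lambda>n::nat. W #> (x [^] n)) \<subseteq> rcosets W"
      using x by (auto simp: RCOSETS_def)
    ultimately show False using fin by (metis finite_subset infinite_UNIV_nat finite_imageD)
  qed
  then obtain a b :: nat where ab: "a < b" "W #> (x [^] a) = W #> (x [^] b)"
    using linorder_inj_onI'[of UNIV "\<lambda>n. W #> (x [^] n)"] by blast
  have "x [^] b \<in> W #> (x [^] a)" using rcos_self[of "x [^] b" W] x W ab by simp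
  then have "x [^] b \<otimes> inv (x [^] a) \<in> W"
    using subgroup.rcos_module_imp[OF W is_group] x by simp
  moreover have "x [^] b = x [^] (b - a) \<otimes> x [^] a"
    using x ab by (simp add: nat_pow_mult)
  ultimately have "x [^] (b - a) \<in> W" using x by (simp add: m_assoc)
  then show ?thesis using ab by (metis zero_less_diff)
qed

text \<open>The order of \<open>x\<close> modulo \<open>W\<close>. It is meaningful for subgroups
  that are not normal, since the exponents that take \<open>x\<close> into \<open>W\<close> are the
  multiples of one number.\<close>

definition (in group) rel_ord :: "'a set \<Rightarrow> 'a \<Rightarrow> nat" where
  "rel_ord W x = (LEAST n. 0 < n \<and> x [^] n \<in> W)"

lemma (in group) rel_ord_dvd_iff:
  assumes W: "subgroup W G" and fin: "finite (rcosets W)" and x: "x \<in> carrier G"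
  shows "0 < rel_ord W x" "x [^] (e::nat) \<in> W \<longleftrightarrow> rel_ord W x dvd e"
proof -
  let ?n = "rel_ord W x"
  have n: "0 < ?n \<and> x [^] ?n \<in> W"
    unfolding rel_ord_def by (rule LeastI_ex[OF pow_in_finite_index[OF W fin x]])
  then show "0 < ?n" by simp
  have le: "?n \<le> m" if "0 < m" "x [^] m \<in> W" for m
    unfolding rel_ord_def using that by (intro Least_le) simp
  show "x [^] e \<in> W \<longleftrightarrow> ?n dvd e"
  proof
    assume e: "x [^] e \<in> W"
    have "x [^] e = x [^] (e mod ?n) \<otimes> (x [^] ?n) [^] (e div ?n)"
      using x by (simp add: nat_pow_pow nat_pow_mult)
    moreover have q: "(x [^] ?n) [^] (e div ?n) \<in> W" using subgroup_npow_closed[OF W] n by blast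
    ultimately have "x [^] (e mod ?n) = x [^] e \<otimes> inv ((x [^] ?n) [^] (e div ?n))"
      using x by (simp add: m_assoc)
    then have "x [^] (e mod ?n) \<in> W" using W e q by (simp add: subgroup.m_closed subgroup.m_inv_closed)
    then have "\<not> 0 < e mod ?n" using le[of "e mod ?n"] n by (meson mod_less_divisor not_le)
    then show "?n dvd e" by auto
  next
    assume "?n dvd e"
    then obtain c where "e = ?n * c" by blast
    then show "x [^] e \<in> W" using subgroup_npow_closed[OF W] n x by (simp add: nat_pow_pow[symmetric])
  qed
qed

context hji_group begin

lemma open_subgroup_finite_index:
  assumes "W \<in> open_subgroups G T"
  shows "subgroup W G" "finite (rcosets W)"
  using assms finite_rcosets_open[OF compact] by (auto simp: open_subgroups_def)

lemma finite_Inter_open_subgroups: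
  "finite F \<Longrightarrow> F \<subseteq> open_subgroups G T \<Longrightarrow> V \<in> open_subgroups G T \<Longrightarrow> V \<inter> \<Inter>F \<in> open_subgroups G T"
proof (induction F rule: finite_induct)
  case (insert W F)
  have "V \<inter> \<Inter>(insert W F) = W \<inter> (V \<inter> \<Inter>F)" by auto
  then show ?case using insert inter_open_subgroups[of W "V \<inter> \<Inter>F"] by auto
qed simp

text \<open>The element is a \<open>p\<close>-component of \<open>a\<close>, obtained by compactness
  from the powers \<open>a [^] m W\<close>, where \<open>m W\<close> is the part prime to
  \<open>p\<close> of the order of \<open>a\<close> modulo \<open>W\<close>. The prime divides the
  order of \<open>a\<close> modulo \<open>V\<close>, which keeps these powers outside
  \<open>V\<close> and the limit non-trivial.\<close>

lemma exists_p_element: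
  assumes A: "A \<in> open_subgroups G T"
  obtains p x where "prime p" "x \<in> A" "x \<noteq> \<one>" "p_element p G T x"
proof -
  note Ap = open_subgroup_props[OF A]
  obtain a where a: "a \<in> A" "a \<noteq> \<one>"
    using Ap(8) by (metis finite.emptyI finite_insert finite_subset singletonI subsetI)
  have ac: "a \<in> carrier G" using a Ap by blast
  obtain V where V: "V \<in> open_subgroups G T" "a \<notin> V"
    using trivial_if_in_all_open_subgroups[OF ac] a(2) unfolding open_subgroups_def by blast
  note ro = rel_ord_dvd_iff[OF open_subgroup_finite_index ac]
  have "rel_ord V a \<noteq> 1"
    using ro(2)[OF V(1) V(1), of 1] V(2) ac by auto
  then obtain p where p: "prime p" "p dvd rel_ord V a" using prime_factor_nat by blast
  define k where "k W = multiplicity p (rel_ord W a)" for W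
  define m where "m W = rel_ord W a div p ^ k W" for W
  have km: "rel_ord W a = p ^ k W * m W" "\<not> p dvd m W" if W: "W \<in> open_subgroups G T" for W
  proof -
    have "rel_ord W a \<noteq> 0" using ro(1)[OF W W] by simp
    moreover have "\<not> is_unit p" using p(1) not_prime_unit by blast
    ultimately show "\<not> p dvd m W" unfolding m_def k_def by (intro multiplicity_decompose)
    show "rel_ord W a = p ^ k W * m W"
      unfolding m_def k_def by (simp add: multiplicity_dvd)
  qed
  define F where "F W = {x \<in> topspace T. x \<in> A - V \<and> x [^] (p ^ k W) \<in> W}" for W
  let ?W = "{W \<in> open_subgroups G T. W \<subseteq> V}"
  have "\<Inter>(F ` ?W) \<noteq> {}"
  proof (rule compact[unfolded compact_space_fip, rule_format], safe)
    fix W assume W: "W \<in> open_subgroups G T" "W \<subseteq> V"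
    have "F W = (A - V) \<inter> {x \<in> topspace T. x [^] (p ^ k W) \<in> W}"
      using Ap(4) topspace_eq by (auto simp: F_def)
    moreover have "closedin T {x \<in> topspace T. x [^] (p ^ k W) \<in> W}"
      by (rule closedin_continuous_map_preimage[OF continuous_map_npow[OF continuous_map_ident] open_subgroup_props(3)[OF W(1)]])
    ultimately show "closedin T (F W)"
      using Ap(3) open_subgroup_props(2)[OF V(1)] by (simp add: closedin_Int closedin_diff)
  next
    fix \<F> assume f: "finite \<F>" "\<F> \<subseteq> F ` ?W" and e: "\<Inter>\<F> = {}"
    obtain W where W: "finite W" "W \<subseteq> ?W" "\<F> = F ` W"
      using finite_subset_image[OF f] by blast
    \<comment> \<open>One exponent \<open>m W0\<close> serves the whole finite family: for
      \<open>w\<close> in it, the order of \<open>a\<close> modulo \<open>w\<close> divides the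
      order modulo \<open>W0\<close>, and \<open>m w\<close> is prime to \<open>p\<close>, so
      \<open>m w\<close> divides \<open>m W0\<close>.\<close>
    define W0 where "W0 = V \<inter> \<Inter>W"
    have W0: "W0 \<in> open_subgroups G T"
      unfolding W0_def by (rule finite_Inter_open_subgroups) (use W V in auto)
    have W0V: "W0 \<subseteq> V" by (simp add: W0_def)
    let ?x = "a [^] m W0"
    have "?x \<in> F w" if w: "w \<in> W" for w
    proof -
      have wo: "w \<in> open_subgroups G T" using w W by blast
      have "?x \<in> A" using subgroup_npow_closed[OF Ap(1) a(1)] .
      moreover have "?x \<notin> V"
      proof
        assume "?x \<in> V"
        then have "rel_ord V a dvd m W0" using ro(2)[OF V(1) V(1)] by blast
        then show False using p(2) km(2)[OF W0] dvd_trans by blast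
      qed
      moreover have "?x [^] (p ^ k w) \<in> w"
      proof -
        have "a [^] rel_ord W0 a \<in> W0" using ro(2)[OF W0 W0] by simp
        then have "a [^] rel_ord W0 a \<in> w" using w by (simp add: W0_def)
        then have "rel_ord w a dvd rel_ord W0 a" using ro(2)[OF wo wo] by blast
        then have "m w dvd p ^ k W0 * m W0" using km(1)[OF wo] km(1)[OF W0] by (metis dvd_mult_right)
        moreover have "coprime (m w) (p ^ k W0)"
          using km(2)[OF wo] p(1) by (simp add: coprime_commute prime_imp_coprime)
        ultimately have "m w dvd m W0" using coprime_dvd_mult_right_iff by blast
        then have "rel_ord w a dvd m W0 * p ^ k w" using km(1)[OF wo] by (simp add: mult.commute)
        then have "a [^] (m W0 * p ^ k w) \<in> w" using ro(2)[OF wo wo] by blast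
        then show ?thesis using ac by (simp add: nat_pow_pow)
      qed
      ultimately show ?thesis using Ap(4) topspace_eq by (auto simp: F_def)
    qed
    then have "?x \<in> \<Inter>\<F>" using W(3) by blast
    then show False using e by blast
  qed
  then obtain x where x: "\<And>W. W \<in> open_subgroups G T \<Longrightarrow> W \<subseteq> V \<Longrightarrow> x \<in> F W" by blast
  have "x \<in> A" "x \<notin> V" using x[OF V(1)] by (auto simp: F_def)
  moreover have "x \<noteq> \<one>" using \<open>x \<notin> V\<close> open_subgroup_props(5)[OF V(1)] by blast
  moreover have "p_element p G T x"
    unfolding p_element_def
  proof
    fix W assume "W \<in> open_subgroups G T"
    then have "x \<in> F (W \<inter> V)" using x inter_open_subgroups[OF _ V(1)] by blast
    then show "\<exists>k. x [^] p ^ k \<in> W" by (auto simp: F_def)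
  qed
  ultimately show ?thesis using that p(1) by blast
qed

lemma coset_meets_dense:
  assumes D: "c \<in> T closure_of D" and W: "openin T W" "\<one> \<in> W" and cc: "c \<in> carrier G"
  obtains g w where "g \<in> D" "w \<in> W" "g = w \<otimes> c"
proof -
  have "openin T (W #> c)" using openin_coset[OF W(1) cc] .
  moreover have "c \<in> W #> c" using W(2) cc by (force simp: r_coset_def)
  ultimately obtain g where "g \<in> D" "g \<in> W #> c"
    using D unfolding in_closure_of by blast
  then show ?thesis using that by (auto simp: r_coset_def)
qed

lemma closure_generate_singleton:
  assumes x: "x \<in> carrier G"
  shows "subgroup (T closure_of (generate G {x})) G" "x \<in> T closure_of (generate G {x})"
proof -
  have s: "subgroup (generate G {x}) G" using x by (simp add: generate_is_subgroup)
  then show "subgroup (T closure_of (generate G {x})) G" by (rule closure_subgroup)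
  have "generate G {x} \<subseteq> T closure_of (generate G {x})"
    using s by (simp add: closure_of_subset subgroup.subset topspace_eq)
  then show "x \<in> T closure_of (generate G {x})" using generate.incl[of x "{x}" G] by blast
qed

lemma commuting_int_pow:
  assumes "x \<in> carrier G" "y \<in> carrier G" "x \<otimes> y = y \<otimes> x"
  shows "(x \<otimes> y) [^] (n::nat) = x [^] n \<otimes> y [^] n"
  using assms pow_mult_distrib by blast

text \<open>By density some \<open>w \<otimes> y\<close> with \<open>w\<close> in \<open>W\<close>
  is a power of \<open>x\<close>. Commutativity splits its \<open>p ^ k\<close>-th power, which
  leaves \<open>y [^] (p ^ k)\<close> in \<open>W\<close>.\<close>

lemma p_element_closure:
  assumes A: "subgroup A G" and comm: "\<And>a b. a \<in> A \<Longrightarrow> b \<in> A \<Longrightarrow> a \<otimes> b = b \<otimes> a"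
    and C: "T closure_of (generate G {x}) \<subseteq> A" and Ao: "openin T A"
    and x: "x \<in> carrier G" "p_element p G T x" and y: "y \<in> T closure_of (generate G {x})"
  shows "p_element p G T y"
  unfolding p_element_def
proof
  fix W assume W: "W \<in> open_subgroups G T"
  have AW: "W \<inter> A \<in> open_subgroups G T"
    using inter_open_subgroups[OF W] A Ao by (simp add: open_subgroups_def)
  have yc: "y \<in> carrier G" "y \<in> A" using y C subgroup.subset[OF A] by auto
  obtain g w where gw: "g \<in> generate G {x}" "w \<in> W \<inter> A" "g = w \<otimes> y"
    using coset_meets_dense[OF y open_subgroup_props(2,5)[OF AW] yc(1)] .
  obtain z :: int where z: "g = x [^] z" using gw(1) generate_pow[OF x(1)] by blast
  obtain k where k: "x [^] (p ^ k) \<in> W" using x(2) W by (auto simp: p_element_def)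
  have sW: "subgroup W G" using W by (simp add: open_subgroups_def)
  have wc: "w \<in> carrier G" using gw subgroup.mem_carrier[OF sW] by simp
  have "g [^] (p ^ k) = (x [^] (p ^ k)) [^] z"
    unfolding z using x(1) by (metis int_pow_int int_pow_pow mult.commute)
  then have "g [^] (p ^ k) \<in> W" using k subgroup_int_pow_closed[OF sW] by simp
  moreover have "g [^] (p ^ k) = w [^] (p ^ k) \<otimes> y [^] (p ^ k)"
    unfolding gw(3) by (rule commuting_int_pow) (use wc yc comm gw(2) in auto)
  moreover have wW: "w [^] (p ^ k) \<in> W" using gw(2) subgroup_npow_closed[OF sW] by blast
  ultimately have "inv (w [^] (p ^ k)) \<otimes> (w [^] (p ^ k) \<otimes> y [^] (p ^ k)) \<in> W"
    using sW by (metis subgroup.m_closed subgroup.m_inv_closed)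
  then have "y [^] (p ^ k) \<in> W" using wc yc by (simp add: m_assoc[symmetric])
  then show "\<exists>k. y [^] p ^ k \<in> W" by blast
qed

text \<open>The powers of \<open>x\<close> are dense in \<open>C\<close>, so every coset of the open
  subgroup \<open>N\<close> contains one, and two powers share a coset exactly when their exponents
  agree modulo \<open>rel_ord N x\<close>.\<close>

lemma card_rcosets_procyclic:
  assumes x: "x \<in> carrier G" and C: "C = T closure_of (generate G {x})"
    and N: "N \<in> open_subgroups G T" "N \<subseteq> C"
  shows "card (rcosets\<^bsub>subgrp G C\<^esub> N) = rel_ord N x"
proof -
  have Cs: "subgroup C G" "x \<in> C" using closure_generate_singleton[OF x] C by auto
  have Ns: "subgroup N G" using N by (simp add: open_subgroups_def)
  have rc: "rcosets\<^bsub>subgrp G C\<^esub> N = (\<lambda>c. N #> c) ` C" by (auto simp: RCOSETS_def)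
  note ro = rel_ord_dvd_iff[OF open_subgroup_finite_index[OF N(1)] x]
  let ?n = "rel_ord N x"
  have eq: "N #> u = N #> v" if "u \<in> carrier G" "v \<in> carrier G" "u \<otimes> inv v \<in> N" for u v
    using repr_independence[OF subgroup.rcos_module_rev[OF Ns is_group that(2,1,3)] that(2) Ns] by simp
  have "bij_betw (\<lambda>e. N #> (x [^] e)) {..<?n} ((\<lambda>c. N #> c) ` C)"
    unfolding bij_betw_def
  proof
    have "e = f" if h: "e \<le> f" "f < ?n" "N #> (x [^] e) = N #> (x [^] f)" for e f
    proof -
      have "x [^] f \<in> N #> (x [^] e)" using rcos_self[of "x [^] f" N] x Ns h by simp
      then have "x [^] f \<otimes> inv (x [^] e) \<in> N"
        using subgroup.rcos_module_imp[OF Ns is_group] x by simp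
      moreover have "x [^] f = x [^] (f - e) \<otimes> x [^] e"
        using x h by (simp add: nat_pow_mult)
      ultimately have "x [^] (f - e) \<in> N" using x by (simp add: m_assoc)
      then have "?n dvd f - e" using ro by blast
      then show "e = f" using h by (meson diff_is_0_eq dvd_imp_le le_antisym less_imp_diff_less not_le not_gr0)
    qed
    then show "inj_on (\<lambda>e. N #> (x [^] e)) {..<?n}"
      unfolding inj_on_def by (metis lessThan_iff nat_le_linear)
    show "(\<lambda>e. N #> (x [^] e)) ` {..<?n} = (\<lambda>c. N #> c) ` C"
    proof safe
      fix e :: nat show "N #> (x [^] e) \<in> (\<lambda>c. N #> c) ` C"
        using subgroup_npow_closed[OF Cs] by blast
    next
      fix c assume c: "c \<in> C"
      have cc: "c \<in> carrier G" using c subgroup.mem_carrier[OF Cs(1)] by blast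
      obtain g w where gw: "g \<in> generate G {x}" "w \<in> N" "g = w \<otimes> c"
        using coset_meets_dense[OF c[unfolded C] open_subgroup_props(2,5)[OF N(1)] cc] .
      obtain z :: int where z: "g = x [^] z" using gw(1) generate_pow[OF x] by blast
      have wc: "w \<in> carrier G" using gw subgroup.mem_carrier[OF Ns] by simp
      have 1: "N #> g = N #> c" by (rule eq) (use gw wc cc in \<open>simp_all add: m_assoc\<close>)
      define e where "e = nat (z mod int ?n)"
      have e: "e < ?n" "int e = z mod int ?n" using ro(1) by (auto simp: e_def nat_less_iff)
      have "z = int ?n * (z div int ?n) + int e" using e by simp
      then have "x [^] z = x [^] (int ?n * (z div int ?n) + int e)" by simp
      also have "\<dots> = x [^] (int ?n * (z div int ?n)) \<otimes> x [^] int e" using x by (rule int_pow_mult)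
      also have "\<dots> = (x [^] ?n) [^] (z div int ?n) \<otimes> x [^] e"
        using int_pow_pow[OF x] by (metis int_pow_int)
      finally have "x [^] z = (x [^] ?n) [^] (z div int ?n) \<otimes> x [^] e" .
      moreover have "(x [^] ?n) [^] (z div int ?n) \<in> N"
        by (rule subgroup_int_pow_closed[OF Ns]) (use ro in simp)
      ultimately have "N #> g = N #> (x [^] e)"
        unfolding z using x by (intro eq) (simp_all add: m_assoc)
      then show "N #> c \<in> (\<lambda>e. N #> (x [^] e)) ` {..<?n}" using 1 e by auto
    qed
  qed
  then show ?thesis unfolding rc by (metis bij_betw_same_card card_lessThan)
qed

text \<open>In an abelian open subgroup \<open>B\<close> every closed subgroup is normal. As
  \<open>B\<close> is just infinite, the closed subgroup generated by a single non-trivial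
  \<open>p\<close>-element is already open.\<close>

lemma virtually_abelian_cases:
  assumes va: "virtually_abelian G T" and U: "U \<in> open_subgroups G T"
  obtains p z H where "prime p" "virtually_Zp p G T" "z \<in> carrier G" "H = T closure_of (generate G {z})"
    "H \<in> open_subgroups G T" "H \<subseteq> U" "\<And>x. x \<in> H \<Longrightarrow> p_element p G T x"
    "\<And>x y. x \<in> H \<Longrightarrow> y \<in> H \<Longrightarrow> x \<otimes> y = y \<otimes> x"
proof -
  obtain A where A: "A \<in> open_subgroups G T" "\<And>x y. x \<in> A \<Longrightarrow> y \<in> A \<Longrightarrow> x \<otimes> y = y \<otimes> x"
    using va unfolding virtually_abelian_def by metis
  define B where "B = A \<inter> U"
  have B: "B \<in> open_subgroups G T" using inter_open_subgroups A(1) U by (simp add: B_def)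
  have commB: "\<And>x y. x \<in> B \<Longrightarrow> y \<in> B \<Longrightarrow> x \<otimes> y = y \<otimes> x" using A(2) by (simp add: B_def)
  note Bp = open_subgroup_props[OF B]
  obtain p z where pz: "prime p" "z \<in> B" "z \<noteq> \<one>" "p_element p G T z"
    using exists_p_element[OF B] .
  have zc: "z \<in> carrier G" using pz Bp by blast
  define H where "H = T closure_of (generate G {z})"
  have Hs: "subgroup H G" "z \<in> H" "closedin T H"
    using closure_generate_singleton[OF zc] by (auto simp: H_def)
  have "generate G {z} \<subseteq> B" by (rule generate_subgroup_incl) (use pz Bp in auto)
  then have HB: "H \<subseteq> B" unfolding H_def using Bp(3) by (rule closure_of_minimal)
  have HsB: "subgroup H (subgrp G B)" using subgroup_incl[OF Hs(1) Bp(1) HB] .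
  have "comm_group (subgrp G B)"
    by (rule group.group_comm_groupI[OF subgroup_imp_group[OF Bp(1)]]) (simp add: commB)
  then have "H \<lhd> subgrp G B" using HsB comm_group.subgroup_imp_normal by blast
  moreover have "closedin (subtopology T B) H" using Hs(3) HB closedin_subset_topspace by blast
  moreover have "H \<noteq> {\<one>}" using pz Hs by blast
  ultimately have "openin (subtopology T B) H" using Bp(7) by (simp add: just_infinite_def)
  then have Ho: "openin T H" using Bp(2) openin_trans_full by blast
  have HO: "H \<in> open_subgroups G T" using Ho Hs by (simp add: open_subgroups_def)
  note Hp = open_subgroup_props[OF HO]
  have pe: "p_element p G T x" if "x \<in> H" for x
    using p_element_closure[OF Bp(1) commB HB[unfolded H_def] Bp(2) zc pz(4) that[unfolded H_def]] .
  have "virtually_Zp p G T"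
    unfolding virtually_Zp_def
  proof (intro bexI[OF _ HO] conjI)
    show "infinite H" by (rule Hp(8))
    have "topologically_generates (subgrp G H) (subtopology T H) {z}"
      using topologically_generates_subgroup_iff[OF is_group Hs(1,3)] Hs(2) by (simp add: H_def)
    then show "procyclic (subgrp G H) (subtopology T H)"
      unfolding procyclic_def using Hp(6) Hs(2) by auto
    show "pro_p_group p (subgrp G H) (subtopology T H)"
      unfolding pro_p_group_def
    proof (intro conjI allI impI Hp(6))
      fix N assume N: "N \<lhd> subgrp G H \<and> openin (subtopology T H) N"
      have sN: "subgroup N (subgrp G H)" using N normal_imp_subgroup by blast
      have NO: "N \<in> open_subgroups G T"
        using N incl_subgroup[OF Hs(1) sN] openin_trans_full Ho by (auto simp: open_subgroups_def)
      have "N \<subseteq> H" using subgroup.subset[OF sN] by simp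
      then have c: "card (rcosets\<^bsub>subgrp G H\<^esub> N) = rel_ord N z"
        using card_rcosets_procyclic[OF zc H_def NO] by blast
      obtain k where "z [^] (p ^ k) \<in> N" using pz(4) NO by (auto simp: p_element_def)
      then have "rel_ord N z dvd p ^ k"
        using rel_ord_dvd_iff[OF open_subgroup_finite_index[OF NO] zc] by blast
      then show "\<exists>k. card (rcosets\<^bsub>subgrp G H\<^esub> N) = p ^ k"
        unfolding c using pz(1) divides_primepow_nat by blast
    qed
  qed
  then show ?thesis
    by (rule that[OF pz(1) _ zc H_def HO _ pe]) (use HB commB in \<open>auto simp: B_def\<close>)
qed

end

section \<open>The upper bound\<close>

context hji_group begin

text \<open>If \<open>z\<close> were torsion, its powers would form a finite and hence closed
  subgroup, which would be all of \<open>C\<close>.\<close>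

lemma procyclic_nontorsion:
  assumes z: "z \<in> carrier G" and C: "C = T closure_of (generate G {z})" and inf: "infinite C"
    and E: "0 < E"
  shows "z [^] (E::nat) \<noteq> \<one>"
proof
  assume e: "z [^] E = \<one>"
  have "generate G {z} \<subseteq> (\<lambda>e. z [^] e) ` {..<E}"
  proof
    fix g assume "g \<in> generate G {z}"
    then obtain k :: int where k: "g = z [^] k" using generate_pow[OF z] by blast
    have d: "k = int E * (k div int E) + int (nat (k mod int E))" using E by simp
    have "z [^] k = z [^] (int E * (k div int E)) \<otimes> z [^] int (nat (k mod int E))"
      using int_pow_mult[OF z] d by metis
    also have "z [^] (int E * (k div int E)) = (z [^] E) [^] (k div int E)"
      using int_pow_pow[OF z] by (metis int_pow_int)
    finally have "g = z [^] nat (k mod int E)"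
      using e z k int_pow_int by (simp add: int_pow_one int_pow_int)
    moreover have "nat (k mod int E) < E" using E by (simp add: nat_less_iff)
    ultimately show "g \<in> (\<lambda>e. z [^] e) ` {..<E}" by blast
  qed
  then have fin: "finite (generate G {z})" using finite_surj by blast
  have "generate G {z} \<subseteq> topspace T" using generate_incl[of "{z}"] z topspace_eq by simp
  then have "closedin T (generate G {z})"
    using fin Hausdorff by (simp add: closedin_Hausdorff_finite)
  then have "C = generate G {z}" using C closure_of_eq by metis
  then show False using fin inf by simp
qed

end

lemma closure_generate_sandwich:
  fixes G :: "'a monoid"
  assumes "group G" "subgroup H G" "closedin T H" "S \<subseteq> X" "X \<subseteq> H" "T closure_of (generate G S) = H"
  shows "T closure_of (generate G X) = H"
proof
  have "generate G X \<subseteq> H" using group.generate_subgroup_incl[OF assms(1) assms(5,2)] .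
  then show "T closure_of (generate G X) \<subseteq> H" using assms(3) by (rule closure_of_minimal)
  have "generate G S \<subseteq> generate G X" using group.mono_generate[OF assms(1,4)] .
  then show "H \<subseteq> T closure_of (generate G X)" using assms(6) closure_of_mono by metis
qed

text \<open>\<open>u\<close> pads the enumeration to \<open>m\<close> positions, so that generating
  sets of all factors can be read in parallel as \<open>m\<close> tuples.\<close>

lemma enumerate_generators:
  assumes "finite S" "card S \<le> m" "S \<subseteq> H" "u \<in> H"
  shows "\<exists>x::nat \<Rightarrow> 'a. S \<subseteq> x ` {..<m} \<and> x ` {..<m} \<subseteq> H"
proof -
  obtain b where b: "bij_betw b {0..<card S} S"
    using ex_bij_betw_nat_finite[OF assms(1)] by blast
  let ?x = "\<lambda>k. if k < card S then b k else u"
  have "S \<subseteq> ?x ` {..<m}"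
  proof
    fix s assume "s \<in> S"
    then have "s \<in> b ` {0..<card S}" using bij_betw_imp_surj_on[OF b] by simp
    then obtain k where "k < card S" "s = b k" by auto
    then show "s \<in> ?x ` {..<m}" using assms(2) by (intro image_eqI[of _ _ k]) auto
  qed
  moreover have "?x ` {..<m} \<subseteq> H" using b assms(3,4) by (auto simp: bij_betw_def)
  ultimately show ?thesis by blast
qed

section \<open>Choice of the subgroups of the factors and of their generators\<close>

context hji_family begin

definition nonisomorphic_choice where
  "nonisomorphic_choice m U B H S \<longleftrightarrow>
    (\<forall>i\<in>B. H i \<in> open_subs i \<and> H i \<subseteq> U i \<and> finite (S i) \<and> card (S i) \<le> m \<and>
      topologically_generates (subgrp (G i) (H i)) (subtopology (T i) (H i)) (S i)) \<and>
    (\<forall>i\<in>B. \<forall>j\<in>B. i \<noteq> j \<longrightarrow> \<not> isomorphic_parts i (H i) j (H j))"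

lemma nonisomorphic_choiceD:
  assumes "nonisomorphic_choice m U B H S"
  shows "i \<in> B \<Longrightarrow> H i \<in> open_subs i" "i \<in> B \<Longrightarrow> H i \<subseteq> U i"
    "i \<in> B \<Longrightarrow> finite (S i)" "i \<in> B \<Longrightarrow> card (S i) \<le> m"
    "i \<in> B \<Longrightarrow> topologically_generates (subgrp (G i) (H i)) (subtopology (T i) (H i)) (S i)"
    "i \<in> B \<Longrightarrow> j \<in> B \<Longrightarrow> i \<noteq> j \<Longrightarrow> \<not> isomorphic_parts i (H i) j (H j)"
  using assms by (simp_all add: nonisomorphic_choice_def)

text \<open>The factors are treated one at a time: the allowed region of the new factor is shrunk
  away from all earlier \<open>H j\<close>, and only then does its lower rank supply
  \<open>L\<close> inside that region. The generating sets are recorded because the avoidance holds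
  for finitely generated subgroups.\<close>

lemma choose_nonisomorphic:
  assumes B: "finite B" "B \<subseteq> I" and nva: "\<And>i. i \<in> B \<Longrightarrow> \<not> virtually_abelian (G i) (T i)"
    and U: "\<And>i. i \<in> B \<Longrightarrow> U i \<in> open_subs i"
    and lr: "\<And>i. i \<in> B \<Longrightarrow> lower_rank (G i) (T i) \<le> enat m"
  shows "\<exists>H S. nonisomorphic_choice m U B H S"
  using assms
proof (induction B rule: finite_induct)
  case empty
  then show ?case by (simp add: nonisomorphic_choice_def)
next
  case (insert i B)
  have "\<exists>H S. nonisomorphic_choice m U B H S"
    by (rule insert.IH) (use insert.prems in auto)
  then obtain H S where "nonisomorphic_choice m U B H S" by blast
  note HS = nonisomorphic_choiceD[OF this]
  have iI: "i \<in> I" using insert.prems by blast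
  interpret Gi: hji_group "G i" "T i" using hji[OF iI] .
  obtain U' where U': "U' \<in> open_subs i" "U' \<subseteq> U i"
    "\<And>L S j. \<lbrakk>L \<in> open_subs i; L \<subseteq> U'; finite S; j \<in> B;
       topologically_generates (subgrp (G i) L) (subtopology (T i) L) S\<rbrakk>
      \<Longrightarrow> \<not> isomorphic_parts i L j (H j)"
    using Gi.shrink_avoiding_isos[OF insert.hyps(1) insert.prems(3)[OF insertI1] insert.prems(2)[OF insertI1],
      of "\<lambda>j. subgrp (G j) (H j)" "\<lambda>j. subtopology (T j) (H j)"] by blast
  have "lower_rank (G i) (T i) \<le> enat m" using insert.prems by blast
  then obtain L where L: "L \<in> open_subs i" "L \<subseteq> U'"
    "min_generators (subgrp (G i) L) (subtopology (T i) L) \<le> enat m"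
    using U'(1) unfolding min_generators_lower_rank_iff by blast
  then obtain S0 where S0: "finite S0" "card S0 \<le> m"
    "topologically_generates (subgrp (G i) L) (subtopology (T i) L) S0"
    unfolding min_generators_le_enat_iff by blast
  have n1: "\<not> isomorphic_parts i L j (H j)"
    if "j \<in> B" for j
    using U'(3)[OF L(1,2) S0(1) that S0(3)] .
  have n2: "\<not> isomorphic_parts j (H j) i L"
    if j: "j \<in> B" for j
  proof -
    have jI: "j \<in> I" using j insert.prems by blast
    interpret Gj: hji_group "G j" "T j" using hji[OF jI] .
    note Hj = Gj.open_subgroup_props[OF HS(1)[OF j]]
    have "group (subgrp (G j) (H j))" "carrier (subgrp (G j) (H j)) = topspace (subtopology (T j) (H j))"
      using Gj.subgroup_imp_group Hj Gj.topspace_eq by auto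
    then show ?thesis using top_isomorphic_sym n1[OF j] by blast
  qed
  show ?case
    unfolding nonisomorphic_choice_def
  proof (rule exI[of _ "H(i := L)"], rule exI[of _ "S(i := S0)"], intro conjI ballI impI)
    fix k assume k: "k \<in> insert i B"
    show "(H(i := L)) k \<in> open_subs k" using k L HS by auto
    show "(H(i := L)) k \<subseteq> U k" using k L HS U' by auto
    show "finite ((S(i := S0)) k)" using k S0 HS by auto
    show "card ((S(i := S0)) k) \<le> m" using k S0 HS by auto
    show "topologically_generates (subgrp (G k) ((H(i := L)) k)) (subtopology (T k) ((H(i := L)) k)) ((S(i := S0)) k)"
      using k S0 HS by auto
    fix j assume j: "j \<in> insert i B" and kj: "k \<noteq> j"
    then consider "k = i" "j \<in> B" "j \<noteq> i" | "k \<in> B" "k \<noteq> i" "j = i" | "k \<in> B" "j \<in> B" "k \<noteq> i" "j \<noteq> i"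
      using k by blast
    then show "\<not> top_isomorphic (subgrp (G k) ((H(i := L)) k)) (subtopology (T k) ((H(i := L)) k))
      (subgrp (G j) ((H(i := L)) j)) (subtopology (T j) ((H(i := L)) j))"
      using n1 n2 HS(6) kj by cases auto
  qed
qed

text \<open>Contrapositive of \<open>top_isomorphic_nested_kernels\<close> for the two projections
  of \<open>K\<close>, with \<open>Hj\<close> as the just infinite quotient and \<open>Hi\<close> as
  the infinite one.\<close>

lemma separate_nonisomorphic:
  assumes K: "subgroup K P" "closedin TP K" and i: "i \<in> I" and j: "j \<in> I"
    and Hi: "Hi \<in> open_subs i" "(\<lambda>x. x i) ` K = Hi"
    and Hj: "Hj \<in> open_subs j" "(\<lambda>x. x j) ` K = Hj"
    and n: "\<not> isomorphic_parts j Hj i Hi"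
  shows "\<exists>k\<in>K. k j = \<one>\<^bsub>G j\<^esub> \<and> k i \<noteq> \<one>\<^bsub>G i\<^esub>"
proof (rule ccontr)
  assume a: "\<not> ?thesis"
  interpret Gi: hji_group "G i" "T i" using hji[OF i] .
  interpret Gj: hji_group "G j" "T j" using hji[OF j] .
  note Hip = Gi.open_subgroup_props[OF Hi(1)]
  note Hjp = Gj.open_subgroup_props[OF Hj(1)]
  have Kc: "K \<subseteq> carrier P" using K(1) subgroup.subset by blast
  have hom: "(\<lambda>x. x s) \<in> hom (P\<lparr>carrier := K\<rparr>) (subgrp (G s) Hs)"
    "(\<lambda>x. x s) ` carrier (P\<lparr>carrier := K\<rparr>) = carrier (subgrp (G s) Hs)"
    "continuous_map (subtopology TP K) (subtopology (T s) Hs) (\<lambda>x. x s)"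
    if s: "s \<in> I" and "(\<lambda>x. x s) ` K = Hs" for s Hs
  proof -
    show "(\<lambda>x. x s) \<in> hom (P\<lparr>carrier := K\<rparr>) (subgrp (G s) Hs)"
      using that by (auto simp: hom_def)
    show "(\<lambda>x. x s) ` carrier (P\<lparr>carrier := K\<rparr>) = carrier (subgrp (G s) Hs)" using that by simp
    show "continuous_map (subtopology TP K) (subtopology (T s) Hs) (\<lambda>x. x s)"
      using continuous_map_from_subtopology[OF continuous_proj[OF s]] that
      by (auto simp: continuous_map_in_subtopology)
  qed
  have "isomorphic_parts j Hj i Hi"
  proof (rule top_isomorphic_nested_kernels[where K = "P\<lparr>carrier := K\<rparr>" and TK = "subtopology TP K"
        and p = "\<lambda>x. x j" and q = "\<lambda>x. x i"])
    show "group (P\<lparr>carrier := K\<rparr>)" using P.subgroup_imp_group K by blast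
    show "compact_space (subtopology TP K)"
      using K(2) compact_TP closedin_compact_space compact_space_subtopology by blast
    show "topspace (subtopology TP K) = carrier (P\<lparr>carrier := K\<rparr>)"
      using Kc topspace_TP by auto
    show "infinite (carrier (subgrp (G i) Hi))" using Hip by simp
  qed (use hom[OF i Hi(2)] hom[OF j Hj(2)] Hip Hjp a in auto)
  then show False using n by blast
qed

lemma open_box:
  assumes U: "U \<in> open_subgroups P TP"
  shows "\<exists>V. (\<forall>i\<in>I. V i \<in> open_subs i) \<and> PiE I V \<subseteq> U"
proof -
  have "openin TP U" "\<one>\<^bsub>P\<^esub> \<in> U" using U by (auto simp: open_subgroups_def dest: subgroup.one_closed)
  then obtain W where W: "\<forall>i\<in>I. openin (T i) (W i)" "\<one>\<^bsub>P\<^esub> \<in> PiE I W" "PiE I W \<subseteq> U"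
    unfolding openin_product_topology_alt by blast
  have "\<forall>i\<in>I. \<exists>V. V \<in> open_subs i \<and> V \<subseteq> W i"
  proof
    fix i assume i: "i \<in> I"
    interpret Gi: hji_group "G i" "T i" using hji[OF i] .
    have "\<one>\<^bsub>P\<^esub> i \<in> W i" using W(2) i by blast
    then have "\<one>\<^bsub>G i\<^esub> \<in> W i" using i by simp
    then obtain V where "subgroup V (G i)" "openin (T i) V" "V \<subseteq> W i"
      using Gi.open_subgroup_in_nhd W(1) i by blast
    then show "\<exists>V. V \<in> open_subs i \<and> V \<subseteq> W i" by (auto simp: open_subgroups_def)
  qed
  then obtain V where V: "\<forall>i\<in>I. V i \<in> open_subs i \<and> V i \<subseteq> W i" by metis
  then have "PiE I V \<subseteq> PiE I W" by (intro PiE_mono) auto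
  then have "PiE I V \<subseteq> U" using W(3) by (rule order_trans)
  then show ?thesis using V by (intro exI[of _ V]) simp
qed

lemma closure_generate_tuple:
  assumes x: "\<And>i k. i \<in> I \<Longrightarrow> k < m \<Longrightarrow> x i k \<in> carrier (G i)"
    and K: "K = TP closure_of (generate P ((\<lambda>k::nat. \<lambda>i\<in>I. x i k) ` {..<m}))"
  shows "subgroup K P" "closedin TP K" "(\<lambda>k. \<lambda>i\<in>I. x i k) ` {..<m} \<subseteq> K"
    and "\<And>i. i \<in> I \<Longrightarrow> (\<lambda>y. y i) ` K = T i closure_of (generate (G i) (x i ` {..<m}))"
proof -
  let ?g = "(\<lambda>k. \<lambda>i\<in>I. x i k) ` {..<m}"
  have gc: "?g \<subseteq> carrier P" using x by auto
  have gs: "subgroup (generate P ?g) P" using P.generate_is_subgroup[OF gc] .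
  show sK: "subgroup K P" unfolding K using P.closure_subgroup[OF gs] .
  show cK: "closedin TP K" unfolding K by simp
  have gK: "generate P ?g \<subseteq> K"
    unfolding K using subgroup.subset[OF gs] topspace_TP by (intro closure_of_subset) simp
  have "?g \<subseteq> generate P ?g" using generate.incl[of _ ?g P] by blast
  then show "?g \<subseteq> K" using gK by blast
  fix i assume i: "i \<in> I"
  interpret pr: group_hom P "G i" "\<lambda>x. x i" using proj_hom[OF i] .
  have im: "(\<lambda>y. y i) ` ?g = x i ` {..<m}" using i by (auto simp: image_image)
  have g: "(\<lambda>y. y i) ` (generate P ?g) = generate (G i) (x i ` {..<m})"
    using pr.generate_img[OF gc] unfolding im by simp
  show "(\<lambda>y. y i) ` K = T i closure_of (generate (G i) (x i ` {..<m}))"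
  proof
    show "(\<lambda>y. y i) ` K \<subseteq> T i closure_of (generate (G i) (x i ` {..<m}))"
      using continuous_map_image_closure_subset[OF continuous_proj[OF i], of "generate P ?g"]
      unfolding g K .
    have "generate (G i) (x i ` {..<m}) \<subseteq> (\<lambda>y. y i) ` K"
      unfolding g[symmetric] using gK by blast
    then show "T i closure_of (generate (G i) (x i ` {..<m})) \<subseteq> (\<lambda>y. y i) ` K"
      using proj_closed_subset[OF cK i] by (rule closure_of_minimal)
  qed
qed

lemma common_power:
  assumes B: "finite B" "B \<subseteq> I" and W: "\<And>l. l \<in> B \<Longrightarrow> W l \<in> open_subs l"
    and y: "\<And>l. l \<in> B \<Longrightarrow> y l \<in> carrier (G l)"
  shows "\<exists>E>0. \<forall>l\<in>B. y l [^]\<^bsub>G l\<^esub> (E::nat) \<in> W l"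
proof -
  have "\<forall>l\<in>B. \<exists>e>0. y l [^]\<^bsub>G l\<^esub> (e::nat) \<in> W l"
  proof
    fix l assume l: "l \<in> B"
    interpret Gl: hji_group "G l" "T l" using hji l B by blast
    show "\<exists>e>0. y l [^]\<^bsub>G l\<^esub> (e::nat) \<in> W l"
      using Gl.pow_in_finite_index[OF Gl.open_subgroup_finite_index[OF W[OF l]] y[OF l]] .
  qed
  then obtain e :: "'i \<Rightarrow> nat" where e: "\<And>l. l \<in> B \<Longrightarrow> 0 < e l \<and> y l [^]\<^bsub>G l\<^esub> e l \<in> W l" by metis
  have "y l [^]\<^bsub>G l\<^esub> (prod e B) \<in> W l" if l: "l \<in> B" for l
  proof -
    interpret Gl: hji_group "G l" "T l" using hji l B by blast
    have "prod e B = e l * prod e (B - {l})" using l B prod.remove by metis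
    then have "y l [^]\<^bsub>G l\<^esub> (prod e B) = (y l [^]\<^bsub>G l\<^esub> e l) [^]\<^bsub>G l\<^esub> prod e (B - {l})"
      using y[OF l] by (simp add: Gl.nat_pow_pow)
    then show ?thesis using Gl.subgroup_npow_closed e[OF l] Gl.open_subgroup_finite_index(1)[OF W[OF l]] by simp
  qed
  moreover have "0 < prod e B" using e by (simp add: prod_pos)
  ultimately show ?thesis by blast
qed

text \<open>Packs the output of \<open>virtually_abelian_cases\<close> so that prime, generator and
  subgroup can be chosen for all factors simultaneously.\<close>

definition Zp_like_factor where
  "Zp_like_factor V i p z H \<longleftrightarrow> prime p \<and> virtually_Zp p (G i) (T i) \<and> z \<in> carrier (G i) \<and>
     H = T i closure_of (generate (G i) {z}) \<and> H \<in> open_subs i \<and> H \<subseteq> V i \<and>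
     (\<forall>x\<in>H. p_element p (G i) (T i) x) \<and> (\<forall>x\<in>H. \<forall>y\<in>H. x \<otimes>\<^bsub>G i\<^esub> y = y \<otimes>\<^bsub>G i\<^esub> x)"

lemma Zp_like_factors:
  assumes V: "\<And>i. i \<in> I \<Longrightarrow> V i \<in> open_subs i"
    and A: "A \<subseteq> I" "\<And>i. i \<in> A \<Longrightarrow> virtually_abelian (G i) (T i)"
  shows "\<exists>p z H. \<forall>i\<in>A. Zp_like_factor V i (p i) (z i) (H i)"
proof -
  have "\<forall>i\<in>A. \<exists>p z H. Zp_like_factor V i p z H"
  proof
    fix i assume i: "i \<in> A"
    interpret Gi: hji_group "G i" "T i" using hji i A by blast
    have Vi: "V i \<in> open_subs i" using V i A by blast
    show "\<exists>p z H. Zp_like_factor V i p z H"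
      by (rule Gi.virtually_abelian_cases[OF A(2)[OF i] Vi]) (unfold Zp_like_factor_def, blast)
  qed
  then show ?thesis by metis
qed

text \<open>Each fibre of \<open>p\<close> injects into the \<open>m\<close> positions. Fibres of
  different primes may share positions, since coprime powers separate them.\<close>

lemma distinct_indices:
  assumes "finite A" and "\<And>i. i \<in> A \<Longrightarrow> card {j \<in> A. p j = p i} \<le> m"
  shows "\<exists>idx. \<forall>i\<in>A. idx i < m \<and> (\<forall>j\<in>A. i \<noteq> j \<longrightarrow> p i = p j \<longrightarrow> idx i \<noteq> (idx j::nat))"
proof -
  have "\<exists>f. inj_on f {j \<in> A. p j = q} \<and> f ` {j \<in> A. p j = q} \<subseteq> {..<m}" for q
  proof -
    define Q where "Q = {j \<in> A. p j = q}"
    have "card Q \<le> m"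
    proof (cases "Q = {}")
      case False
      then obtain i where "i \<in> A" "p i = q" by (auto simp: Q_def)
      then show ?thesis using assms(2)[of i] by (simp add: Q_def)
    qed simp
    moreover have "finite Q" using assms(1) by (simp add: Q_def)
    ultimately have "\<exists>f. inj_on f Q \<and> f ` Q \<subseteq> {..<m}"
      using inj_on_iff_card_le[of Q "{..<m}"] by auto
    then show ?thesis by (simp only: Q_def)
  qed
  then obtain f where f: "\<And>q. inj_on (f q) {j \<in> A. p j = q}" "\<And>q. f q ` {j \<in> A. p j = q} \<subseteq> {..<m}"
    by metis
  show ?thesis
  proof (intro exI[of _ "\<lambda>i. f (p i) i"] ballI conjI impI)
    fix i assume i: "i \<in> A"
    then show "f (p i) i < m" using f(2)[of "p i"] by auto
    fix j assume "j \<in> A" "i \<noteq> j" "p i = p j"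
    then show "f (p i) i \<noteq> f (p j) j" using f(1)[of "p i"] i by (auto simp: inj_on_def)
  qed
qed

theorem lower_rank_product_le:
  assumes lr: "\<And>i. i \<in> I \<Longrightarrow> lower_rank (G i) (T i) \<le> enat m"
    and Zp: "\<And>p. prime p \<Longrightarrow> card {i \<in> I. virtually_Zp p (G i) (T i)} \<le> m"
  shows "lower_rank P TP \<le> enat m"
  unfolding min_generators_lower_rank_iff
proof
  fix U assume U: "U \<in> open_subgroups P TP"
  obtain V where V: "\<And>i. i \<in> I \<Longrightarrow> V i \<in> open_subs i" "PiE I V \<subseteq> U"
    using open_box[OF U] by blast
  define A where "A = {i \<in> I. virtually_abelian (G i) (T i)}"
  define B where "B = I - A"
  have AB: "A \<subseteq> I" "B \<subseteq> I" "finite A" "finite B" "I = A \<union> B" "A \<inter> B = {}"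
    using fin_I by (auto simp: A_def B_def)
  have nva: "\<not> virtually_abelian (G i) (T i)" if "i \<in> B" for i
    using that by (simp add: A_def B_def)
  have "\<exists>p z H. \<forall>i\<in>A. Zp_like_factor V i (p i) (z i) (H i)"
    by (rule Zp_like_factors) (use V(1) in \<open>auto simp: A_def\<close>)
  then obtain p z HA where "\<forall>i\<in>A. Zp_like_factor V i (p i) (z i) (HA i)" by blast
  then have HA: "\<And>i. i \<in> A \<Longrightarrow> prime (p i)" "\<And>i. i \<in> A \<Longrightarrow> virtually_Zp (p i) (G i) (T i)"
    "\<And>i. i \<in> A \<Longrightarrow> z i \<in> carrier (G i)" "\<And>i. i \<in> A \<Longrightarrow> HA i = T i closure_of (generate (G i) {z i})"
    "\<And>i. i \<in> A \<Longrightarrow> HA i \<in> open_subs i" "\<And>i. i \<in> A \<Longrightarrow> HA i \<subseteq> V i"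
    "\<And>i x. i \<in> A \<Longrightarrow> x \<in> HA i \<Longrightarrow> p_element (p i) (G i) (T i) x"
    "\<And>i x y. i \<in> A \<Longrightarrow> x \<in> HA i \<Longrightarrow> y \<in> HA i \<Longrightarrow> x \<otimes>\<^bsub>G i\<^esub> y = y \<otimes>\<^bsub>G i\<^esub> x"
    unfolding Zp_like_factor_def by blast+
  have "card {j \<in> A. p j = p i} \<le> m" if i: "i \<in> A" for i
  proof -
    have "{j \<in> A. p j = p i} \<subseteq> {j \<in> I. virtually_Zp (p i) (G j) (T j)}"
    proof clarify
      fix j assume "j \<in> A" "p j = p i"
      then show "j \<in> I \<and> virtually_Zp (p i) (G j) (T j)" using HA(2)[of j] AB(1) by auto
    qed
    then have "card {j \<in> A. p j = p i} \<le> card {j \<in> I. virtually_Zp (p i) (G j) (T j)}"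
      using fin_I by (intro card_mono) auto
    then show ?thesis using Zp[OF HA(1)[OF i]] by linarith
  qed
  from distinct_indices[OF AB(3) this] obtain idx :: "'i \<Rightarrow> nat" where
    "\<forall>i\<in>A. idx i < m \<and> (\<forall>j\<in>A. i \<noteq> j \<longrightarrow> p i = p j \<longrightarrow> idx i \<noteq> idx j)" by blast
  then have idx: "\<And>i. i \<in> A \<Longrightarrow> idx i < m"
    "\<And>i j. i \<in> A \<Longrightarrow> j \<in> A \<Longrightarrow> i \<noteq> j \<Longrightarrow> p i = p j \<Longrightarrow> idx i \<noteq> idx j"
    by simp_all
  have "\<exists>H S. nonisomorphic_choice m V B H S"
    by (rule choose_nonisomorphic[OF AB(4,2)]) (use nva V(1) lr AB(2) in auto)
  then obtain HB S where "nonisomorphic_choice m V B HB S" by blast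
  note HB = nonisomorphic_choiceD[OF this]
  define H where "H i = (if i \<in> A then HA i else HB i)" for i
  have HAi: "H i = HA i" if "i \<in> A" for i using that by (simp add: H_def)
  have HBi: "H i = HB i" if "i \<in> B" for i using that AB(6) by (auto simp: H_def)
  have Ho': "H i \<in> open_subs i \<and> H i \<subseteq> V i" if "i \<in> I" for i
  proof (cases "i \<in> A")
    case True
    then show ?thesis using HA(5)[OF True] HA(6)[OF True] by (simp add: HAi)
  next
    case False
    then have "i \<in> B" using that AB(5) by blast
    then show ?thesis using HB(1,2) by (simp add: HBi)
  qed
  then have Ho: "H i \<in> open_subs i" "H i \<subseteq> V i" if "i \<in> I" for i
    using that by blast+
  \<comment> \<open>A virtually abelian factor has its generator at position \<open>idx i\<close>
    and the identity elsewhere; the other factors use any enumeration of their generators.\<close>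
  have "\<forall>i\<in>I. \<exists>x::nat \<Rightarrow> 'a. x ` {..<m} \<subseteq> H i \<and> T i closure_of (generate (G i) (x ` {..<m})) = H i \<and>
     (i \<in> A \<longrightarrow> x (idx i) = z i \<and> (\<forall>k. k \<noteq> idx i \<longrightarrow> x k = \<one>\<^bsub>G i\<^esub>))"
  proof
    fix i assume i: "i \<in> I"
    interpret Gi: hji_group "G i" "T i" using hji[OF i] .
    note Hp = Gi.open_subgroup_props[OF Ho(1)[OF i]]
    show "\<exists>x::nat \<Rightarrow> 'a. x ` {..<m} \<subseteq> H i \<and> T i closure_of (generate (G i) (x ` {..<m})) = H i \<and>
     (i \<in> A \<longrightarrow> x (idx i) = z i \<and> (\<forall>k. k \<noteq> idx i \<longrightarrow> x k = \<one>\<^bsub>G i\<^esub>))"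
    proof (cases "i \<in> A")
      case True
      have zH: "z i \<in> H i"
        using Gi.closure_generate_singleton(2)[OF HA(3)[OF True]] HA(4)[OF True] HAi[OF True] by simp
      let ?x = "\<lambda>k. if k = idx i then z i else \<one>\<^bsub>G i\<^esub>"
      have s: "?x ` {..<m} \<subseteq> H i" "{z i} \<subseteq> ?x ` {..<m}" using zH Hp(5) idx(1)[OF True] by auto
      have "T i closure_of (generate (G i) (?x ` {..<m})) = H i"
        by (rule closure_generate_sandwich[OF _ Hp(1,3) s(2,1)]) (use HA(4)[OF True] HAi[OF True] in auto)
      then show ?thesis using s by (intro exI[of _ ?x]) simp
    next
      case False
      then have iB: "i \<in> B" using i AB(5) by blast
      have t: "S i \<subseteq> H i" "T i closure_of (generate (G i) (S i)) = H i"
        using HB(5)[OF iB] topologically_generates_subgroup_iff[OF Gi.is_group Hp(1,3)] HBi[OF iB] by auto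
      obtain x :: "nat \<Rightarrow> 'a" where x: "S i \<subseteq> x ` {..<m}" "x ` {..<m} \<subseteq> H i"
        using enumerate_generators[OF HB(3,4)[OF iB] t(1) Hp(5)] by blast
      then have "T i closure_of (generate (G i) (x ` {..<m})) = H i"
        using closure_generate_sandwich[OF Gi.is_group Hp(1,3) x t(2)] by blast
      then show ?thesis using x False by blast
    qed
  qed
  from bchoice[OF this] obtain x :: "'i \<Rightarrow> nat \<Rightarrow> 'a" where
    "\<forall>i\<in>I. x i ` {..<m} \<subseteq> H i \<and> T i closure_of (generate (G i) (x i ` {..<m})) = H i \<and>
     (i \<in> A \<longrightarrow> x i (idx i) = z i \<and> (\<forall>k. k \<noteq> idx i \<longrightarrow> x i k = \<one>\<^bsub>G i\<^esub>))" by blast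
  then have x: "\<And>i. i \<in> I \<Longrightarrow> x i ` {..<m} \<subseteq> H i"
    "\<And>i. i \<in> I \<Longrightarrow> T i closure_of (generate (G i) (x i ` {..<m})) = H i"
    "\<And>i. i \<in> A \<Longrightarrow> x i (idx i) = z i" "\<And>i k. i \<in> A \<Longrightarrow> k \<noteq> idx i \<Longrightarrow> x i k = \<one>\<^bsub>G i\<^esub>"
    using AB(1) by (simp_all add: subset_iff)
  have xc: "x i k \<in> carrier (G i)" if "i \<in> I" "k < m" for i k
    using x(1)[OF that(1)] hji_group.open_subgroup_props(4)[OF hji[OF that(1)] Ho(1)[OF that(1)]] that(2) by blast
  define g where "g k = (\<lambda>i\<in>I. x i k)" for k
  define K where "K = TP closure_of (generate P (g ` {..<m}))"
  note Kp = closure_generate_tuple[of m x, OF _ K_def[unfolded g_def]]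
  have K: "subgroup K P" "closedin TP K"
    by (rule Kp(1), rule xc, assumption+) (rule Kp(2), rule xc, assumption+)
  have Kc: "K \<subseteq> carrier P" using K(1) subgroup.subset by blast
  have gK: "g k \<in> K" if "k < m" for k 
  proof -
    have "(\<lambda>k. \<lambda>i\<in>I. x i k) ` {..<m} \<subseteq> K" by (rule Kp(3), rule xc, assumption+)
    then show ?thesis using that unfolding g_def by blast
  qed
  have proj: "(\<lambda>y. y i) ` K = H i" if i: "i \<in> I" for i
  proof -
    have "(\<lambda>y. y i) ` K = T i closure_of (generate (G i) (x i ` {..<m}))"
      by (rule Kp(4)[OF _ i], rule xc, assumption+)
    then show ?thesis using x(2)[OF i] by simp
  qed
  have KU: "K \<subseteq> U"
  proof
    fix y assume y: "y \<in> K"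
    have "y i \<in> V i" if "i \<in> I" for i using proj[OF that] y Ho(2)[OF that] by blast
    then have "y \<in> PiE I V" using Kc y by (auto simp: PiE_iff)
    then show "y \<in> U" using V(2) by blast
  qed
  have isoB: "\<exists>k\<in>off K (I - {i}). k i \<noteq> \<one>\<^bsub>G i\<^esub>" if i: "i \<in> B" for i
  proof -
    have iI: "i \<in> I" using i AB by blast
    interpret Gi: hji_group "G i" "T i" using hji[OF iI] .
    show ?thesis
    proof (rule isolate_nonabelian[OF K iI Ho(1)[OF iI] proj[OF iI] nva[OF i]])
      fix j assume j: "j \<in> I - {i}"
      then have jI: "j \<in> I" by blast
      show "\<exists>k\<in>K. k j = \<one>\<^bsub>G j\<^esub> \<and> k i \<noteq> \<one>\<^bsub>G i\<^esub>"
      proof (rule separate_nonisomorphic[OF K iI jI Ho(1)[OF iI] proj[OF iI] Ho(1)[OF jI] proj[OF jI]])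
        show "\<not> isomorphic_parts j (H j) i (H i)"
        proof (cases "j \<in> A")
          case True
          \<comment> \<open>An isomorphism with the abelian \<open>H j\<close> would make the open
            subgroup \<open>H i\<close> abelian.\<close>
          show ?thesis
          proof
            assume "isomorphic_parts j (H j) i (H i)"
            then obtain f where f: "f \<in> iso (subgrp (G j) (H j)) (subgrp (G i) (H i))"
              by (auto simp: top_isomorphic_def)
            have "a \<otimes>\<^bsub>G i\<^esub> b = b \<otimes>\<^bsub>G i\<^esub> a" if "a \<in> H i" "b \<in> H i" for a b
            proof -
              have "f ` H j = H i" using f by (auto simp: iso_def bij_betw_def)
              then obtain a' b' where ab: "a' \<in> H j" "b' \<in> H j" "a = f a'" "b = f b'" using \<open>a \<in> H i\<close> \<open>b \<in> H i\<close> by blast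
              have "f (a' \<otimes>\<^bsub>G j\<^esub> b') = f a' \<otimes>\<^bsub>G i\<^esub> f b'" "f (b' \<otimes>\<^bsub>G j\<^esub> a') = f b' \<otimes>\<^bsub>G i\<^esub> f a'"
                using f ab by (auto simp: iso_def hom_def)
              moreover have "a' \<otimes>\<^bsub>G j\<^esub> b' = b' \<otimes>\<^bsub>G j\<^esub> a'" using HA(8)[OF True] ab HAi[OF True] by simp
              ultimately show ?thesis using ab by simp
            qed
            then show False using nva[OF i] Ho(1)[OF iI] unfolding virtually_abelian_def by blast
          qed
        next
          case False
          then have "j \<in> B" using jI AB(5) by blast
          then show ?thesis using HB(6)[of j i] i j HBi by auto
        qed
      qed
    qed blast
  qed
  have isoA: "\<exists>k\<in>off K (I - {i}). k i \<noteq> \<one>\<^bsub>G i\<^esub>" if i: "i \<in> A" for i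
  proof -
    have iI: "i \<in> I" using i AB by blast
    interpret Gi: hji_group "G i" "T i" using hji[OF iI] .
    \<comment> \<open>The coordinates in \<open>S0\<close> are killed explicitly, by the choice of
      the tuple and a correction inside \<open>K\<close>; those in \<open>S1\<close> belong to other
      primes and are killed by powers.\<close>
    define S0 where "S0 = B \<union> {j \<in> A. j \<noteq> i \<and> p j = p i}"
    define S1 where "S1 = {j \<in> A. p j \<noteq> p i}"
    have S: "S1 \<union> S0 = I - {i}" "finite S1" "S1 \<subseteq> I" "S0 \<subseteq> I"
      using AB i by (auto simp: S0_def S1_def)
    let ?g = "g (idx i)"
    have g0: "?g \<in> K" using gK idx(1)[OF i] by blast
    have g0c: "?g \<in> carrier P" using g0 Kc by blast
    have KiB: "Ki K l \<in> open_subs l" if l: "l \<in> B" for l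
    proof -
      have lI: "l \<in> I" using l AB by blast
      obtain k where "k \<in> off K (I - {l})" "k l \<noteq> \<one>\<^bsub>G l\<^esub>" using isoB[OF l] by blast
      then show ?thesis
        using Ki_open_subgroups[OF K lI Ho(1)[OF lI] proj[OF lI], of k] by (auto simp: off_def)
    qed
    \<comment> \<open>\<open>K\<close> already contains an open subgroup of every factor in
      \<open>B\<close>. A common power moves the \<open>B\<close>-coordinates of \<open>?g\<close>
      into these subgroups, so that they can be divided out within \<open>K\<close>.\<close>
    obtain E :: nat where E: "0 < E" "\<And>l. l \<in> B \<Longrightarrow> ?g l [^]\<^bsub>G l\<^esub> E \<in> Ki K l"
      using common_power[OF AB(4,2) KiB, of ?g] proj_in[OF g0c] AB(2) by blast
    define y where "y = ?g [^]\<^bsub>P\<^esub> E"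
    have yK: "y \<in> K" unfolding y_def by (rule P.subgroup_npow_closed[OF K(1) g0])
    have yc: "y \<in> carrier P" using yK Kc by blast
    have ycomp: "y s = ?g s [^]\<^bsub>G s\<^esub> E" if "s \<in> I" for s
      unfolding y_def using group_hom.hom_nat_pow[OF proj_hom[OF that] g0c] by simp
    define w where "w = (\<lambda>j\<in>I. if j \<in> B then y j else \<one>\<^bsub>G j\<^esub>)"
    have wK: "w \<in> K"
      unfolding w_def by (rule partial_product_in[OF K(1) AB(4,2)]) (use E(2) ycomp AB(2) in auto)
    have wc: "w \<in> carrier P" using wK Kc by blast
    define k0 where "k0 = y \<otimes>\<^bsub>P\<^esub> inv\<^bsub>P\<^esub> w"
    have k0K: "k0 \<in> K" unfolding k0_def using K(1) yK wK by (meson subgroup.m_closed subgroup.m_inv_closed)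
    have k0c: "k0 s = y s \<otimes>\<^bsub>G s\<^esub> inv\<^bsub>G s\<^esub> (w s)" if "s \<in> I" for s
      unfolding k0_def comp_mult[OF that] comp_inv[OF wc that] ..
    have k0B: "k0 s = \<one>\<^bsub>G s\<^esub>" if s: "s \<in> B" for s
    proof -
      have sI: "s \<in> I" using s AB by blast
      then show ?thesis unfolding k0c[OF sI] using s proj_in[OF yc sI] by (simp add: w_def group.r_inv)
    qed
    have k0A: "k0 s = x s (idx i) [^]\<^bsub>G s\<^esub> E" if s: "s \<in> A" for s
    proof -
      have sI: "s \<in> I" and sB: "s \<notin> B" using s AB by auto
      interpret Gs: group "G s" using sI by simp
      show ?thesis unfolding k0c[OF sI] ycomp[OF sI] using sI sB proj_in[OF g0c sI] by (simp add: w_def g_def)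
    qed
    have "k0 s = \<one>\<^bsub>G s\<^esub>" if "s \<in> S0" for s
    proof (cases "s \<in> B")
      case False
      then have s: "s \<in> A" "s \<noteq> i" "p s = p i" using that by (auto simp: S0_def)
      interpret Gs: group "G s" using s AB by auto
      \<comment> \<open>Factors with the same prime use different positions, so tuple number
        \<open>idx i\<close> is trivial at \<open>s\<close>.\<close>
      have "idx i \<noteq> idx s" using idx(2)[of s i] s i by metis
      then show ?thesis using k0A[OF s(1)] x(4)[OF s(1)] by simp
    qed (simp add: k0B)
    then have k0off: "k0 \<in> off K S0" using k0K by (simp add: off_def)
    \<comment> \<open>Coordinate \<open>i\<close> survives the exponent \<open>E\<close>, since a
      generator of an infinite procyclic group has infinite order.\<close>
    have "k0 i \<noteq> \<one>\<^bsub>G i\<^esub>"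
      unfolding k0A[OF i] x(3)[OF i]
      by (rule Gi.procyclic_nontorsion[OF HA(3,4)[OF i] _ E(1)])
        (use Gi.open_subgroup_props(8)[OF HA(5)[OF i]] in simp)
    then have "\<exists>k\<in>off K (S1 \<union> S0). k i \<noteq> \<one>\<^bsub>G i\<^esub>"
    proof (intro isolate_p_element[OF K iI HA(1)[OF i] _ S(2,3) _ S(4)])
      show "p_element (p i) (G i) (T i) (k i)" if "k \<in> K" for k
        using HA(7)[OF i] proj[OF iI] that HAi[OF i] by blast
      show "\<exists>q. prime q \<and> q \<noteq> p i \<and> (\<forall>k\<in>K. p_element q (G j) (T j) (k j))" if j: "j \<in> S1" for j
      proof (intro exI[of _ "p j"] conjI ballI)
        have jA: "j \<in> A" using j by (simp add: S1_def)
        show "prime (p j)" using HA(1)[OF jA] .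
        show "p j \<noteq> p i" using j by (simp add: S1_def)
        fix k assume "k \<in> K"
        then show "p_element (p j) (G j) (T j) (k j)"
          using HA(7)[OF jA] proj[of j] jA AB(1) HAi[OF jA] by blast
      qed
    qed (use k0off in blast)
    then show ?thesis unfolding S(1) .
  qed
  have "openin TP K"
  proof (rule open_if_isolated[OF K Ho(1) proj])
    fix i assume "i \<in> I"
    then have "\<exists>k\<in>off K (I - {i}). k i \<noteq> \<one>\<^bsub>G i\<^esub>" using isoA isoB AB(5) by blast
    then show "\<exists>k\<in>K. k i \<noteq> \<one>\<^bsub>G i\<^esub> \<and> (\<forall>j\<in>I - {i}. k j = \<one>\<^bsub>G j\<^esub>)" by (auto simp: off_def)
  qed
  then have KO: "K \<in> open_subgroups P TP" using K(1) by (simp add: open_subgroups_def)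
  have "topologically_generates (P\<lparr>carrier := K\<rparr>) (subtopology TP K) (g ` {..<m})"
    unfolding topologically_generates_subgroup_iff[OF group_P K] using gK K_def by auto
  moreover have "finite (g ` {..<m})" "card (g ` {..<m}) \<le> m"
    using card_image_le[of "{..<m}" g] by auto
  ultimately have "min_generators (P\<lparr>carrier := K\<rparr>) (subtopology TP K) \<le> enat m"
    unfolding min_generators_le_enat_iff by blast
  then show "\<exists>H\<in>open_subgroups P TP. H \<subseteq> U \<and> min_generators (P\<lparr>carrier := H\<rparr>) (subtopology TP H) \<le> enat m"
    using KO KU by blast
qed

end

section \<open>The lower bound\<close>

lemma (in group) int_pow_in_subgroup_iff:
  assumes D: "subgroup D G" and z: "z \<in> carrier G"
    and q: "\<And>n::nat. z [^] n \<in> D \<longleftrightarrow> q dvd n"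
  shows "z [^] (k::int) \<in> D \<longleftrightarrow> int q dvd k"
proof (cases "0 \<le> k")
  case True
  then obtain n where "k = int n" using nonneg_int_cases by blast
  then show ?thesis using q int_pow_int by (metis int_dvd_int_iff)
next
  case False
  then obtain n where n: "k = - int n" by (metis int_cases2 nle_le of_nat_0_le_iff)
  have "z [^] k = inv (z [^] n)" unfolding n using z by (simp add: int_pow_neg int_pow_int)
  moreover have "inv (z [^] n) \<in> D \<longleftrightarrow> z [^] n \<in> D"
    using subgroup.m_inv_closed[OF D] z by (metis inv_inv nat_pow_closed)
  ultimately show ?thesis using q n by simp
qed

context hji_group begin

text \<open>Centralisers are closed, so whatever commutes with \<open>z\<close> commutes with all of
  \<open>C\<close>. This is used twice, for \<open>z\<close> itself and then for an arbitrary
  element of \<open>C\<close>.\<close>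

lemma dense_commuting:
  assumes S: "C = T closure_of (generate G {z})" and z: "z \<in> carrier G" and xy: "x \<in> C" "y \<in> C"
  shows "x \<otimes> y = y \<otimes> x"
proof -
  have Cs: "subgroup C G" "z \<in> C" using closure_generate_singleton[OF z] S by auto
  have cl: "C \<subseteq> {y \<in> carrier G. y \<otimes> a = a \<otimes> y}" if a: "a \<in> carrier G" and za: "z \<otimes> a = a \<otimes> z" for a
  proof -
    let ?Z = "{y \<in> carrier G. y \<otimes> a = a \<otimes> y}"
    have eq: "y \<otimes> a \<otimes> inv y \<otimes> inv a = \<one> \<longleftrightarrow> y \<otimes> a = a \<otimes> y" if "y \<in> carrier G" for y
    proof
      assume "y \<otimes> a \<otimes> inv y \<otimes> inv a = \<one>"
      then have "inv (inv a) = y \<otimes> a \<otimes> inv y" using a that by (intro inv_equality) auto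
      then have "a \<otimes> y = y \<otimes> a \<otimes> inv y \<otimes> y" using a by simp
      then show "y \<otimes> a = a \<otimes> y" using a that by (simp add: m_assoc)
    next
      assume "y \<otimes> a = a \<otimes> y"
      then show "y \<otimes> a \<otimes> inv y \<otimes> inv a = \<one>" using a that by (simp add: m_assoc)
    qed
    have "continuous_map T T (\<lambda>y. y \<otimes> a \<otimes> inv y \<otimes> inv a)"
      by (intro continuous_group_intros) (use a in auto)
    moreover have "closedin T {\<one>}" using Hausdorff topspace_eq by (simp add: closedin_Hausdorff_singleton)
    ultimately have "closedin T {y \<in> topspace T. y \<otimes> a \<otimes> inv y \<otimes> inv a \<in> {\<one>}}"
      by (rule closedin_continuous_map_preimage)
    moreover have "{y \<in> topspace T. y \<otimes> a \<otimes> inv y \<otimes> inv a \<in> {\<one>}} = ?Z"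
      using eq topspace_eq by auto
    ultimately have "closedin T ?Z" by simp
    moreover have "generate G {z} \<subseteq> ?Z"
    proof (rule generate_subgroup_incl)
      show "{z} \<subseteq> ?Z" using z za by simp
      show "subgroup ?Z G"
      proof (rule subgroupI)
        show "?Z \<noteq> {}" using a by (auto intro!: exI[of _ \<one>])
        fix u assume u: "u \<in> ?Z"
        have uc: "u \<in> carrier G" using u by simp
        have "u \<otimes> a \<otimes> inv u = a \<otimes> u \<otimes> inv u" using u by simp
        also have "\<dots> = a" using uc a by (simp add: m_assoc)
        finally have e: "u \<otimes> a \<otimes> inv u = a" .
        have "inv u \<otimes> (u \<otimes> a \<otimes> inv u) = a \<otimes> inv u"
          using uc a by (simp add: m_assoc[symmetric])
        then have "inv u \<otimes> a = a \<otimes> inv u" unfolding e .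
        then show "inv u \<in> ?Z" using u by simp
        fix v assume v: "v \<in> ?Z"
        have "u \<otimes> v \<otimes> a = u \<otimes> (a \<otimes> v)" using u v a by (simp add: m_assoc)
        also have "\<dots> = a \<otimes> (u \<otimes> v)" using u v a by (simp add: m_assoc[symmetric])
        finally show "u \<otimes> v \<in> ?Z" using u v by simp
      qed auto
    qed
    ultimately show ?thesis unfolding S by (intro closure_of_minimal)
  qed
  have c: "x \<in> carrier G" "y \<in> carrier G" using xy subgroup.mem_carrier[OF Cs(1)] by auto
  have "y \<otimes> z = z \<otimes> y" using cl[OF z refl] xy by blast
  then have "z \<otimes> y = y \<otimes> z" by simp
  from cl[OF c(2) this] xy show ?thesis by blast
qed

lemma virtually_Zp_generator:
  assumes p: "virtually_Zp p G T"
  obtains z C where "z \<in> carrier G" "C = T closure_of (generate G {z})" "C \<in> open_subgroups G T"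
    "p_element p G T z"
proof -
  obtain C where C: "C \<in> open_subgroups G T" "procyclic (subgrp G C) (subtopology T C)"
    "pro_p_group p (subgrp G C) (subtopology T C)"
    using p by (auto simp: virtually_Zp_def)
  note Cp = open_subgroup_props[OF C(1)]
  obtain z where z: "z \<in> C" "topologically_generates (subgrp G C) (subtopology T C) {z}"
    using C(2) by (auto simp: procyclic_def)
  have zc: "z \<in> carrier G" using z Cp by blast
  have Ceq: "C = T closure_of (generate G {z})"
    using z(2) topologically_generates_subgroup_iff[OF is_group Cp(1,3)] by auto
  have "comm_group (subgrp G C)"
    by (rule group.group_comm_groupI[OF subgroup_imp_group[OF Cp(1)]]) (simp add: dense_commuting[OF Ceq zc])
  then interpret C: comm_group "subgrp G C" .
  have "p_element p G T z"
    unfolding p_element_def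
  proof
    fix W assume W: "W \<in> open_subgroups G T"
    have WC: "W \<inter> C \<in> open_subgroups G T" using inter_open_subgroups[OF W C(1)] .
    have "subgroup (W \<inter> C) (subgrp G C)" using subgroup_incl[of "W \<inter> C" C] WC Cp(1) by (auto simp: open_subgroups_def)
    then have "(W \<inter> C) \<lhd> subgrp G C" by (rule C.subgroup_imp_normal)
    moreover have "openin (subtopology T C) (W \<inter> C)"
      using WC Cp(2) by (simp add: open_subgroups_def openin_open_subtopology)
    ultimately obtain k where k: "card (rcosets\<^bsub>subgrp G C\<^esub> (W \<inter> C)) = p ^ k"
      using C(3) by (auto simp: pro_p_group_def)
    then have "rel_ord (W \<inter> C) z = p ^ k" using card_rcosets_procyclic[OF zc Ceq WC] by simp
    then have "z [^] (p ^ k) \<in> W \<inter> C"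
      using rel_ord_dvd_iff[OF open_subgroup_finite_index[OF WC] zc] by simp
    then show "\<exists>k. z [^] p ^ k \<in> W" by blast
  qed
  then show ?thesis using that zc Ceq C(1) by blast
qed

text \<open>A homomorphism from \<open>C\<close> to the integers modulo \<open>q\<close> that sends
  \<open>z\<close> to 1, written with integer representatives and congruences. Vanishing on the
  elements of \<open>C\<close> in the open subgroup \<open>D\<close> expresses continuity.\<close>

definition discrete_log :: "nat \<Rightarrow> 'a \<Rightarrow> 'a set \<Rightarrow> 'a set \<Rightarrow> ('a \<Rightarrow> int) \<Rightarrow> bool" where
  "discrete_log q z C D l \<longleftrightarrow> D \<in> open_subgroups G T \<and>
    (\<forall>x\<in>C. \<forall>y\<in>C. int q dvd l (x \<otimes> y) - (l x + l y)) \<and>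
    (\<forall>e::nat. int q dvd l (z [^] e) - int e) \<and> (\<forall>x\<in>C. x \<in> D \<longrightarrow> int q dvd l x)"

text \<open>The exponent of \<open>z\<close> modulo \<open>p ^ N\<close> extends to \<open>C \<cong> \<int>\<^sub>p\<close>; here \<open>D\<close> is \<open>p\<^sup>N C\<close>.\<close>

lemma discrete_log_exists:
  assumes p: "prime p" and z: "z \<in> carrier G" and C: "C = T closure_of (generate G {z})"
    and CO: "C \<in> open_subgroups G T" and pz: "p_element p G T z"
  shows "\<exists>D l. discrete_log (p ^ N) z C D l"
proof -
  note Cp = open_subgroup_props[OF CO]
  have zC: "z \<in> C" using closure_generate_singleton(2)[OF z] C by simp
  have comm: "\<And>x y. x \<in> C \<Longrightarrow> y \<in> C \<Longrightarrow> x \<otimes> y = y \<otimes> x" using dense_commuting[OF C z] .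
  have nt: "z [^] (p ^ N) \<noteq> \<one>"
    by (rule procyclic_nontorsion[OF z C Cp(8)]) (use p prime_gt_0_nat in simp)
  obtain V where V: "V \<in> open_subgroups G T" "z [^] (p ^ N) \<notin> V"
    using trivial_if_in_all_open_subgroups[of "z [^] (p ^ N)"] z nt by (auto simp: open_subgroups_def)
  define W where "W = V \<inter> C"
  have W: "W \<in> open_subgroups G T" using inter_open_subgroups[OF V(1) CO] by (simp add: W_def)
  note ro = rel_ord_dvd_iff[OF open_subgroup_finite_index[OF W] z]
  obtain k where "z [^] (p ^ k) \<in> W" using pz W by (auto simp: p_element_def)
  then have "rel_ord W z dvd p ^ k" using ro by blast
  then obtain a where a: "rel_ord W z = p ^ a" using p divides_primepow_nat by blast
  have "\<not> p ^ a dvd p ^ N" using ro(2)[of "p ^ N"] V(2) a by (simp add: W_def)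
  then have aN: "N \<le> a" using le_imp_power_dvd nat_le_linear by blast
  \<comment> \<open>The order \<open>p ^ a\<close> of \<open>z\<close> modulo \<open>W\<close> may
    be too large. Allowing the exponent \<open>p ^ (a - N)\<close> enlarges \<open>W\<close> to a
    subgroup modulo which \<open>z\<close> has order exactly \<open>p ^ N\<close>.\<close>
  define D where "D = {x \<in> C. x [^] (p ^ (a - N)) \<in> W}"
  have Ws: "subgroup W G" using W by (simp add: open_subgroups_def)
  have Ds: "subgroup D G"
  proof (rule subgroupI)
    show "D \<subseteq> carrier G" using Cp by (auto simp: D_def)
    show "D \<noteq> {}" using Cp(5) subgroup.one_closed[OF Ws] by (auto simp: D_def)
    fix x assume x: "x \<in> D"
    then have xc: "x \<in> carrier G" using Cp by (auto simp: D_def)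
    show "inv x \<in> D" using x xc subgroup.m_inv_closed[OF Cp(1)] subgroup.m_inv_closed[OF Ws]
      by (simp add: D_def nat_pow_inv)
    fix y assume y: "y \<in> D"
    then have yc: "y \<in> carrier G" using Cp by (auto simp: D_def)
    have "x \<otimes> y = y \<otimes> x" using x y comm by (simp add: D_def)
    then show "x \<otimes> y \<in> D"
      using x y commuting_int_pow[OF xc yc] subgroup.m_closed[OF Cp(1)] subgroup.m_closed[OF Ws] by (simp add: D_def)
  qed
  have "W \<subseteq> D" using subgroup_npow_closed[OF Ws] by (auto simp: D_def W_def)
  then have DO: "D \<in> open_subgroups G T"
    using open_subgroupsI[OF Ds, of W] W by (auto simp: open_subgroups_def dest: subgroup.one_closed)
  have zD: "z [^] (n::nat) \<in> D \<longleftrightarrow> p ^ N dvd n" for n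
  proof -
    have "z [^] n \<in> C" using subgroup_npow_closed[OF Cp(1) zC] .
    then have "z [^] n \<in> D \<longleftrightarrow> z [^] (n * p ^ (a - N)) \<in> W" using z by (simp add: D_def nat_pow_pow)
    also have "\<dots> \<longleftrightarrow> p ^ N * p ^ (a - N) dvd n * p ^ (a - N)"
      using ro(2) a aN by (simp add: power_add[symmetric])
    also have "\<dots> \<longleftrightarrow> p ^ N dvd n" using p prime_gt_0_nat by simp
    finally show ?thesis .
  qed
  have zDi: "z [^] (k::int) \<in> D \<longleftrightarrow> int (p ^ N) dvd k" for k
    using int_pow_in_subgroup_iff[OF Ds z zD] .
  have ex: "\<exists>k::int. z [^] k \<otimes> inv x \<in> D" if x: "x \<in> C" for x
  proof -
    have xc: "x \<in> carrier G" using x Cp by blast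
    obtain g w where gw: "g \<in> generate G {z}" "w \<in> D" "g = w \<otimes> x"
      using coset_meets_dense[OF x[unfolded C] open_subgroup_props(2,5)[OF DO] xc] .
    obtain k :: int where "g = z [^] k" using gw(1) generate_pow[OF z] by blast
    moreover have "g \<otimes> inv x = w" using gw xc subgroup.mem_carrier[OF Ds] by (simp add: m_assoc)
    ultimately show ?thesis using gw(2) by metis
  qed
  \<comment> \<open>The choice is arbitrary, but the fact \<open>cong\<close> shows that it is
    determined modulo \<open>p ^ N\<close>.\<close>
  define l where "l x = (SOME k::int. z [^] k \<otimes> inv x \<in> D)" for x
  have l: "z [^] l x \<otimes> inv x \<in> D" if "x \<in> C" for x
    unfolding l_def using someI_ex[OF ex[OF that]] .
  have zkC: "z [^] (k::int) \<in> C" for k using subgroup_int_pow_closed[OF Cp(1) zC] .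
  have cong: "int (p ^ N) dvd l x - k" if x: "x \<in> C" and k: "z [^] k \<otimes> inv x \<in> D" for x and k :: int
  proof -
    have xc: "x \<in> carrier G" using x Cp by blast
    have zc: "z [^] (j::int) \<in> carrier G" for j using z by simp
    have "(z [^] l x \<otimes> inv x) \<otimes> inv (z [^] k \<otimes> inv x) \<in> D"
      using l[OF x] k subgroup.m_closed[OF Ds] subgroup.m_inv_closed[OF Ds] by blast
    also have "(z [^] l x \<otimes> inv x) \<otimes> inv (z [^] k \<otimes> inv x) = z [^] l x \<otimes> inv (z [^] k)"
      using xc zc by (simp add: inv_mult_group m_assoc) (simp add: m_assoc[symmetric])
    also have "\<dots> = z [^] (l x - k)" using z by (simp add: int_pow_diff)
    finally show ?thesis using zDi by blast
  qed
  show ?thesis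
    unfolding discrete_log_def
  proof (rule exI[of _ D], rule exI[of _ l], intro conjI DO allI ballI impI)
    fix x y assume xy: "x \<in> C" "y \<in> C"
    have c: "x \<in> carrier G" "y \<in> carrier G" using xy Cp by auto
    have zc: "z [^] (j::int) \<in> carrier G" for j using z by simp
    have "(z [^] l x \<otimes> inv x) \<otimes> (z [^] l y \<otimes> inv y) \<in> D"
      using l[OF xy(1)] l[OF xy(2)] subgroup.m_closed[OF Ds] by blast
    moreover have "(z [^] l x \<otimes> inv x) \<otimes> (z [^] l y \<otimes> inv y) = z [^] (l x + l y) \<otimes> inv (x \<otimes> y)"
    proof -
      have e: "inv x \<otimes> z [^] l y = z [^] l y \<otimes> inv x" "inv x \<otimes> inv y = inv (x \<otimes> y)"
        using comm[OF _ zkC] comm[of x y] xy c subgroup.m_inv_closed[OF Cp(1)] by (auto simp: inv_mult_group)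
      have "(z [^] l x \<otimes> inv x) \<otimes> (z [^] l y \<otimes> inv y) = z [^] l x \<otimes> (inv x \<otimes> z [^] l y) \<otimes> inv y"
        using c zc by (simp add: m_assoc)
      also have "\<dots> = (z [^] l x \<otimes> z [^] l y) \<otimes> (inv x \<otimes> inv y)"
        unfolding e(1) using c zc by (simp add: m_assoc)
      also have "\<dots> = z [^] (l x + l y) \<otimes> inv (x \<otimes> y)" unfolding e(2) using z by (simp add: int_pow_mult)
      finally show ?thesis .
    qed
    ultimately have "z [^] (l x + l y) \<otimes> inv (x \<otimes> y) \<in> D" by simp
    then show "int (p ^ N) dvd l (x \<otimes> y) - (l x + l y)"
      using cong subgroup.m_closed[OF Cp(1) xy] by blast
  next
    fix e :: nat
    have "z [^] int e \<otimes> inv (z [^] e) \<in> D" using z subgroup.one_closed[OF Ds] by (simp add: int_pow_int)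
    then show "int (p ^ N) dvd l (z [^] e) - int e"
      using cong[OF subgroup_npow_closed[OF Cp(1) zC]] by blast
  next
    fix x assume x: "x \<in> C" "x \<in> D"
    have "z [^] (0::int) \<otimes> inv x \<in> D" using x subgroup.m_inv_closed[OF Ds] subgroup.mem_carrier[OF Ds] by simp
    then show "int (p ^ N) dvd l x" using cong[OF x(1)] by fastforce
  qed
qed

end

section \<open>Projection of generators and counting in the product\<close>

context hji_family begin

lemma image_generates:
  assumes i: "i \<in> I" and H: "H \<in> open_subgroups P TP"
    and S: "topologically_generates (P\<lparr>carrier := H\<rparr>) (subtopology TP H) S"
  shows "(\<lambda>x. x i) ` H \<in> open_subs i"
    "topologically_generates (subgrp (G i) ((\<lambda>x. x i) ` H)) (subtopology (T i) ((\<lambda>x. x i) ` H)) ((\<lambda>x. x i) ` S)"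
proof -
  interpret Gi: hji_group "G i" "T i" using hji[OF i] .
  interpret pr: group_hom P "G i" "\<lambda>x. x i" using proj_hom[OF i] .
  have Hs: "subgroup H P" "openin TP H" using H by (auto simp: open_subgroups_def)
  have Hc: "closedin TP H" using P.open_subgroup_closedin[OF Hs] .
  let ?H = "(\<lambda>x. x i) ` H"
  have o: "openin (T i) ?H" using open_map_product_projection[OF i, of T] Hs(2) by (auto simp: open_map_def)
  have s: "subgroup ?H (G i)" using pr.subgroup_img_is_subgroup[OF Hs(1)] .
  show HO: "?H \<in> open_subs i" using o s by (simp add: open_subgroups_def)
  have S': "S \<subseteq> H" "TP closure_of (generate P S) = H"
    using S topologically_generates_subgroup_iff[OF group_P Hs(1) Hc] by auto
  have Sc: "S \<subseteq> carrier P" using S'(1) subgroup.subset[OF Hs(1)] by blast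
  have g: "generate (G i) ((\<lambda>x. x i) ` S) = (\<lambda>x. x i) ` generate P S" using pr.generate_img[OF Sc] .
  have "T i closure_of (generate (G i) ((\<lambda>x. x i) ` S)) = ?H"
  proof
    have "generate P S \<subseteq> H" using P.generate_subgroup_incl[OF S'(1) Hs(1)] .
    then have "(\<lambda>x. x i) ` generate P S \<subseteq> ?H" by blast
    then show "T i closure_of (generate (G i) ((\<lambda>x. x i) ` S)) \<subseteq> ?H"
      unfolding g using Gi.open_subgroup_props(3)[OF HO] by (rule closure_of_minimal)
    have "(\<lambda>x. x i) ` (TP closure_of (generate P S)) \<subseteq> T i closure_of ((\<lambda>x. x i) ` generate P S)"
      by (rule continuous_map_image_closure_subset[OF continuous_proj[OF i]])
    then show "?H \<subseteq> T i closure_of (generate (G i) ((\<lambda>x. x i) ` S))" unfolding g S'(2) .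
  qed
  then show "topologically_generates (subgrp (G i) ?H) (subtopology (T i) ?H) ((\<lambda>x. x i) ` S)"
    using topologically_generates_subgroup_iff[OF Gi.is_group s Gi.open_subgroup_props(3)[OF HO]] S'(1) by blast
qed

lemma preimage_open_subgroup:
  assumes J: "J \<subseteq> I" and C: "\<And>i. i \<in> J \<Longrightarrow> C i \<in> open_subs i"
  shows "{x \<in> carrier P. \<forall>i\<in>J. x i \<in> C i} \<in> open_subgroups P TP"
proof -
  define C' where "C' i = (if i \<in> J then C i else carrier (G i))" for i
  have C': "subgroup (C' i) (G i) \<and> openin (T i) (C' i)" if i: "i \<in> I" for i
  proof -
    interpret Gi: hji_group "G i" "T i" using hji[OF i] .
    show ?thesis using C Gi.carrier_open_subgroup by (auto simp: C'_def open_subgroups_def)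
  qed
  have Csub: "C i \<subseteq> carrier (G i)" if "i \<in> J" for i
    using C[OF that] by (auto simp: open_subgroups_def dest: subgroup.mem_carrier)
  have "{x \<in> carrier P. \<forall>i\<in>J. x i \<in> C i} = PiE I C'"
  proof (intro Set.set_eqI iffI)
    fix x assume "x \<in> {x \<in> carrier P. \<forall>i\<in>J. x i \<in> C i}"
    then show "x \<in> PiE I C'" by (auto simp: PiE_iff C'_def)
  next
    fix x assume x: "x \<in> PiE I C'"
    have "x i \<in> C i" if "i \<in> J" for i
    proof -
      have "x i \<in> C' i" using x J that by blast
      then show ?thesis using that by (simp add: C'_def)
    qed
    moreover have "x i \<in> carrier (G i)" if "i \<in> I" for i
      using x that C' subgroup.mem_carrier[of "C' i" "G i"] by (auto simp: PiE_iff)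
    ultimately show "x \<in> {x \<in> carrier P. \<forall>i\<in>J. x i \<in> C i}" using x by (auto simp: PiE_iff)
  qed
  moreover have "subgroup (PiE I C') P" using PiE_subgroup_product_group[of I G C'] C' by simp
  moreover have "openin TP (PiE I C')" using C' product_open by simp
  ultimately show ?thesis by (simp add: open_subgroups_def)
qed

theorem lower_rank_factor_le:
  assumes i: "i \<in> I" and lr: "lower_rank P TP \<le> enat m"
  shows "lower_rank (G i) (T i) \<le> enat m"
  unfolding min_generators_lower_rank_iff
proof
  fix U assume U: "U \<in> open_subs i"
  have "{x \<in> carrier P. \<forall>j\<in>{i}. x j \<in> U} \<in> open_subgroups P TP"
    using preimage_open_subgroup[of "{i}" "\<lambda>_. U"] i U by auto
  then obtain H where H: "H \<in> open_subgroups P TP" "H \<subseteq> {x \<in> carrier P. \<forall>j\<in>{i}. x j \<in> U}"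
    "min_generators (P\<lparr>carrier := H\<rparr>) (subtopology TP H) \<le> enat m"
    using lr unfolding min_generators_lower_rank_iff by blast
  then obtain S where S: "finite S" "card S \<le> m"
    "topologically_generates (P\<lparr>carrier := H\<rparr>) (subtopology TP H) S"
    unfolding min_generators_le_enat_iff by blast
  let ?H = "(\<lambda>x. x i) ` H"
  note im = image_generates[OF i H(1) S(3)]
  have "card ((\<lambda>x. x i) ` S) \<le> m" using card_image_le[OF S(1), of "\<lambda>x. x i"] S(2) by linarith
  then have "min_generators (subgrp (G i) ?H) (subtopology (T i) ?H) \<le> enat m"
    unfolding min_generators_le_enat_iff using im(2) S(1) by blast
  moreover have "?H \<subseteq> U" using H(2) by blast
  ultimately show "\<exists>H\<in>open_subs i. H \<subseteq> U \<and>
      min_generators (subgrp (G i) H) (subtopology (T i) H) \<le> enat m" using im(1) by blast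
qed


theorem card_virtually_Zp_le:
  assumes p: "prime p" and lr: "lower_rank P TP \<le> enat m"
  shows "card {i \<in> I. virtually_Zp p (G i) (T i)} \<le> m"
proof -
  define J where "J = {i \<in> I. virtually_Zp p (G i) (T i)}"
  have J: "J \<subseteq> I" "finite J" using fin_I by (auto simp: J_def)
  have "\<forall>i\<in>J. \<exists>z. z \<in> carrier (G i) \<and> T i closure_of (generate (G i) {z}) \<in> open_subs i \<and>
    p_element p (G i) (T i) z"
  proof
    fix i assume i: "i \<in> J"
    interpret Gi: hji_group "G i" "T i" using hji i J by blast
    have "virtually_Zp p (G i) (T i)" using i by (simp add: J_def)
    then show "\<exists>z. z \<in> carrier (G i) \<and> T i closure_of (generate (G i) {z}) \<in> open_subs i \<and>
      p_element p (G i) (T i) z"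
      by (rule Gi.virtually_Zp_generator) blast
  qed
  from bchoice[OF this] obtain z where z: "\<forall>i\<in>J. z i \<in> carrier (G i) \<and>
    T i closure_of (generate (G i) {z i}) \<in> open_subs i \<and> p_element p (G i) (T i) (z i)" by blast
  define C where "C i = T i closure_of (generate (G i) {z i})" for i
  have C: "\<And>i. i \<in> J \<Longrightarrow> z i \<in> carrier (G i)" "\<And>i. i \<in> J \<Longrightarrow> C i = T i closure_of (generate (G i) {z i})"
    "\<And>i. i \<in> J \<Longrightarrow> C i \<in> open_subs i" "\<And>i. i \<in> J \<Longrightarrow> p_element p (G i) (T i) (z i)"
    using z by (simp_all add: C_def)
  have Cs: "subgroup (C i) (G i)" if "i \<in> J" for i using C(3)[OF that] by (simp add: open_subgroups_def)
  have zpow: "z i [^]\<^bsub>G i\<^esub> (e::nat) \<in> C i" if i: "i \<in> J" for i e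
  proof -
    interpret Gi: hji_group "G i" "T i" using hji i J by blast
    show ?thesis
      using Gi.subgroup_npow_closed[OF Cs[OF i]] Gi.closure_generate_singleton(2)[OF C(1)[OF i]] C(2)[OF i] by simp
  qed
  define U where "U = {x \<in> carrier P. \<forall>i\<in>J. x i \<in> C i}"
  have "U \<in> open_subgroups P TP"
    unfolding U_def by (rule preimage_open_subgroup[OF J(1) C(3)])
  then obtain H where H: "H \<in> open_subgroups P TP" "H \<subseteq> U"
    "min_generators (P\<lparr>carrier := H\<rparr>) (subtopology TP H) \<le> enat m"
    using lr unfolding min_generators_lower_rank_iff by blast
  then obtain S where S: "finite S" "card S \<le> m"
    "topologically_generates (P\<lparr>carrier := H\<rparr>) (subtopology TP H) S"
    unfolding min_generators_le_enat_iff by blast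
  have Hs: "subgroup H P" "openin TP H" using H(1) by (auto simp: open_subgroups_def)
  have S': "S \<subseteq> H" "TP closure_of (generate P S) = H"
    using S(3) topologically_generates_subgroup_iff[OF group_P Hs(1) P.open_subgroup_closedin[OF Hs]] by auto
  have Hc: "H \<subseteq> carrier P" using subgroup.subset[OF Hs(1)] .
  have HC: "h i \<in> C i" if "h \<in> H" "i \<in> J" for h i using H(2) that by (auto simp: U_def)
  have fin: "finite (rcosets\<^bsub>P\<^esub> H)" using P.finite_rcosets_open[OF compact_TP Hs] .
  define c where "c = card (rcosets\<^bsub>P\<^esub> H)"
  \<comment> \<open>The constant \<open>c\<close> is fixed before \<open>N\<close>. A tuple of
    exponents below \<open>p ^ N\<close> will be recovered from a coset of \<open>H\<close>, with
    \<open>c\<close> choices, and the logarithms of an element of \<open>H\<close>, with at most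
    \<open>(p ^ N) ^ m\<close> choices.\<close>
  have count: "(p ^ N) ^ card J \<le> c * (p ^ N) ^ m" for N
  proof -
    define q where "q = p ^ N"
    have q0: "0 < q" using p prime_gt_0_nat by (simp add: q_def)
    have "\<forall>i\<in>J. \<exists>D l. hji_group.discrete_log (G i) (T i) q (z i) (C i) D l"
    proof
      fix i assume i: "i \<in> J"
      interpret Gi: hji_group "G i" "T i" using hji i J by blast
      show "\<exists>D l. Gi.discrete_log q (z i) (C i) D l"
        unfolding q_def by (rule Gi.discrete_log_exists[OF p C(1)[OF i] C(2)[OF i] C(3)[OF i] C(4)[OF i]])
    qed
    then obtain D l where Dl: "\<And>i. i \<in> J \<Longrightarrow> hji_group.discrete_log (G i) (T i) q (z i) (C i) (D i) (l i)"
      by metis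
    have l: "\<And>i x y. i \<in> J \<Longrightarrow> x \<in> C i \<Longrightarrow> y \<in> C i \<Longrightarrow> int q dvd l i (x \<otimes>\<^bsub>G i\<^esub> y) - (l i x + l i y)"
      "\<And>i e. i \<in> J \<Longrightarrow> int q dvd l i (z i [^]\<^bsub>G i\<^esub> (e::nat)) - int e"
      and D: "\<And>i. i \<in> J \<Longrightarrow> D i \<in> open_subs i"
      "\<And>i x. i \<in> J \<Longrightarrow> x \<in> C i \<Longrightarrow> x \<in> D i \<Longrightarrow> int q dvd l i x"
      using Dl by (simp_all add: hji_group.discrete_log_def[OF hji[OF subsetD[OF J(1)]]])
    have l1: "int q dvd l i \<one>\<^bsub>G i\<^esub>" if "i \<in> J" for i
      using l(2)[OF that, of 0] by simp
    define lin where "lin a i = (\<Sum>s\<in>S. a s * l i (s i))" for a :: "('i \<Rightarrow> 'a) \<Rightarrow> int" and i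
    \<comment> \<open>The coefficients \<open>a\<close> are common to all coordinates.
      \<open>E\<close> is a subgroup that contains \<open>S\<close> and a neighbourhood of the
      identity, so it is all of \<open>H\<close>: the coefficients modulo \<open>q\<close>, one for
      each generator, determine all logarithms on \<open>H\<close>.\<close>
    define E where "E = {h \<in> H. \<exists>a. \<forall>i\<in>J. int q dvd l i (h i) - lin a i}"
    have Es: "subgroup E P"
    proof (rule P.subgroupI)
      show "E \<subseteq> carrier P" using Hc by (auto simp: E_def)
      have "\<one>\<^bsub>P\<^esub> \<in> E"
        unfolding E_def using subgroup.one_closed[OF Hs(1)] l1 J(1)
        by (auto intro!: exI[of _ "\<lambda>_. 0"] simp: lin_def subset_iff)
      then show "E \<noteq> {}" by blast
      fix x assume x: "x \<in> E"
      then obtain a where a: "x \<in> H" "\<And>i. i \<in> J \<Longrightarrow> int q dvd l i (x i) - lin a i" by (auto simp: E_def)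
      have xc: "x \<in> carrier P" using a Hc by blast
      have "int q dvd l i ((inv\<^bsub>P\<^esub> x) i) - lin (\<lambda>s. - a s) i" if i: "i \<in> J" for i
      proof -
        have iI: "i \<in> I" using i J by blast
        interpret Gi: group "G i" using iI by simp
        have xi: "x i \<in> C i" "inv\<^bsub>G i\<^esub> (x i) \<in> C i" using HC[OF a(1) i] subgroup.m_inv_closed[OF Cs[OF i]] by auto
        have "int q dvd l i (x i \<otimes>\<^bsub>G i\<^esub> inv\<^bsub>G i\<^esub> (x i)) - (l i (x i) + l i (inv\<^bsub>G i\<^esub> (x i)))" using l(1)[OF i xi] .
        then have "int q dvd l i \<one>\<^bsub>G i\<^esub> - (l i (x i) + l i (inv\<^bsub>G i\<^esub> (x i)))"
          using proj_in[OF xc iI] by simp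
        with l1[OF i] a(2)[OF i] have "int q dvd l i \<one>\<^bsub>G i\<^esub> - (l i \<one>\<^bsub>G i\<^esub> - (l i (x i) + l i (inv\<^bsub>G i\<^esub> (x i)))) - (l i (x i) - lin a i)"
          by (metis dvd_diff)
        then show ?thesis unfolding comp_inv[OF xc iI] by (simp add: lin_def sum_negf)
      qed
      then show "inv\<^bsub>P\<^esub> x \<in> E" using subgroup.m_inv_closed[OF Hs(1) a(1)] unfolding E_def by blast
      fix y assume y: "y \<in> E"
      then obtain b where b: "y \<in> H" "\<And>i. i \<in> J \<Longrightarrow> int q dvd l i (y i) - lin b i" by (auto simp: E_def)
      have "int q dvd l i ((x \<otimes>\<^bsub>P\<^esub> y) i) - lin (\<lambda>s. a s + b s) i" if i: "i \<in> J" for i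
      proof -
        have iI: "i \<in> I" using i J by blast
        have "int q dvd (l i (x i \<otimes>\<^bsub>G i\<^esub> y i) - (l i (x i) + l i (y i))) + (l i (x i) - lin a i) + (l i (y i) - lin b i)"
          by (intro dvd_add l(1)[OF i HC[OF a(1) i] HC[OF b(1) i]] a(2)[OF i] b(2)[OF i])
        moreover have "lin (\<lambda>s. a s + b s) i = lin a i + lin b i"
          by (simp add: lin_def algebra_simps sum.distrib)
        ultimately show ?thesis unfolding comp_mult[OF iI] by (simp add: algebra_simps)
      qed
      then show "x \<otimes>\<^bsub>P\<^esub> y \<in> E" using subgroup.m_closed[OF Hs(1) a(1) b(1)] unfolding E_def by blast
    qed
    have EH: "E = H"
    proof -
      have D': "{x \<in> carrier P. \<forall>i\<in>J. x i \<in> D i} \<in> open_subgroups P TP"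
        by (rule preimage_open_subgroup[OF J(1) D(1)])
      let ?V = "H \<inter> {x \<in> carrier P. \<forall>i\<in>J. x i \<in> D i}"
      have "openin TP ?V" using D' Hs(2) by (auto simp: open_subgroups_def)
      moreover have "\<one>\<^bsub>P\<^esub> \<in> ?V"
        using subgroup.one_closed[OF Hs(1)] subgroup.one_closed[of _ P] D' unfolding open_subgroups_def by blast
      moreover have "?V \<subseteq> E"
      proof
        fix x assume x: "x \<in> ?V"
        then have "int q dvd l i (x i) - lin (\<lambda>_. 0) i" if "i \<in> J" for i
          using D(2)[OF that HC[OF _ that]] that by (simp add: lin_def)
        then show "x \<in> E" using x unfolding E_def by blast
      qed
      ultimately have "openin TP E" using P.subgroup_openinI[OF Es] by blast
      then have Ec: "closedin TP E" using P.open_subgroup_closedin[OF Es] by blast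
      have "S \<subseteq> E"
      proof
        fix s assume s: "s \<in> S"
        have "lin (\<lambda>t. if t = s then 1 else 0) i = l i (s i)" for i
          using s S(1) by (simp add: lin_def if_distrib[of "\<lambda>x. x * _"] cong: if_cong)
        then have "\<forall>i\<in>J. int q dvd l i (s i) - lin (\<lambda>t. if t = s then 1 else 0) i" by simp
        then show "s \<in> E" using s S'(1) unfolding E_def by blast
      qed
      then have "generate P S \<subseteq> E" using P.generate_subgroup_incl[OF _ Es] by blast
      then have "H \<subseteq> E" unfolding S'(2)[symmetric] using Ec by (rule closure_of_minimal)
      then show ?thesis by (auto simp: E_def)
    qed
    define \<Lambda> where "\<Lambda> x = (\<lambda>i\<in>J. l i (x i) mod int q)" for x :: "'i \<Rightarrow> 'a"
    have \<Lambda>H: "finite (\<Lambda> ` H)" "card (\<Lambda> ` H) \<le> q ^ m"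
    proof -
      let ?A = "PiE S (\<lambda>_. {0..<int q})"
      have finA: "finite ?A" using S(1) by (intro finite_PiE) auto
      have sub: "\<Lambda> ` H \<subseteq> (\<lambda>a. \<lambda>i\<in>J. lin a i mod int q) ` ?A"
      proof
        fix y assume "y \<in> \<Lambda> ` H"
        then obtain h where h: "h \<in> H" "y = \<Lambda> h" by blast
        have "h \<in> E" using h(1) EH by blast
        then obtain a where a: "\<And>i. i \<in> J \<Longrightarrow> int q dvd l i (h i) - lin a i" by (auto simp: E_def)
        let ?a = "\<lambda>s\<in>S. a s mod int q"
        have "l i (h i) mod int q = lin ?a i mod int q" if i: "i \<in> J" for i
        proof -
          have "lin a i - lin ?a i = (\<Sum>s\<in>S. (a s - a s mod int q) * l i (s i))"
            by (simp add: lin_def sum_subtractf[symmetric] algebra_simps)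
          moreover have "int q dvd (\<Sum>s\<in>S. (a s - a s mod int q) * l i (s i))"
            by (intro dvd_sum dvd_mult2) (simp add: minus_mod_eq_mult_div)
          ultimately have "int q dvd (l i (h i) - lin a i) + (lin a i - lin ?a i)"
            using a[OF i] by (intro dvd_add) simp_all
          then show ?thesis by (simp add: mod_eq_dvd_iff)
        qed
        then have "y = (\<lambda>i\<in>J. lin ?a i mod int q)" using h(2) by (auto simp: \<Lambda>_def)
        moreover have "?a \<in> ?A" using q0 by auto
        ultimately show "y \<in> (\<lambda>a. \<lambda>i\<in>J. lin a i mod int q) ` ?A" by blast
      qed
      then show "finite (\<Lambda> ` H)" using finA finite_surj by blast
      have "card (\<Lambda> ` H) \<le> card ?A" using sub finA surj_card_le by blast
      also have "\<dots> = q ^ card S" using S(1) by (simp add: card_PiE)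
      also have "\<dots> \<le> q ^ m" using S(2) q0 by (intro power_increasing) auto
      finally show "card (\<Lambda> ` H) \<le> q ^ m" .
    qed
    define F where "F = PiE J (\<lambda>_. {0..<q})"
    define xf where "xf f = (\<lambda>i\<in>I. if i \<in> J then z i [^]\<^bsub>G i\<^esub> (f i :: nat) else \<one>\<^bsub>G i\<^esub>)" for f
    have xfc: "xf f \<in> carrier P" for f
      using C(1) by (auto simp: xf_def intro!: monoid.nat_pow_closed[OF group.is_monoid])
    have xfJ: "xf f i = z i [^]\<^bsub>G i\<^esub> f i" if "i \<in> J" for f i
      using that J(1) by (auto simp: xf_def)
    \<comment> \<open>Equal cosets get the same representative. Dividing by it lands in
      \<open>H\<close>, and the logarithms of the quotient are the differences of the exponents
      modulo \<open>q\<close>.\<close>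
    define rep where "rep A = (SOME f. f \<in> F \<and> H #>\<^bsub>P\<^esub> xf f = A)" for A
    have rep: "rep (H #>\<^bsub>P\<^esub> xf f) \<in> F \<and> H #>\<^bsub>P\<^esub> xf (rep (H #>\<^bsub>P\<^esub> xf f)) = H #>\<^bsub>P\<^esub> xf f" if "f \<in> F" for f
      unfolding rep_def by (rule someI[of _ f]) (use that in simp)
    define h where "h f = xf f \<otimes>\<^bsub>P\<^esub> inv\<^bsub>P\<^esub> (xf (rep (H #>\<^bsub>P\<^esub> xf f)))" for f
    have hH: "h f \<in> H" if f: "f \<in> F" for f
    proof -
      have "xf f \<in> H #>\<^bsub>P\<^esub> xf (rep (H #>\<^bsub>P\<^esub> xf f))"
        using rep[OF f] P.rcos_self[OF xfc Hs(1)] by metis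
      then show ?thesis unfolding h_def using subgroup.rcos_module_imp[OF Hs(1) group_P xfc] by blast
    qed
    have lh: "int q dvd l i (h f i) - (int (f i) - int (rep (H #>\<^bsub>P\<^esub> xf f) i))" if f: "f \<in> F" and i: "i \<in> J" for f i
    proof -
      have iI: "i \<in> I" using i J by blast
      interpret Gi: group "G i" using iI by simp
      let ?r = "rep (H #>\<^bsub>P\<^esub> xf f)"
      have "h f i \<otimes>\<^bsub>G i\<^esub> xf ?r i = xf f i"
        unfolding h_def comp_mult[OF iI] comp_inv[OF xfc iI]
        using proj_in[OF xfc iI] by (simp add: Gi.m_assoc)
      then have "int q dvd l i (xf f i) - (l i (h f i) + l i (xf ?r i))"
        using l(1)[OF i HC[OF hH[OF f] i], of "xf ?r i"] zpow[OF i] xfJ[OF i] by simp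
      moreover have "int q dvd l i (xf f i) - int (f i)" "int q dvd l i (xf ?r i) - int (?r i)"
        using l(2)[OF i] xfJ[OF i] by simp_all
      ultimately have "int q dvd (l i (xf f i) - int (f i)) - (l i (xf f i) - (l i (h f i) + l i (xf ?r i))) - (l i (xf ?r i) - int (?r i))"
        by (metis dvd_diff)
      then show ?thesis by (simp add: algebra_simps)
    qed
    have inj: "inj_on (\<lambda>f. (H #>\<^bsub>P\<^esub> xf f, \<Lambda> (h f))) F"
    proof (rule inj_onI)
      fix f g assume fg: "f \<in> F" "g \<in> F" and e: "(H #>\<^bsub>P\<^esub> xf f, \<Lambda> (h f)) = (H #>\<^bsub>P\<^esub> xf g, \<Lambda> (h g))"
      have "f i = g i" if i: "i \<in> J" for i
      proof -
        have "\<Lambda> (h f) i = \<Lambda> (h g) i" using e by simp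
        then have "int q dvd l i (h f i) - l i (h g i)" using i by (simp add: \<Lambda>_def mod_eq_dvd_iff)
        moreover have "int q dvd l i (h g i) - (int (g i) - int (rep (H #>\<^bsub>P\<^esub> xf f) i))" using lh[OF fg(2) i] e by simp
        ultimately have "int q dvd (l i (h f i) - l i (h g i)) - (l i (h f i) - (int (f i) - int (rep (H #>\<^bsub>P\<^esub> xf f) i)))
           + (l i (h g i) - (int (g i) - int (rep (H #>\<^bsub>P\<^esub> xf f) i)))"
          using lh[OF fg(1) i] by (metis dvd_add dvd_diff)
        then have "int q dvd int (f i) - int (g i)" by (simp add: algebra_simps)
        moreover have "f i < q" "g i < q" using fg i by (auto simp: F_def)
        ultimately show ?thesis
          by (simp add: mod_eq_dvd_iff[symmetric] zmod_int[symmetric])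
      qed
      then show "f = g" using fg unfolding F_def by (intro PiE_ext[of f J _ g]) auto
    qed
    have "(\<lambda>f. (H #>\<^bsub>P\<^esub> xf f, \<Lambda> (h f))) ` F \<subseteq> (rcosets\<^bsub>P\<^esub> H) \<times> (\<Lambda> ` H)"
      using hH P.rcosetsI[OF Hc xfc] by blast
    then have "card F \<le> card ((rcosets\<^bsub>P\<^esub> H) \<times> (\<Lambda> ` H))"
      using inj fin \<Lambda>H(1) by (intro card_inj_on_le) auto
    also have "\<dots> = c * card (\<Lambda> ` H)" by (simp add: card_cartesian_product c_def)
    also have "\<dots> \<le> c * q ^ m" using \<Lambda>H(2) by simp
    finally show ?thesis using J(2) by (simp add: F_def card_PiE q_def)
  qed
  show ?thesis
  proof (rule ccontr)
    assume "\<not> ?thesis"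
    then have m: "Suc m \<le> card J" by (simp add: J_def)
    have p2: "2 \<le> p" using p prime_ge_2_nat by blast
    \<comment> \<open>The choice \<open>N = c\<close> suffices: cancelling the common factor in
      \<open>count\<close> leaves \<open>p ^ c \<le> c\<close>, which is impossible.\<close>
    let ?Q = "p ^ c"
    have "?Q * ?Q ^ m = ?Q ^ Suc m" by simp
    also have "\<dots> \<le> ?Q ^ card J" using m p2 by (intro power_increasing) auto
    also have "\<dots> \<le> c * ?Q ^ m" by (rule count)
    finally have "?Q \<le> c" using p2 by simp
    moreover have "c < 2 ^ c" by (rule less_exp)
    moreover have "(2::nat) ^ c \<le> ?Q" using p2 by (rule power_mono) simp
    ultimately show False by linarith
  qed
qed

end

theorem theorem1:
  fixes n :: nat
    and G :: "nat \<Rightarrow> 'a monoid"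
    and T :: "nat \<Rightarrow> 'a topology"
    and d :: enat
    and r :: nat
    and r_p :: "nat \<Rightarrow> nat"
  assumes "n \<ge> 1"
    and "\<And>i. i \<in> {1..n} \<Longrightarrow> profinite_group (G i) (T i)"
    and "\<And>i. i \<in> {1..n} \<Longrightarrow> hereditarily_just_infinite (G i) (T i)"
    and "\<And>i. i \<in> {1..n} \<Longrightarrow> lower_rank (G i) (T i) < \<infinity>"
    and "d = Max {lower_rank (G i) (T i) | i. i \<in> {1..n}}"
    and "\<And>p. prime p \<Longrightarrow> r_p p = card {i \<in> {1..n}. virtually_Zp p (G i) (T i)}"
    and "r = Max {r_p p | p. prime p}"
  shows "lower_rank (product_group {1..n} G) (product_topology T {1..n}) = max d (enat r)"
proof -
  have "hji_group (G i) (T i)" if "i \<in> {1..n}" for i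
    using assms(2)[OF that] assms(3)[OF that] by (simp add: hji_group_def hji_group_axioms_def)
  then interpret hji_family "{1..n}" G T
    by (intro hji_family.intro) auto
  have D: "finite {lower_rank (G i) (T i) | i. i \<in> {1..n}}" "{lower_rank (G i) (T i) | i. i \<in> {1..n}} \<noteq> {}"
    using assms(1) by auto
  \<comment> \<open>The maximum runs over infinitely many primes, but each value counts indices and
    is at most \<open>n\<close>, so the set of values is finite.\<close>
  have "{r_p p | p. prime p} \<subseteq> {..n}"
  proof
    fix x assume "x \<in> {r_p p | p. prime p}"
    then obtain p where p: "prime p" "x = r_p p" by blast
    have "r_p p \<le> card {1..n}" unfolding assms(6)[OF p(1)] by (intro card_mono) auto
    then show "x \<in> {..n}" using p(2) by simp
  qed
  then have R: "finite {r_p p | p. prime p}" "{r_p p | p. prime p} \<noteq> {}"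
    using finite_subset two_is_prime_nat by blast+
  have dle: "d \<le> e \<longleftrightarrow> (\<forall>i\<in>{1..n}. lower_rank (G i) (T i) \<le> e)" for e
    unfolding assms(5) Max_le_iff[OF D] by blast
  have rle: "r \<le> m \<longleftrightarrow> (\<forall>p. prime p \<longrightarrow> card {i \<in> {1..n}. virtually_Zp p (G i) (T i)} \<le> m)" for m
    unfolding assms(7) Max_le_iff[OF R] using assms(6) by auto
  \<comment> \<open>Extended naturals with the same finite upper bounds are equal, so it suffices to
    compare both sides with each finite \<open>m\<close>.\<close>
  have "lower_rank P TP \<le> enat m \<longleftrightarrow> max d (enat r) \<le> enat m" for m
  proof
    assume a: "lower_rank P TP \<le> enat m"
    have "d \<le> enat m" unfolding dle using lower_rank_factor_le[OF _ a] by blast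
    moreover have "r \<le> m" unfolding rle using card_virtually_Zp_le[OF _ a] by blast
    ultimately show "max d (enat r) \<le> enat m" by simp
  next
    assume "max d (enat r) \<le> enat m"
    then have "d \<le> enat m" "r \<le> m" by auto
    then show "lower_rank P TP \<le> enat m"
      unfolding dle rle by (intro lower_rank_product_le) auto
  qed
  then show ?thesis by (metis enat_ord_code(3) enat.exhaust order_antisym order_refl)
qed

end
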